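(* Let $(\mathcal U,C)$ be a solid and walled chambered set for $(W,S)$. Then the $0$-Shi polyhedron satisfies $$\mathscr S_0=\bigcup_{w\in L_0}C_{w^{-1}}.$$
   Context: Let $(W,S)$ be a Coxeter system with length function $\ell$, realized via a geometric representation on a real vector space $V$ with symmetric bilinear form $B$, simple roots $\Delta=\{\alpha_s\mid s\in S\}$ ($B(\alpha_s,\alpha_s)=1$), $\Phi=W(\Delta)$, $\Phi^+=\Phi\cap\operatorname{cone}(\Delta)$, $\Phi^-=-\Phi^+$; $s_\beta$ is the reflection in $\beta\in\Phi$. $\Phi(w)=\Phi^+\cap w(\Phi^-)$; $\Phi^1(w)=\{\beta\in\Phi^+\mid\ell(s_\beta w)=\ell(w)-1\}$. Dominance order on $\Phi^+$: $\alpha\preceq_{\operatorname{dom}}\beta$ iff for all $x\in W$, $\beta\in\Phi(x)\Rightarrow\alpha\in\Phi(x)$; $\operatorname{dp}_\infty(\beta)=|\{\alpha\in\Phi^+\setminus\{\beta\}\mid\alpha\preceq_{\operatorname{dom}}\beta\}|$; $\Sigma_m=\{\beta\in\Phi^+\mid\operatorname{dp}_\infty(\beta)\le m\}$; $L_m=\{x\in W\mid\Phi^1(x)\subseteq\Sigma_m\}$. A chambered set for $(W,S)$ is a pair $(\mathcal U,C)$ where $\mathcal U$ is a left $W$-set and $C\subseteq\mathcal U$ is a set of representatives of the $W$-orbits such that the stabilizer of each $a\in C$ is a standard parabolic subgroup $W_J$. It is solid if some $a\in C$ has trivial stabilizer, walled if for each $s\in S$ some $a\in C$ has stabilizer $\{e,s\}$.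 Chambers: $C_w=wC$. For $\alpha\in\Phi$, $H_\alpha^+=\bigcup\{C_x\mid x\in W,\ x^{-1}(\alpha)\in\Phi^+\}$. Let $\mathcal B_m=\{x^{-1}(\alpha_s)\mid x\in L_m,\ s\in S,\ sx\notin L_m\}$ and define the $m$-Shi polyhedron $\mathscr S_m=\bigcap_{\beta\in\mathcal B_m}H_\beta^+$. *)

theory Defs
  imports
    "HOL-Analysis.Analysis"
    "HOL-Algebra.Group_Action"
    "HOL-Algebra.Generated_Groups"
    "HOL-Algebra.Multiplicative_Group"
    "HOL-Library.Extended_Nat"
begin

context group
begin

definition word_prod :: "'a list \<Rightarrow> 'a" where
  "word_prod ws = foldr (\<otimes>) ws \<one>"

text \<open>The congruence on words over \<open>S\<close> generated by the relations \<open>(s t)\<^sup>m = 1\<close>, where \<open>m\<close> is the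
  order of \<open>s t\<close> in the group. Since \<^const>\<open>group.ord\<close> is \<open>0\<close> on elements of infinite order, no
  relation is imposed on such pairs. The case \<open>s = t\<close>, \<open>m = 1\<close> gives the relations \<open>s s = 1\<close>, so
  that no formal inverses are needed.\<close>

inductive coxeter_equiv :: "'a set \<Rightarrow> 'a list \<Rightarrow> 'a list \<Rightarrow> bool" for S where
  refl: "ws \<in> lists S \<Longrightarrow> coxeter_equiv S ws ws"
| sym: "coxeter_equiv S us ws \<Longrightarrow> coxeter_equiv S ws us"
| trans: "coxeter_equiv S us vs \<Longrightarrow> coxeter_equiv S vs ws \<Longrightarrow> coxeter_equiv S us ws"
| relation: "us \<in> lists S \<Longrightarrow> vs \<in> lists S \<Longrightarrow> s \<in> S \<Longrightarrow> t \<in> S \<Longrightarrow> ord (s \<otimes> t) \<noteq> 0 \<Longrightarrow>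
    coxeter_equiv S (us @ concat (replicate (ord (s \<otimes> t)) [s, t]) @ vs) (us @ vs)"

end

text \<open>The last assumption says that the defining relations of the Coxeter presentation suffice;
  that they hold in \<open>W\<close> is automatic. The set \<open>S\<close> may be infinite.\<close>

locale coxeter_system = group W for W :: "('w, 'x) monoid_scheme" (structure) +
  fixes S :: "'w set"
  assumes S_subset: "S \<subseteq> carrier W"
    and S_generates: "generate W S = carrier W"
    and S_involutions: "s \<in> S \<Longrightarrow> ord s = 2"
    and presentation: "us \<in> lists S \<Longrightarrow> vs \<in> lists S \<Longrightarrow> word_prod us = word_prod vs \<Longrightarrow>
      coxeter_equiv S us vs"
begin

definition len :: "'w \<Rightarrow> nat" where
  "len w = (LEAST n. \<exists>ws \<in> lists S. length ws = n \<and> word_prod ws = w)"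

end

text \<open>\<open>\<rho>\<close> is the action of \<open>W\<close> on \<open>V = UNIV\<close>; it is linear and preserves \<open>B\<close> because the elements of
  \<open>S\<close> act by reflections. The simple roots are only required to be positively linearly
  independent, which covers the case where they form a basis of \<open>V\<close>.\<close>

locale geometric_representation = coxeter_system W S + action: group_action W UNIV \<rho>
  for W :: "('w, 'x) monoid_scheme" (structure) and S :: "'w set" and \<rho> :: "'w \<Rightarrow> 'v::real_vector \<Rightarrow> 'v" +
  fixes B :: "'v \<Rightarrow> 'v \<Rightarrow> real" and \<alpha> :: "'w \<Rightarrow> 'v"
  assumes bilinear_B: "bilinear B"
    and symmetric_B: "B u v = B v u"
    and simple_norm: "s \<in> S \<Longrightarrow> B (\<alpha> s) (\<alpha> s) = 1"
    and simple_finite: "s \<in> S \<Longrightarrow> t \<in> S \<Longrightarrow> s \<noteq> t \<Longrightarrow> ord (s \<otimes> t) \<noteq> 0 \<Longrightarrow>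
      B (\<alpha> s) (\<alpha> t) = - cos (pi / real (ord (s \<otimes> t)))"
    and simple_infinite: "s \<in> S \<Longrightarrow> t \<in> S \<Longrightarrow> s \<noteq> t \<Longrightarrow> ord (s \<otimes> t) = 0 \<Longrightarrow>
      B (\<alpha> s) (\<alpha> t) \<le> - 1"
    and simple_positively_independent: "finite F \<Longrightarrow> F \<subseteq> S \<Longrightarrow> (\<And>s. s \<in> F \<Longrightarrow> 0 \<le> c s) \<Longrightarrow>
      (\<Sum>s\<in>F. c s *\<^sub>R \<alpha> s) = 0 \<Longrightarrow> s \<in> F \<Longrightarrow> c s = 0"
    and simple_reflection: "s \<in> S \<Longrightarrow> \<rho> s v = v - (2 * B (\<alpha> s) v) *\<^sub>R \<alpha> s"
begin

definition roots :: "'v set" where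
  "roots = {\<rho> w (\<alpha> s) | w s. w \<in> carrier W \<and> s \<in> S}"

definition pos_roots :: "'v set" where
  "pos_roots = roots \<inter> convex_cone hull (\<alpha> ` S)"

definition neg_roots :: "'v set" where
  "neg_roots = uminus ` pos_roots"

text \<open>The element of \<open>W\<close> acting as the reflection in \<open>\<beta>\<close>; it is unique because the action of \<open>W\<close> on
  \<open>V\<close> is faithful.\<close>

definition root_reflection :: "'v \<Rightarrow> 'w" where
  "root_reflection \<beta> = (THE t. t \<in> carrier W \<and> (\<forall>v. \<rho> t v = v - (2 * B \<beta> v) *\<^sub>R \<beta>))"

definition inversions :: "'w \<Rightarrow> 'v set" where
  "inversions w = pos_roots \<inter> \<rho> w ` neg_roots"

definition short_inversions :: "'w \<Rightarrow> 'v set" where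
  "short_inversions w = {\<beta> \<in> pos_roots. len (root_reflection \<beta> \<otimes> w) + 1 = len w}"

definition dominated_by :: "'v \<Rightarrow> 'v \<Rightarrow> bool" where
  "dominated_by \<gamma> \<beta> \<longleftrightarrow> (\<forall>x \<in> carrier W. \<beta> \<in> inversions x \<longrightarrow> \<gamma> \<in> inversions x)"

definition inf_depth :: "'v \<Rightarrow> enat" where
  "inf_depth \<beta> = (let D = {\<gamma> \<in> pos_roots - {\<beta>}. dominated_by \<gamma> \<beta>}
     in if finite D then enat (card D) else \<infinity>)"

definition small_roots :: "nat \<Rightarrow> 'v set" where
  "small_roots m = {\<beta> \<in> pos_roots. inf_depth \<beta> \<le> enat m}"

definition low_elements :: "nat \<Rightarrow> 'w set" where
  "low_elements m = {x \<in> carrier W. short_inversions x \<subseteq> small_roots m}"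

definition shi_boundary_roots :: "nat \<Rightarrow> 'v set" where
  "shi_boundary_roots m =
     {\<rho> (inv x) (\<alpha> s) | x s. x \<in> low_elements m \<and> s \<in> S \<and> s \<otimes> x \<notin> low_elements m}"

end

locale chambered_set = coxeter_system W S + U_action: group_action W U \<phi>
  for W :: "('w, 'x) monoid_scheme" (structure) and S :: "'w set" and U :: "'u set" and \<phi> :: "'w \<Rightarrow> 'u \<Rightarrow> 'u" +
  fixes C :: "'u set"
  assumes C_subset: "C \<subseteq> U"
    and C_representatives: "X \<in> orbits W U \<phi> \<Longrightarrow> \<exists>!a. a \<in> C \<and> a \<in> X"
    and C_stabilizers: "a \<in> C \<Longrightarrow> \<exists>J \<subseteq> S. stabilizer W \<phi> a = generate W J"
begin

definition solid :: bool where
  "solid \<longleftrightarrow> (\<exists>a \<in> C. stabilizer W \<phi> a = {\<one>})"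

definition walled :: bool where
  "walled \<longleftrightarrow> (\<forall>s \<in> S. \<exists>a \<in> C. stabilizer W \<phi> a = {\<one>, s})"

definition chamber :: "'w \<Rightarrow> 'u set" where
  "chamber w = \<phi> w ` C"

end

locale geometric_chambered_set =
  geometric_representation W S \<rho> B \<alpha> + chambered_set W S U \<phi> C
  for W :: "('w, 'x) monoid_scheme" (structure) and S :: "'w set"
    and \<rho> :: "'w \<Rightarrow> 'v::real_vector \<Rightarrow> 'v" and B :: "'v \<Rightarrow> 'v \<Rightarrow> real" and \<alpha> :: "'w \<Rightarrow> 'v"
    and U :: "'u set" and \<phi> :: "'w \<Rightarrow> 'u \<Rightarrow> 'u" and C :: "'u set"
begin

definition half_space :: "'v \<Rightarrow> 'u set" where
  "half_space \<beta> = (\<Union>x \<in> {x \<in> carrier W. \<rho> (inv x) \<beta> \<in> pos_roots}. chamber x)"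

text \<open>The intersection is taken inside \<open>U\<close>, so it is \<open>U\<close> if there are no boundary roots.\<close>

definition shi_polyhedron :: "nat \<Rightarrow> 'u set" where
  "shi_polyhedron m = U \<inter> (\<Inter>\<beta> \<in> shi_boundary_roots m. half_space \<beta>)"

end

end

theory Submission
  imports Defs
begin

text \<open>Everything rests on a descent property of non-small roots (those dominating another positive
  root): if a short inversion of \<open>x\<close> is non-small, then so is \<open>- \<rho> x (\<alpha> r)\<close> for some right descent
  \<open>r\<close> of \<open>x\<close>. A non-small short inversion is moved down in depth by passing, inside rank two systems,
  from a root \<open>f\<close> to a root \<open>a = x f + y e\<close> with \<open>f\<close> indecomposable; that non-smallness survives this
  step is a statement about a rank two system and one further root dominated by \<open>f\<close>, whose
  exceptional case is excluded by a second positive system of the rank three system they span.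

  The descent property implies that \<open>L\<^sub>0\<close> is closed under suffixes and that every \<open>x \<in> L\<^sub>0\<close> keeps
  every boundary root positive, so the chambers indexed by \<open>L\<^sub>0\<close> lie in the polyhedron. Conversely let
  \<open>u = w a\<close> with \<open>a \<in> C\<close> and \<open>w\<close> of minimal length in its coset modulo the stabilizer of \<open>a\<close>. If
  \<open>w\<inverse> \<notin> L\<^sub>0\<close>, a reduced word of \<open>w\<inverse>\<close> leaves \<open>L\<^sub>0\<close> through a boundary root \<open>\<beta>\<close> inverted by \<open>w\<close>. Were \<open>u\<close>
  in the half space of \<open>\<beta>\<close>, the reflection in \<open>w\<inverse> \<beta>\<close> would fix \<open>a\<close>, and \<open>s\<^sub>\<beta> w\<close> would be a shorter
  element of the coset.\<close>

section \<open>Reflection systems and dominance\<close>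

text \<open>Dominance is converted into form values: for distinct positive roots it forces a value
  of at least 1, and a value of at least 1 forces comparability. The planes and rank three spans
  that occur are not generated by simple reflections of \<open>W\<close> and come without simple
  roots. What remains available is an ambient cone for the signs and the finiteness of the set of
  positive roots that a group element inverts; this is the reason for the abstract locale
  \<open>reflection_system\<close>. In a plane with canonical roots \<open>b\<close> and
  \<open>e\<close>, reflecting a non-small root at a nonpositive form value keeps it non-small. This
  settles every root between \<open>b\<close> and \<open>e\<close> once \<open>refl b e\<close> is
  known to be non-small; that root arises from \<open>e\<close>, which may be small, and is the
  source of the exceptional case. Right descents are singled out because
  \<open>- \<rho> x (\<alpha> r)\<close> changes well under left multiplication by a generator: it
  is mapped to the corresponding root of the product, which is not known for an arbitrary short
  inversion.\<close>

text \<open>This is the Chebyshev polynomial of the second kind of degree \<open>n - 1\<close>. With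
  \<open>y = - B a b\<close>, consecutive values are the coordinates of the roots obtained from
  \<open>a\<close> and \<open>b\<close> by alternating reflections.\<close>

fun cheb :: "real \<Rightarrow> nat \<Rightarrow> real" where
  "cheb y 0 = 0"
| "cheb y (Suc 0) = 1"
| "cheb y (Suc (Suc n)) = 2 * y * cheb y (Suc n) - cheb y n"

text \<open>Stands in for the trigonometric solution. The differences of a positive solution
  decrease strictly. A negative difference would drive it below 0 linearly, so it increases; then
  the differences fall by at least \<open>2 * (1 - y) * a 0\<close> at every step and turn negative
  after all.\<close>

lemma oscillating_recurrence:
  fixes a :: "nat \<Rightarrow> real"
  assumes rec: "\<And>n. a (Suc (Suc n)) = 2 * y * a (Suc n) - a n" and y: "y < 1"
  shows "\<exists>n. a n \<le> 0"
proof (rule ccontr)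
  assume "\<not> ?thesis"
  then have pos: "a n > 0" for n by (simp add: not_le)
  define D where "D n = a (Suc n) - a n" for n
  have D_Suc: "D (Suc n) = D n - 2 * (1 - y) * a (Suc n)" for n
    by (simp add: D_def rec algebra_simps)
  have D_less: "D (Suc n) < D n" for n
    using D_Suc[of n] y pos[of "Suc n"] by simp
  have a_sum: "a n = a 0 + (\<Sum>k<n. D k)" for n
    by (induction n) (auto simp: D_def)
  have no_neg: "\<not> D n < 0" for n
  proof
    assume neg: "D n < 0"
    have le: "D (n + k) \<le> D n" for k
    proof (induction k)
      case (Suc k)
      then show ?case using D_less[of "n + k"] by simp
    qed simp
    have bound: "a (n + k) \<le> a n + real k * D n" for k
    proof (induction k)
      case (Suc k)
      then show ?case using le[of k] by (simp add: D_def algebra_simps)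
    qed simp
    obtain k where "real k * (- D n) > a n"
      using reals_Archimedean3[of "- D n"] neg by auto
    then show False using bound[of k] pos[of "n + k"] by simp
  qed
  then have D_nonneg: "D n \<ge> 0" for n by (simp add: not_less)
  have mono: "a 0 \<le> a n" for n
    using a_sum[of n] D_nonneg by (simp add: sum_nonneg)
  define e where "e = 2 * (1 - y) * a 0"
  have e: "e > 0" using y pos[of 0] by (simp add: e_def)
  have bound: "D n \<le> D 0 - real n * e" for n
  proof (induction n)
    case (Suc n)
    have "e \<le> 2 * (1 - y) * a (Suc n)"
      unfolding e_def using mono[of "Suc n"] y by (intro mult_left_mono) auto
    then show ?case using Suc D_Suc[of n] by (simp add: algebra_simps)
  qed simp
  obtain n where "real n * e > D 0"
    using reals_Archimedean3[OF e] by auto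
  then show False using bound[of n] no_neg[of n] by simp
qed

lemma cheb_first_nonpos:
  assumes "y < 1"
  obtains n where "\<And>k. 1 \<le> k \<Longrightarrow> k \<le> Suc n \<Longrightarrow> cheb y k > 0" and "cheb y (Suc (Suc n)) \<le> 0"
proof -
  define Q where "Q n \<longleftrightarrow> cheb y (Suc n) \<le> 0" for n
  have "\<exists>n. Q n"
    unfolding Q_def by (rule oscillating_recurrence[OF _ assms]) simp
  then have Q: "Q (LEAST n. Q n)" by (rule LeastI_ex)
  moreover have "\<not> Q 0" by (simp add: Q_def)
  ultimately have "(LEAST n. Q n) \<noteq> 0" by metis
  then obtain n where n: "(LEAST n. Q n) = Suc n" by (cases "LEAST n. Q n") auto
  have "cheb y k > 0" if "1 \<le> k" "k \<le> Suc n" for k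
  proof -
    have "\<not> Q (k - 1)" using not_less_Least[of "k - 1" Q] n that by auto
    then show ?thesis using that by (simp add: Q_def not_le)
  qed
  moreover have "cheb y (Suc (Suc n)) \<le> 0" using Q n by (simp add: Q_def)
  ultimately show ?thesis by (rule that)
qed

text \<open>The step size never drops below its initial value 1, so a plane with such a
  \<open>y\<close> carries infinitely many roots.\<close>

lemma cheb_diff_ge: "y \<ge> 1 \<Longrightarrow> cheb y (Suc n) \<ge> cheb y n + 1 \<and> cheb y n \<ge> 0"
proof (induction n)
  case (Suc n)
  then have *: "cheb y (Suc n) \<ge> cheb y n + 1" "cheb y n \<ge> 0" by auto
  then have "cheb y (Suc n) \<ge> 0" by simp
  then have "2 * 1 * cheb y (Suc n) \<le> 2 * y * cheb y (Suc n)"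
    using Suc.prems by (intro mult_right_mono) auto
  then have "2 * y * cheb y (Suc n) - cheb y n \<ge> cheb y (Suc n) + 1" using *(1) by linarith
  then show ?case using * by simp
qed simp

lemma cheb_less: "y \<ge> 1 \<Longrightarrow> m < n \<Longrightarrow> cheb y m < cheb y n"
  by (rule lift_Suc_mono_less) (use cheb_diff_ge[of y] in \<open>smt (verit)\<close>)

lemma cheb_nonneg: "y \<ge> 1 \<Longrightarrow> cheb y n \<ge> 0"
  using cheb_diff_ge by blast

lemma comb_diff_scale:
  fixes a b :: "'a::real_vector"
  shows "(p *\<^sub>R a - q *\<^sub>R b) - k *\<^sub>R (u *\<^sub>R a - w *\<^sub>R b) = (p - k * u) *\<^sub>R a - (q - k * w) *\<^sub>R b"
  by (simp add: algebra_simps)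

lemma minus_comb:
  fixes a b :: "'a::real_vector"
  shows "- (p *\<^sub>R a - q *\<^sub>R b) = (- p) *\<^sub>R a - (- q) *\<^sub>R b"
  by simp

section \<open>Abstract reflection systems\<close>

text \<open>The salient cone \<open>K\<close> decides the signs of roots, and
  \<open>M_finite\<close> plays the part of the length function: infinite families of roots are
  refuted through it. Simple roots are not part of the data.\<close>

locale reflection_system =
  fixes B :: "'v::real_vector \<Rightarrow> 'v \<Rightarrow> real" and K R :: "'v set" and M :: "('v \<Rightarrow> 'v) set"
  assumes B_bilinear: "bilinear B"
    and B_sym: "B u v = B v u"
    and K_add: "x \<in> K \<Longrightarrow> y \<in> K \<Longrightarrow> x + y \<in> K"
    and K_scale: "0 \<le> c \<Longrightarrow> x \<in> K \<Longrightarrow> c *\<^sub>R x \<in> K"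
    and K_salient: "x \<in> K \<Longrightarrow> - x \<in> K \<Longrightarrow> x = 0"
    and R_norm: "r \<in> R \<Longrightarrow> B r r = 1"
    and R_signed: "r \<in> R \<Longrightarrow> r \<in> K \<or> - r \<in> K"
    and M_linear: "g \<in> M \<Longrightarrow> linear g"
    and M_B: "g \<in> M \<Longrightarrow> B (g u) (g v) = B u v"
    and M_R: "g \<in> M \<Longrightarrow> r \<in> R \<Longrightarrow> g r \<in> R"
    and M_comp: "g \<in> M \<Longrightarrow> h \<in> M \<Longrightarrow> g \<circ> h \<in> M"
    and M_inv: "g \<in> M \<Longrightarrow> \<exists>h \<in> M. h \<circ> g = id \<and> g \<circ> h = id"
    and M_refl: "r \<in> R \<Longrightarrow> (\<lambda>v. v - (2 * B r v) *\<^sub>R r) \<in> M"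
    and M_finite: "g \<in> M \<Longrightarrow> finite {r \<in> R \<inter> K. g r \<notin> K}"
begin

definition refl :: "'v \<Rightarrow> 'v \<Rightarrow> 'v" where "refl r v = v - (2 * B r v) *\<^sub>R r"

definition P :: "'v set" where "P = R \<inter> K"

lemmas B_simps = bilinear_ladd[OF B_bilinear] bilinear_radd[OF B_bilinear]
  bilinear_lmul[OF B_bilinear] bilinear_rmul[OF B_bilinear]
  bilinear_lsub[OF B_bilinear] bilinear_rsub[OF B_bilinear]
  bilinear_lneg[OF B_bilinear] bilinear_rneg[OF B_bilinear]
  bilinear_lzero[OF B_bilinear] bilinear_rzero[OF B_bilinear]

lemma refl_M: "r \<in> R \<Longrightarrow> refl r \<in> M"
  using M_refl by (simp add: refl_def[abs_def])

lemma refl_add: "refl r (u + v) = refl r u + refl r v"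
  by (simp add: refl_def B_simps algebra_simps)

lemma refl_scale: "refl r (c *\<^sub>R v) = c *\<^sub>R refl r v"
  by (simp add: refl_def B_simps algebra_simps)

lemma refl_minus: "refl r (- v) = - refl r v"
  by (simp add: refl_def B_simps)

lemma refl_self: "r \<in> R \<Longrightarrow> refl r r = - r"
  using R_norm[of r] by (simp add: refl_def scaleR_2)

lemma refl_comb:
  assumes "r \<in> R"
  shows "refl r (x *\<^sub>R r + y *\<^sub>R b) = (- x - 2 * y * B r b) *\<^sub>R r + y *\<^sub>R b"
proof -
  have "refl r (x *\<^sub>R r + y *\<^sub>R b) = x *\<^sub>R r + y *\<^sub>R b - (2 * (x + y * B r b)) *\<^sub>R r"
    using R_norm[OF assms] by (simp add: refl_def B_simps)
  also have "\<dots> = (x - 2 * (x + y * B r b)) *\<^sub>R r + y *\<^sub>R b"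
    by (simp only: scaleR_left_diff_distrib diff_add_eq)
  also have "x - 2 * (x + y * B r b) = - x - 2 * y * B r b" by simp
  finally show ?thesis .
qed

lemma refl_refl: "r \<in> R \<Longrightarrow> refl r (refl r v) = v"
  using R_norm[of r] by (simp add: refl_def B_simps algebra_simps)

lemma refl_B: "r \<in> R \<Longrightarrow> B (refl r u) (refl r v) = B u v"
  using refl_M M_B by blast

lemma refl_R: "r \<in> R \<Longrightarrow> u \<in> R \<Longrightarrow> refl r u \<in> R"
  using refl_M M_R by blast

lemma neg_R: "r \<in> R \<Longrightarrow> - r \<in> R"
  using refl_R[of r r] refl_self[of r] by simp

lemma R_nonzero: "r \<in> R \<Longrightarrow> r \<noteq> 0"
  using R_norm[of r] by (auto simp: B_simps)

lemma P_R: "r \<in> P \<Longrightarrow> r \<in> R" and P_K: "r \<in> P \<Longrightarrow> r \<in> K"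
  by (auto simp: P_def)

lemma not_P_iff: "r \<in> R \<Longrightarrow> r \<notin> P \<longleftrightarrow> - r \<in> P"
  using R_signed[of r] K_salient[of r] R_nonzero[of r] neg_R[of r] by (auto simp: P_def)

lemma P_neg: "r \<in> P \<Longrightarrow> - r \<notin> P"
  using not_P_iff[of "- r"] neg_R P_R by force

lemma R_nonneg_comb:
  assumes "x *\<^sub>R a + y *\<^sub>R b \<in> R" "a \<in> K" "b \<in> K" "x \<ge> 0" "y \<ge> 0"
  shows "x *\<^sub>R a + y *\<^sub>R b \<in> P"
  using assms by (auto simp: P_def K_add K_scale)

lemma positive_relation:
  assumes "x *\<^sub>R a + y *\<^sub>R b = 0" "a \<in> K" "b \<in> K" "x \<ge> 0" "y \<ge> 0" "a \<noteq> 0" "b \<noteq> 0"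
  shows "x = 0 \<and> y = 0"
proof -
  have e: "- (x *\<^sub>R a) = y *\<^sub>R b" using assms(1) by (simp add: add_eq_0_iff)
  then have "x *\<^sub>R a = 0" using K_salient[of "x *\<^sub>R a"] K_scale assms by metis
  then show ?thesis using assms e by auto
qed

lemma finite_inverted: "g \<in> M \<Longrightarrow> finite {r \<in> P. g r \<notin> P}"
  by (rule finite_subset[OF _ M_finite[of g]]) (auto simp: P_def dest: M_R)

lemma M_add: "g \<in> M \<Longrightarrow> g (u + v) = g u + g v"
  and M_scale: "g \<in> M \<Longrightarrow> g (c *\<^sub>R v) = c *\<^sub>R g v"
  and M_minus: "g \<in> M \<Longrightarrow> g (- v) = - g v"
  and M_diff: "g \<in> M \<Longrightarrow> g (u - v) = g u - g v"
  using M_linear[of g] by (auto simp: linear_add linear_scale linear_neg linear_diff)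

lemma id_M: "r \<in> R \<Longrightarrow> id \<in> M"
  using M_comp[OF refl_M refl_M, of r r] refl_refl[of r]
  by (metis (no_types, lifting) comp_apply eq_id_iff)

text \<open>\<open>refl a\<close> and \<open>refl b\<close> exchange the two kinds of root, and each
  reflection performs one step of the recurrence.\<close>

lemma cheb_roots:
  assumes "a \<in> R" "b \<in> R" and y: "y = - B a b"
  shows "cheb y (Suc n) *\<^sub>R a + cheb y n *\<^sub>R b \<in> R \<and> cheb y n *\<^sub>R a + cheb y (Suc n) *\<^sub>R b \<in> R"
proof (induction n)
  case 0
  then show ?case using assms by simp
next
  case (Suc n)
  have 1: "refl a (cheb y n *\<^sub>R a + cheb y (Suc n) *\<^sub>R b)
      = cheb y (Suc (Suc n)) *\<^sub>R a + cheb y (Suc n) *\<^sub>R b"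
    using y by (simp add: refl_comb[OF assms(1)])
  have 2: "refl b (cheb y (Suc n) *\<^sub>R a + cheb y n *\<^sub>R b)
      = cheb y (Suc n) *\<^sub>R a + cheb y (Suc (Suc n)) *\<^sub>R b"
    using y B_sym[of b a] refl_comb[OF assms(2), of "cheb y n" "cheb y (Suc n)" a]
    by (simp add: add.commute)
  show ?case
    using Suc refl_R[OF assms(1)] refl_R[OF assms(2)] 1 2 by metis
qed

lemma cheb_roots':
  assumes "a \<in> R" "b \<in> R" and y: "y = B a b"
  shows "cheb y (Suc n) *\<^sub>R a - cheb y n *\<^sub>R b \<in> R"
  using cheb_roots[OF assms(1) neg_R[OF assms(2)], of y n] y by (simp add: B_simps)

lemma cheb_comb_inj:
  assumes "a \<in> P" "b \<in> P" and y: "y \<ge> 1"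
  shows "inj (\<lambda>n. cheb y (Suc n) *\<^sub>R a + cheb y n *\<^sub>R b)"
proof (rule injI, rule ccontr)
  have lt: False if "m < n" "cheb y (Suc m) *\<^sub>R a + cheb y m *\<^sub>R b = cheb y (Suc n) *\<^sub>R a + cheb y n *\<^sub>R b" for m n
  proof -
    have "(cheb y (Suc n) - cheb y (Suc m)) *\<^sub>R a + (cheb y n - cheb y m) *\<^sub>R b = 0"
      using that(2) by (simp add: algebra_simps)
    moreover have "cheb y (Suc n) - cheb y (Suc m) > 0" "cheb y n - cheb y m > 0"
      using cheb_less[OF y that(1)] cheb_less[OF y, of "Suc m" "Suc n"] that(1) by auto
    ultimately show False
      using positive_relation[of "cheb y (Suc n) - cheb y (Suc m)" a "cheb y n - cheb y m" b]
        assms P_R P_K R_nonzero by (metis less_eq_real_def less_irrefl)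
  qed
  fix m n assume "cheb y (Suc m) *\<^sub>R a + cheb y m *\<^sub>R b = cheb y (Suc n) *\<^sub>R a + cheb y n *\<^sub>R b" "m \<noteq> n"
  then show False using lt[of m n] lt[of n m] by (metis nat_neq_iff)
qed

text \<open>If the form value is at most -1, alternating reflections produce infinitely many
  nonnegative combinations of \<open>a\<close> and \<open>b\<close>. Together with \<open>a\<close>
  and \<open>b\<close>, all of them would be inverted by \<open>g\<close>.\<close>

lemma inverted_pair_B:
  assumes g: "g \<in> M" and ab: "a \<in> P" "b \<in> P" and neg: "g a \<notin> P" "g b \<notin> P"
  shows "B a b > - 1"
proof (rule ccontr)
  assume nt: "\<not> ?thesis"
  define y where "y = - B a b"
  have y: "y \<ge> 1" using nt by (simp add: y_def)
  define r where "r n = cheb y (Suc n) *\<^sub>R a + cheb y n *\<^sub>R b" for n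
  have R: "r n \<in> R" for n unfolding r_def using cheb_roots[OF _ _ y_def] ab P_R by blast
  have P: "r n \<in> P" for n unfolding r_def
    by (rule R_nonneg_comb[OF R[unfolded r_def]]) (use ab P_K cheb_nonneg[OF y] in auto)
  have "- g (r n) = cheb y (Suc n) *\<^sub>R (- g a) + cheb y n *\<^sub>R (- g b)" for n
    unfolding r_def by (simp add: M_add[OF g] M_scale[OF g])
  moreover have "- g a \<in> P" "- g b \<in> P" using neg not_P_iff M_R[OF g] ab P_R by blast+
  ultimately have "- g (r n) \<in> P" for n
    using R_nonneg_comb[of "cheb y (Suc n)" "- g a" "cheb y n" "- g b"] neg_R[OF M_R[OF g R[of n]]]
      cheb_nonneg[OF y] P_K by metis
  then have "g (r n) \<notin> P" for n using P_neg by fastforce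
  then have "range r \<subseteq> {x \<in> P. g x \<notin> P}" using P by auto
  then have "finite (range r)" using finite_inverted[OF g] finite_subset by blast
  moreover have "inj r" unfolding r_def using cheb_comb_inj[OF ab y] .
  ultimately show False using finite_imageD by blast
qed

section \<open>The dominance order\<close>

text \<open>\<open>dom b c\<close> reads: \<open>b\<close> dominates \<open>c\<close>. It is not
  restricted to positive roots, so that it can be moved by group elements and reversed by
  negation.\<close>

definition dom :: "'v \<Rightarrow> 'v \<Rightarrow> bool" where
  "dom b c \<longleftrightarrow> (\<forall>g \<in> M. g b \<notin> P \<longrightarrow> g c \<notin> P)"

definition nonsmall :: "'v \<Rightarrow> bool" where
  "nonsmall b \<longleftrightarrow> (\<exists>d \<in> P. d \<noteq> b \<and> dom b d)"

lemma domD: "dom b c \<Longrightarrow> g \<in> M \<Longrightarrow> g b \<notin> P \<Longrightarrow> g c \<notin> P"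
  by (auto simp: dom_def)

lemma dom_trans: "dom a b \<Longrightarrow> dom b c \<Longrightarrow> dom a c"
  by (auto simp: dom_def)

lemma dom_M: "dom a b \<Longrightarrow> g \<in> M \<Longrightarrow> dom (g a) (g b)"
  unfolding dom_def using M_comp[of _ g] by (metis comp_apply)

lemma dom_minus: "dom a b \<Longrightarrow> a \<in> R \<Longrightarrow> b \<in> R \<Longrightarrow> dom (- b) (- a)"
  unfolding dom_def using M_R not_P_iff M_minus neg_R by (metis add.inverse_inverse)

text \<open>If neither root dominates the other, some \<open>g\<close> inverts only \<open>a\<close>
  and some \<open>h\<close> only \<open>b\<close>. Then \<open>h\<close> after the inverse of
  \<open>g\<close> inverts both positive roots \<open>- g a\<close> and \<open>g b\<close>, so
  \<open>- B a b\<close> exceeds -1.\<close>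

lemma comparable:
  assumes "a \<in> P" "b \<in> P" "B a b \<ge> 1"
  shows "dom a b \<or> dom b a"
proof (rule ccontr)
  assume "\<not> ?thesis"
  then obtain g h where g: "g \<in> M" "g a \<notin> P" "g b \<in> P" and h: "h \<in> M" "h b \<notin> P" "h a \<in> P"
    unfolding dom_def by blast
  obtain g' where g': "g' \<in> M" "g' \<circ> g = id" using M_inv[OF g(1)] by blast
  have id: "g' (g x) = x" for x using g'(2) by (metis comp_apply id_apply)
  have "- g a \<in> P" using g not_P_iff M_R[OF g(1)] assms P_R by blast
  moreover have "(h \<circ> g') (- g a) = - h a" "(h \<circ> g') (g b) = h b"
    using id M_minus[OF g'(1)] M_minus[OF h(1)] by auto
  moreover have "- h a \<notin> P" using h P_neg by blast
  ultimately have "B (- g a) (g b) > - 1"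
    using inverted_pair_B[of "h \<circ> g'" "- g a" "g b"] M_comp[OF h(1) g'(1)] h g by metis
  then show False using assms(3) M_B[OF g(1)] by (simp add: B_simps)
qed

text \<open>The step to the next index is an isometry of the plane; algebraically, the quadratic
  expression \<open>inv\<close> is constant along the recurrence.\<close>

lemma cheb_consecutive_B:
  assumes "B a a = 1" "B b b = 1" "B b a = y"
  shows "B (cheb y (Suc (Suc n)) *\<^sub>R a - cheb y (Suc n) *\<^sub>R b) (cheb y (Suc n) *\<^sub>R a - cheb y n *\<^sub>R b) = y"
proof -
  have ab: "B a b = y" using assms B_sym by simp
  have inv: "cheb y (Suc n) ^ 2 + cheb y n ^ 2 - 2 * y * cheb y (Suc n) * cheb y n = 1" for n
  proof (induction n)
    case (Suc n)
    have "(2 * y * p - q)^2 + p^2 - 2 * y * (2 * y * p - q) * p = p^2 + q^2 - 2 * y * p * q" for p q :: real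
      by (simp add: power2_eq_square algebra_simps)
    from this[of "cheb y (Suc n)" "cheb y n"] show ?case using Suc by (simp only: cheb.simps)
  qed simp
  have *: "B (u *\<^sub>R a - p *\<^sub>R b) (p *\<^sub>R a - q *\<^sub>R b) = u * p + p * q - y * (u * q + p * p)" for u p q
    using assms ab by (simp add: B_simps algebra_simps)
  have "(2 * y * p - q) * p + p * q - y * ((2 * y * p - q) * q + p * p) = y * (p^2 + q^2 - 2 * y * p * q)" for p q :: real
    by (simp add: power2_eq_square algebra_simps)
  then have "B (cheb y (Suc (Suc n)) *\<^sub>R a - cheb y (Suc n) *\<^sub>R b) (cheb y (Suc n) *\<^sub>R a - cheb y n *\<^sub>R b)
     = y * (cheb y (Suc n) ^ 2 + cheb y n ^ 2 - 2 * y * cheb y (Suc n) * cheb y n)"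
    unfolding * by simp
  then show ?thesis using inv by simp
qed

text \<open>Dominance is transported along the rotations of the rank two system.\<close>

lemma dom_sequence:
  assumes ab: "a \<in> P" "b \<in> P" and d: "dom a b" and y: "y = B a b"
  shows "cheb y (Suc n) *\<^sub>R a - cheb y n *\<^sub>R b \<in> P"
proof -
  define t where "t n = cheb y (Suc n) *\<^sub>R a - cheb y n *\<^sub>R b" for n
  have tR: "t n \<in> R" for n unfolding t_def using cheb_roots'[OF _ _ y] ab P_R by blast
  have Baa: "B a a = 1" "B b b = 1" "B b a = y" using ab P_R R_norm B_sym y by auto
  \<comment> \<open>Reflecting in the dominating root \<open>t (Suc n)\<close> makes it negative,
    hence also the dominated \<open>t n\<close>, whose image is \<open>- t (Suc (Suc n))\<close>.
    Negating the transported dominance reverses it and gives the next pair.\<close>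
  have P2: "t n \<in> P \<and> t (Suc n) \<in> P \<and> dom (t (Suc n)) (t n)" for n
  proof (induction n)
    case 0
    have eq: "refl a b = - t 1" unfolding refl_def t_def using Baa y by (simp add: B_simps algebra_simps)
    have aR: "a \<in> R" using ab P_R by blast
    have "refl a b \<notin> P"
      using domD[OF d refl_M, of a] ab refl_self[OF aR] aR P_neg by auto
    moreover have "dom (- a) (refl a b)" using dom_M[OF d refl_M[OF aR]] refl_self[OF aR] by simp
    ultimately have 1: "t 1 \<in> P" "dom (- a) (- t 1)"
      using not_P_iff[of "refl a b"] refl_R[of a b] ab P_R eq by auto
    then have "dom (t 1) a" using dom_minus[OF 1(2)] ab P_R tR neg_R by fastforce
    then show ?case using 1 ab by (simp add: t_def)
  next
    case (Suc n)
    let ?a = "t (Suc n)" and ?b = "t n"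
    have eq: "refl ?a ?b = - t (Suc (Suc n))"
    proof -
      have "B ?a ?b = y"
        unfolding t_def by (rule cheb_consecutive_B) (use Baa in auto)
      then have "refl ?a ?b = ?b - (2 * y) *\<^sub>R ?a" unfolding refl_def by simp
      also have "\<dots> = - t (Suc (Suc n))"
        unfolding t_def comb_diff_scale minus_comb by simp
      finally show ?thesis .
    qed
    have d: "dom ?a ?b" and p: "?a \<in> P" "?b \<in> P" using Suc by auto
    have aR: "?a \<in> R" using p P_R by blast
    have "refl ?a ?b \<notin> P"
      using domD[OF d refl_M[OF aR]] refl_self[OF aR] P_neg[OF p(1)] by auto
    moreover have "dom (- ?a) (refl ?a ?b)" using dom_M[OF d refl_M[OF aR]] refl_self[OF aR] by simp
    ultimately have 1: "t (Suc (Suc n)) \<in> P" "dom (- ?a) (- t (Suc (Suc n)))"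
      using not_P_iff[of "refl ?a ?b"] refl_R[of ?a ?b] p P_R eq by auto
    then have "dom (t (Suc (Suc n))) ?a" using dom_minus[OF 1(2)] p P_R tR neg_R by fastforce
    then show ?case using 1 p by simp
  qed
  then show ?thesis using t_def by auto
qed

text \<open>For a form value below 1 the Chebyshev values become nonpositive after a positive one;
  the root of \<open>dom_sequence\<close> at that index would be a nonpositive combination of
  positive roots.\<close>

lemma dom_B:
  assumes ab: "a \<in> P" "b \<in> P" "dom a b" "a \<noteq> b"
  shows "B a b \<ge> 1"
proof (rule ccontr)
  define y where "y = B a b"
  assume "\<not> ?thesis"
  then have "y < 1" by (simp add: y_def)
  then obtain n where n: "\<And>k. 1 \<le> k \<Longrightarrow> k \<le> Suc n \<Longrightarrow> cheb y k > 0" "cheb y (Suc (Suc n)) \<le> 0"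
    by (rule cheb_first_nonpos) blast
  let ?t = "cheb y (Suc (Suc n)) *\<^sub>R a - cheb y (Suc n) *\<^sub>R b"
  have "?t \<in> P" using dom_sequence[OF ab(1,2,3) y_def] .
  moreover have "- ?t = (- cheb y (Suc (Suc n))) *\<^sub>R a + cheb y (Suc n) *\<^sub>R b" by (simp del: cheb.simps)
  moreover have "(- cheb y (Suc (Suc n))) *\<^sub>R a + cheb y (Suc n) *\<^sub>R b \<in> K"
    using n(1)[of "Suc n"] n(2) ab by (intro K_add K_scale P_K) (auto simp del: cheb.simps)
  ultimately have "?t \<in> P" "- ?t \<in> K" by (simp_all del: cheb.simps)
  then show False using P_neg[of ?t] neg_R[of ?t] P_R by (auto simp: P_def)
qed

lemma cheb_diff_inj:
  assumes ab: "a \<in> P" "b \<in> P" and ne: "a \<noteq> b" and y: "y \<ge> 1"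
  shows "inj (\<lambda>n. cheb y (Suc n) *\<^sub>R b - cheb y n *\<^sub>R a)"
proof (rule injI, rule ccontr)
    let ?t = "\<lambda>n. cheb y (Suc n) *\<^sub>R b - cheb y n *\<^sub>R a"
    have lt: False if "m < n" "?t m = ?t n" for m n
    proof -
      let ?d = "cheb y (Suc n) - cheb y (Suc m)" and ?e = "cheb y n - cheb y m"
      have eq: "?d *\<^sub>R b = ?e *\<^sub>R a" using that(2) by (simp add: algebra_simps)
      have pos: "?d > 0" "?e > 0" using cheb_less[OF y that(1)] cheb_less[OF y, of "Suc m" "Suc n"] that(1) by auto
      then have "?d *\<^sub>R b = ?d *\<^sub>R ((?e / ?d) *\<^sub>R a)" using eq by simp
      then have b: "b = (?e / ?d) *\<^sub>R a" using pos by (metis less_irrefl scaleR_left_imp_eq)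
      obtain x where x: "x = ?e / ?d" by blast
      have "x > 0" using pos x by simp
      have "B b b = x * x * B a a" unfolding b x[symmetric] by (simp only: B_simps mult.assoc real_scaleR_def)
      then have "x * x = 1" using R_norm[of b] R_norm[of a] ab P_R by simp
      then have "x = 1" using \<open>x > 0\<close> by (metis mult.right_neutral mult_le_cancel_left_pos mult_less_cancel_left_pos not_less order_less_le)
      then have "b = a" using b x by simp
      then show False using b ne by simp
    qed
    fix m n assume "?t m = ?t n" "m \<noteq> n"
    then show False using lt[of m n] lt[of n m] by (metis nat_neq_iff)
  qed

text \<open>Mutual dominance makes the sequences of \<open>dom_sequence\<close> positive in both
  directions. As \<open>refl a\<close> maps one of them to the negative of the other, shifted by
  one, it would invert infinitely many positive roots.\<close>

lemma dom_antisym: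
  assumes ab: "a \<in> P" "b \<in> P" "dom a b" "dom b a"
  shows "a = b"
proof (rule ccontr)
  assume ne: "a \<noteq> b"
  define y where "y = B a b"
  have y: "y \<ge> 1" using dom_B[OF ab(1,2,3) ne] by (simp add: y_def)
  define t where "t n = cheb y (Suc n) *\<^sub>R b - cheb y n *\<^sub>R a" for n
  have y': "y = B b a" using y_def B_sym by simp
  have tP: "t n \<in> P" for n unfolding t_def using dom_sequence[OF ab(2,1,4) y'] .
  have sP: "cheb y (Suc n) *\<^sub>R a - cheb y n *\<^sub>R b \<in> P" for n
    using dom_sequence[OF ab(1,2,3) y_def] .
  have "refl a (t n) = - (cheb y (Suc (Suc n)) *\<^sub>R a - cheb y (Suc n) *\<^sub>R b)" for n
  proof -
    have "refl a (t n) = refl a ((- cheb y n) *\<^sub>R a + cheb y (Suc n) *\<^sub>R b)" by (simp add: t_def)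
    also have "\<dots> = (cheb y n - 2 * cheb y (Suc n) * y) *\<^sub>R a + cheb y (Suc n) *\<^sub>R b"
      using refl_comb[of a "- cheb y n" "cheb y (Suc n)" b] ab P_R y_def by simp
    also have "cheb y n - 2 * cheb y (Suc n) * y = - cheb y (Suc (Suc n))" by simp
    finally show ?thesis by (simp only: scaleR_minus_left minus_diff_eq uminus_add_conv_diff)
  qed
  then have "refl a (t n) \<notin> P" for n using P_neg[OF sP[of "Suc n"]] by simp
  then have "range t \<subseteq> {x \<in> P. refl a x \<notin> P}" using tP by auto
  then have "finite (range t)" using finite_inverted[OF refl_M] ab P_R finite_subset by blast
  moreover have "inj t" unfolding t_def using cheb_diff_inj[OF ab(1,2) ne y] .
  ultimately show False using finite_imageD by blast
qed

lemma nonsmall_B: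
  assumes "b \<in> P" "nonsmall b"
  obtains d where "d \<in> P" "d \<noteq> b" "dom b d" "B b d \<ge> 1"
  using assms dom_B unfolding nonsmall_def by metis

lemma nonsmall_dom: "dom a b \<Longrightarrow> a \<in> P \<Longrightarrow> b \<in> P \<Longrightarrow> a \<noteq> b \<Longrightarrow> nonsmall a"
  by (auto simp: nonsmall_def)

text \<open>The witness for the reflected root \<open>al\<close> is \<open>d\<close> or
  \<open>refl e d\<close>, depending on the sign of \<open>B d e\<close>. Either has form value at
  least 1 with \<open>al\<close>, so the two are comparable. The wrong direction would make
  \<open>b\<close> dominate \<open>al\<close>, although \<open>B b al < 1\<close>, or make
  \<open>d\<close> dominate \<open>b\<close>.\<close>

lemma nonsmall_refl_obtuse:
  assumes b: "b \<in> P" "nonsmall b" and e: "e \<in> P" "B b e \<le> 0"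
  shows "nonsmall (refl e b)"
proof -
  obtain d where d: "d \<in> P" "d \<noteq> b" "dom b d" "B b d \<ge> 1" using nonsmall_B[OF b] .
  define k where "k = - B b e"
  have k: "k \<ge> 0" using e by (simp add: k_def)
  define al where "al = refl e b"
  have R: "b \<in> R" "e \<in> R" "d \<in> R" using b e d P_R by auto
  have al: "al = 1 *\<^sub>R b + (2 * k) *\<^sub>R e" unfolding al_def refl_def k_def using B_sym[of e b] by simp
  have alR: "al \<in> R" unfolding al_def using refl_R R by blast
  have alP: "al \<in> P" using R_nonneg_comb[of 1 b "2 * k" e] alR al b e k P_K by auto
  have Bal: "B b al = 1 - 2 * k\<^sup>2"
    unfolding al using R_norm[OF R(1)] by (simp add: B_simps k_def power2_eq_square)
  show ?thesis
  proof (cases "k = 0")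
    case True
    then show ?thesis using b al al_def by simp
  next
    case k0: False
    have nb: "al \<noteq> b" using Bal k0 R_norm[OF R(1)] by auto
    have ndom: "\<not> dom b al" using dom_B[of b al] b alP nb Bal k0 by force
    show ?thesis
    proof (cases "B d e \<ge> 0")
      case True
      have "B al d \<ge> 1" unfolding al using d(4) True k B_sym[of e d] by (simp add: B_simps add_increasing2)
      then have "dom al d \<or> dom d al" using comparable alP d by blast
      moreover have "\<not> dom d al" using dom_trans[OF d(3)] ndom by blast
      moreover have "al \<noteq> d" using ndom d by blast
      ultimately show ?thesis using nonsmall_dom alP d al_def by blast
    next
      case False
      define d' where "d' = refl e d"
      have d'R: "d' \<in> R" unfolding d'_def using refl_R R by blast
      have "d' = 1 *\<^sub>R d + (- 2 * B d e) *\<^sub>R e" unfolding d'_def refl_def using B_sym[of e d] by simp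
      then have d'P: "d' \<in> P" using R_nonneg_comb[of 1 d "- 2 * B d e" e] d'R False d e P_K by auto
      have "B al d' \<ge> 1" unfolding al_def d'_def using refl_B R d(4) by simp
      then have "dom al d' \<or> dom d' al" using comparable alP d'P by blast
      moreover have "\<not> dom d' al"
      proof
        assume "dom d' al"
        then have "dom d b" using dom_M[OF _ refl_M[OF R(2)], of d' al] refl_refl[OF R(2)]
          by (simp add: d'_def al_def)
        then show False using dom_antisym d b by blast
      qed
      moreover have "al \<noteq> d'" unfolding al_def d'_def using refl_refl[OF R(2)] d(2) by metis
      ultimately show ?thesis using nonsmall_dom alP d'P al_def by blast
    qed
  qed
qed

end

section \<open>Rank two subsystems and a dominated root\<close>

text \<open>\<open>b\<close> and \<open>e\<close> are the canonical roots of a finite dihedral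
  subsystem. The upper bound on \<open>c\<close> makes the form positive definite on their plane;
  the lower bound excludes orthogonality.\<close>

locale obtuse_pair = reflection_system +
  fixes b e :: 'a and c :: real
  assumes b_P: "b \<in> P" and e_P: "e \<in> P"
    and B_be: "B b e = - c" and c_pos: "c > 0" and c_less: "c < 1"
    and canonical: "\<And>x y. x *\<^sub>R b + y *\<^sub>R e \<in> P \<Longrightarrow> x \<ge> 0 \<and> y \<ge> 0"
begin

lemma bR: "b \<in> R" and eR: "e \<in> R"
  using b_P e_P P_R by auto

lemma B_bb: "B b b = 1" and B_ee: "B e e = 1" and B_eb: "B e b = - c"
  using R_norm bR eR B_sym B_be by auto

lemma c2_less: "c\<^sup>2 < 1"
  using c_pos c_less by (simp add: abs_square_less_1)

lemma plane_norm: "B (x *\<^sub>R b + y *\<^sub>R e) (x *\<^sub>R b + y *\<^sub>R e) = (x - c * y)\<^sup>2 + (1 - c\<^sup>2) * y\<^sup>2"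
  by (simp add: B_simps B_bb B_ee B_be B_eb power2_eq_square algebra_simps)

lemma plane_norm': "B (x *\<^sub>R b + y *\<^sub>R e) (x *\<^sub>R b + y *\<^sub>R e) = (y - c * x)\<^sup>2 + (1 - c\<^sup>2) * x\<^sup>2"
  by (simp add: B_simps B_bb B_ee B_be B_eb power2_eq_square algebra_simps)

lemma plane_norm_nonneg: "B (x *\<^sub>R b + y *\<^sub>R e) (x *\<^sub>R b + y *\<^sub>R e) \<ge> 0"
  unfolding plane_norm using c2_less by simp

lemma plane_norm_zero:
  assumes "B (x *\<^sub>R b + y *\<^sub>R e) (x *\<^sub>R b + y *\<^sub>R e) \<le> 0"
  shows "x = 0 \<and> y = 0"
proof -
  have "(1 - c\<^sup>2) * y\<^sup>2 \<le> 0" using assms unfolding plane_norm by (smt (verit) zero_le_power2)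
  then have "y = 0" using c2_less by (simp add: mult_le_0_iff)
  moreover have "(1 - c\<^sup>2) * x\<^sup>2 \<le> 0" using assms unfolding plane_norm' by (smt (verit) zero_le_power2)
  then have "x = 0" using c2_less by (simp add: mult_le_0_iff)
  ultimately show ?thesis by simp
qed

lemma plane_indep: "x *\<^sub>R b + y *\<^sub>R e = 0 \<Longrightarrow> x = 0 \<and> y = 0"
  by (rule plane_norm_zero) (simp add: B_simps)

lemma plane_eqD:
  assumes "x *\<^sub>R b + y *\<^sub>R e = x' *\<^sub>R b + y' *\<^sub>R e"
  shows "x = x' \<and> y = y'"
proof -
  have "(x - x') *\<^sub>R b + (y - y') *\<^sub>R e = (x *\<^sub>R b + y *\<^sub>R e) - (x' *\<^sub>R b + y' *\<^sub>R e)"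
    by (simp add: algebra_simps)
  also have "\<dots> = 0" unfolding assms by simp
  finally show ?thesis using plane_indep[of "x - x'" "y - y'"] by simp
qed

lemma plane_root_sign:
  assumes "x *\<^sub>R b + y *\<^sub>R e \<in> R"
  shows "(x \<ge> 0 \<and> y \<ge> 0 \<and> x *\<^sub>R b + y *\<^sub>R e \<in> P) \<or> (x \<le> 0 \<and> y \<le> 0)"
proof (cases "x *\<^sub>R b + y *\<^sub>R e \<in> P")
  case False
  then have "(- x) *\<^sub>R b + (- y) *\<^sub>R e \<in> P" using not_P_iff[OF assms] by simp
  then show ?thesis using canonical by fastforce
qed (use canonical in auto)

definition rot :: "'a \<Rightarrow> 'a" where "rot v = refl e (refl b v)"

lemma rot_add: "rot (u + v) = rot u + rot v"
  and rot_scale: "rot (k *\<^sub>R v) = k *\<^sub>R rot v"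
  by (simp_all add: rot_def refl_add refl_scale)

lemma rot_pow_add: "(rot ^^ k) (u + v) = (rot ^^ k) u + (rot ^^ k) v"
  and rot_pow_scale: "(rot ^^ k) (r *\<^sub>R v) = r *\<^sub>R (rot ^^ k) v"
  by (induction k) (simp_all add: rot_add rot_scale)

lemma rot_M: "rot \<in> M"
  using M_comp[OF refl_M[OF eR] refl_M[OF bR]] by (simp add: rot_def[abs_def] comp_def)

lemma rot_pow_M: "rot ^^ k \<in> M"
proof (induction k)
  case 0
  then show ?case using id_M[OF bR] by (simp only: funpow_0 funpow.simps)
next
  case (Suc k)
  then show ?case using M_comp[OF rot_M] by (simp only: funpow.simps)
qed

lemma refl_b_plane: "refl b (x *\<^sub>R b + y *\<^sub>R e) = (2 * c * y - x) *\<^sub>R b + y *\<^sub>R e"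
  by (simp add: refl_comb[OF bR] B_be)

lemma refl_e_plane: "refl e (x *\<^sub>R b + y *\<^sub>R e) = x *\<^sub>R b + (2 * c * x - y) *\<^sub>R e"
  using refl_comb[OF eR, of y x b] by (simp add: B_eb add.commute)

lemma rot_plane: "rot (x *\<^sub>R b + y *\<^sub>R e) = (2 * c * y - x) *\<^sub>R b + (2 * c * (2 * c * y - x) - y) *\<^sub>R e"
  unfolding rot_def refl_b_plane refl_e_plane ..

lemma rot_pow_e: "(rot ^^ k) e = cheb c (2 * k) *\<^sub>R b + cheb c (Suc (2 * k)) *\<^sub>R e"
proof (induction k)
  case (Suc k)
  have "(rot ^^ Suc k) e = rot (cheb c (2 * k) *\<^sub>R b + cheb c (Suc (2 * k)) *\<^sub>R e)" using Suc by simp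
  then show ?case unfolding rot_plane by simp
qed simp

lemma rot_pow_b: "(rot ^^ Suc k) b = (- cheb c (Suc (2 * k))) *\<^sub>R b + (- cheb c (Suc (Suc (2 * k)))) *\<^sub>R e"
proof (induction k)
  case 0
  show ?case using rot_plane[of 1 0] by simp
next
  case (Suc k)
  have "(rot ^^ Suc (Suc k)) b = rot ((rot ^^ Suc k) b)" by simp
  also have "\<dots> = rot ((- cheb c (Suc (2 * k))) *\<^sub>R b + (- cheb c (Suc (Suc (2 * k)))) *\<^sub>R e)"
    unfolding Suc.IH ..
  also have "\<dots> = (- cheb c (Suc (2 * Suc k))) *\<^sub>R b + (- cheb c (Suc (Suc (2 * Suc k)))) *\<^sub>R e"
    unfolding rot_plane by (rule arg_cong2[of _ _ _ _ "\<lambda>x y. x *\<^sub>R b + y *\<^sub>R e"]) (simp_all add: algebra_simps)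
  finally show ?case .
qed

text \<open>The angle is shown to be a suitable fraction of pi without trigonometry. At the first
  nonpositive Chebyshev value some root has coefficients of opposite sign unless that value is 0;
  the norm then makes the preceding value 1.\<close>

lemma cheb_zero: "\<exists>n. cheb c (Suc (Suc n)) = 0 \<and> cheb c (Suc n) = 1"
proof -
  obtain n where n: "\<And>k. 1 \<le> k \<Longrightarrow> k \<le> Suc n \<Longrightarrow> cheb c k > 0" "cheb c (Suc (Suc n)) \<le> 0"
    using cheb_first_nonpos[OF c_less] by blast
  have p: "cheb c (Suc n) > 0" using n(1) by simp
  have r: "cheb c (Suc (Suc n)) *\<^sub>R b + cheb c (Suc n) *\<^sub>R e \<in> R"
    using cheb_roots[OF bR eR, of c "Suc n"] B_be by simp
  then have z: "cheb c (Suc (Suc n)) = 0" using plane_root_sign[OF r] p n(2) by linarith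
  then have "cheb c (Suc n) *\<^sub>R e \<in> R" using r by simp
  then have "cheb c (Suc n) * cheb c (Suc n) = 1" using R_norm[of "cheb c (Suc n) *\<^sub>R e"] B_ee by (simp add: B_simps)
  then have "cheb c (Suc n) = 1" using p by (metis abs_1 abs_mult_self_eq abs_of_pos mult_1 mult.commute power2_eq_square real_sqrt_abs real_sqrt_one)
  then show ?thesis using z by blast
qed

text \<open>From the zero of \<open>cheb_zero\<close> on, the Chebyshev values repeat with opposite
  sign, so twice its index is a period; one rotation advances the index by two.\<close>

lemma rot_period: "\<exists>N > 0. (rot ^^ N) b = b \<and> (rot ^^ N) e = e"
proof -
  obtain n where n: "cheb c (Suc (Suc n)) = 0" "cheb c (Suc n) = 1" using cheb_zero by blast
  have neg: "cheb c (Suc (Suc n) + k) = - cheb c k \<and> cheb c (Suc (Suc n) + Suc k) = - cheb c (Suc k)" for k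
    by (induction k) (use n in auto)
  have zz: "cheb c (2 * Suc (Suc n)) = 0" using neg[of "Suc (Suc n)"] n by (simp only: mult_2 minus_zero)
  have zo: "cheb c (Suc (2 * Suc (Suc n))) = 1"
  proof -
    have "cheb c (Suc (2 * Suc (Suc n))) = cheb c (Suc (Suc n) + Suc (Suc (Suc n)))"
      by (simp only: mult_2 add_Suc_right)
    also have "\<dots> = - cheb c (Suc (Suc (Suc n)))" using neg by blast
    also have "cheb c (Suc (Suc (Suc n))) = cheb c (Suc (Suc n) + Suc 0)" by (simp only: add_Suc_right add_0_right)
    also have "\<dots> = - cheb c (Suc 0)" using neg by blast
    finally show ?thesis by simp
  qed
  have "Suc (2 * Suc n) = Suc (Suc n) + Suc n" by simp
  then have zm: "cheb c (Suc (2 * Suc n)) = - 1" using neg[of "Suc n"] n by (simp only:)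
  have "(rot ^^ Suc (Suc n)) b = (- cheb c (Suc (2 * Suc n))) *\<^sub>R b + (- cheb c (2 * Suc (Suc n))) *\<^sub>R e"
    using rot_pow_b[of "Suc n"] by (simp only: mult_Suc_right) simp
  then have "(rot ^^ Suc (Suc n)) b = b" unfolding zm zz by simp
  moreover have "(rot ^^ Suc (Suc n)) e = e" unfolding rot_pow_e zz zo by simp
  ultimately show ?thesis by blast
qed

lemma rot_fixed_plane:
  assumes "rot (x *\<^sub>R b + y *\<^sub>R e) = x *\<^sub>R b + y *\<^sub>R e"
  shows "x = 0 \<and> y = 0"
proof -
  have "refl b (x *\<^sub>R b + y *\<^sub>R e) = refl e (x *\<^sub>R b + y *\<^sub>R e)"
    using assms refl_refl[OF eR] unfolding rot_def by metis
  then have "(2 * c * y - x) *\<^sub>R b + y *\<^sub>R e = x *\<^sub>R b + (2 * c * x - y) *\<^sub>R e"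
    unfolding refl_b_plane refl_e_plane .
  from plane_eqD[OF this] have eqs: "2 * c * y - x = x" "y = 2 * c * x - y" by blast+
  have xy: "x = c * y" using eqs(1) by linarith
  have yx: "y = c * x" using eqs(2) by linarith
  have "x = c * (c * x)" using xy yx by simp
  then have "(1 - c\<^sup>2) * x = 0" by (simp add: power2_eq_square algebra_simps)
  then have "x = 0" using c2_less by simp
  then show ?thesis using yx by simp
qed

text \<open>The sum over a period is fixed by \<open>rot\<close>, and \<open>rot\<close> fixes only
  0 in the plane.\<close>

lemma orbit_sum_plane:
  assumes N: "(rot ^^ N) b = b" "(rot ^^ N) e = e"
  shows "(\<Sum>k<N. (rot ^^ k) (x *\<^sub>R b + y *\<^sub>R e)) = 0"
proof -
  let ?v = "x *\<^sub>R b + y *\<^sub>R e"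
  let ?S = "\<Sum>k<N. (rot ^^ k) ?v"
  have per: "(rot ^^ N) ?v = ?v" using N by (simp add: rot_pow_add rot_pow_scale)
  have lin: "rot (\<Sum>k<n. (rot ^^ k) ?v) = (\<Sum>k<n. (rot ^^ Suc k) ?v)" for n
  proof (induction n)
    case 0
    show ?case using rot_scale[of 0 0] by simp
  qed (simp add: rot_add)
  have shift: "(\<Sum>k<n. (rot ^^ Suc k) ?v) = (\<Sum>k<n. (rot ^^ k) ?v) + (rot ^^ n) ?v - ?v" for n
    by (induction n) auto
  have "rot ?S = ?S" unfolding lin shift per by simp
  moreover have "\<exists>p q. (\<Sum>k<n. (rot ^^ k) ?v) = p *\<^sub>R b + q *\<^sub>R e" for n
  proof (induction n)
    case 0
    show ?case by (rule exI[of _ 0], rule exI[of _ 0]) simp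
  next
    case (Suc n)
    have "\<exists>p q. (rot ^^ n) ?v = p *\<^sub>R b + q *\<^sub>R e"
    proof (induction n)
      case (Suc n)
      then obtain p q where "(rot ^^ n) ?v = p *\<^sub>R b + q *\<^sub>R e" by blast
      then have "(rot ^^ Suc n) ?v = rot (p *\<^sub>R b + q *\<^sub>R e)" by simp
      then show ?case unfolding rot_plane by blast
    qed auto
    then obtain p q p' q' where "(rot ^^ n) ?v = p *\<^sub>R b + q *\<^sub>R e"
      "(\<Sum>k<n. (rot ^^ k) ?v) = p' *\<^sub>R b + q' *\<^sub>R e" using Suc by blast
    then have "(\<Sum>k<Suc n. (rot ^^ k) ?v) = (p' + p) *\<^sub>R b + (q' + q) *\<^sub>R e"
      by (simp add: algebra_simps)
    then show ?case by blast
  qed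
  ultimately show ?thesis using rot_fixed_plane by (metis (no_types, lifting) add.right_neutral scaleR_zero_left)
qed

lemma sum_in_K:
  fixes n :: nat
  shows "(\<And>k. k < n \<Longrightarrow> f k \<in> K) \<Longrightarrow> (\<Sum>k<n. f k) \<in> K"
proof (induct n)
  case 0
  show ?case using K_scale[of 0 b] b_P P_K by simp
qed (simp add: K_add)

lemma orbit_sum_nonzero:
  assumes "N > 0" "v \<noteq> 0" "\<And>k. k < N \<Longrightarrow> (rot ^^ k) v \<in> K"
  shows "(\<Sum>k<N. (rot ^^ k) v) \<noteq> 0"
proof
  assume z: "(\<Sum>k<N. (rot ^^ k) v) = 0"
  obtain m where m: "N = Suc m" using assms(1) by (cases N) auto
  have "(\<Sum>k<N. (rot ^^ k) v) = v + (\<Sum>k<m. (rot ^^ Suc k) v)"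
    unfolding m by (subst sum.lessThan_Suc_shift) simp
  then have "- v = (\<Sum>k<m. (rot ^^ Suc k) v)" using z neg_eq_iff_add_eq_0 by metis
  then have "- v \<in> K" using sum_in_K[of m "\<lambda>k. (rot ^^ Suc k) v"] assms(3) m
    by (metis Suc_less_eq)
  moreover have "v \<in> K" using assms(3)[of 0] assms(1) by simp
  ultimately show False using K_salient assms(2) by blast
qed

text \<open>A root is counted by its coefficient at \<open>d\<close> modulo the plane of \<open>b\<close> and \<open>e\<close>. Averaging over
  the rotations kills the plane, so positive roots all of whose rotations stay positive would
  average to a positive multiple of the average of \<open>d\<close>; the roots
  \<open>dom_sequence\<close> average to negative multiples.\<close>

definition above :: "'a \<Rightarrow> 'a set" where
  "above d = {r \<in> P. \<exists>x y z. x > 0 \<and> r = x *\<^sub>R d + y *\<^sub>R b + z *\<^sub>R e}"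

text \<open>In the positive definite plane of \<open>b\<close> and \<open>e\<close>, a unit vector
  whose form value with \<open>b\<close> is at least 1 equals \<open>b\<close>, by the equality case
  of Cauchy-Schwarz. Hence \<open>d\<close> lies outside the plane.\<close>

lemma indep3:
  assumes d: "d \<in> P" "d \<noteq> b" "B b d \<ge> 1" and z: "x *\<^sub>R d + y *\<^sub>R b + z *\<^sub>R e = 0"
  shows "x = 0 \<and> y = 0 \<and> z = 0"
proof (cases "x = 0")
  case True
  then show ?thesis using z plane_indep[of y z] by simp
next
  case False
  define p q where "p = - y / x" and "q = - z / x"
  have "x *\<^sub>R (d - (p *\<^sub>R b + q *\<^sub>R e)) = 0" using z False by (simp add: p_def q_def algebra_simps)
  then have dpq: "d = p *\<^sub>R b + q *\<^sub>R e" using False by simp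
  have n: "(p - c * q)\<^sup>2 + (1 - c\<^sup>2) * q\<^sup>2 = 1" using R_norm[of d] d P_R plane_norm[of p q] dpq by simp
  have "p - c * q \<ge> 1" using d(3) unfolding dpq by (simp add: B_simps B_bb B_be mult.commute)
  then have "(p - c * q)\<^sup>2 \<ge> 1" by simp
  then have "(1 - c\<^sup>2) * q\<^sup>2 \<le> 0" using n by linarith
  then have q: "q = 0" using c2_less by (simp add: mult_le_0_iff)
  then have "p\<^sup>2 = 1" "p \<ge> 1" using n \<open>p - c * q \<ge> 1\<close> by auto
  then have "p = 1" by (simp add: power2_eq_1_iff)
  then show ?thesis using dpq q d by simp
qed

lemma finite_above:
  assumes d: "d \<in> P" "d \<noteq> b" "dom b d"
  shows "finite (above d)"
proof -
  define y where "y = B b d"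
  have y: "y \<ge> 1" using dom_B[OF b_P d(1,3)] d by (simp add: y_def)
  obtain N where N: "N > 0" "(rot ^^ N) b = b" "(rot ^^ N) e = e" using rot_period by blast
  define S where "S v = (\<Sum>k<N. (rot ^^ k) v)" for v
  have S: "S (x *\<^sub>R d + p *\<^sub>R b + q *\<^sub>R e) = x *\<^sub>R S d" for x p q
  proof -
    have "S (x *\<^sub>R d + p *\<^sub>R b + q *\<^sub>R e) = S (x *\<^sub>R d + (p *\<^sub>R b + q *\<^sub>R e))" by (simp add: add.assoc)
    also have "\<dots> = x *\<^sub>R S d + S (p *\<^sub>R b + q *\<^sub>R e)"
      unfolding S_def rot_pow_add[of _ "x *\<^sub>R d"] rot_pow_scale[of _ x d] by (simp add: sum.distrib scaleR_right.sum)
    finally show ?thesis unfolding S_def orbit_sum_plane[OF N(2,3)] by simp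
  qed
  define E where "E = (\<Union>k<N. {r \<in> P. (rot ^^ k) r \<notin> P})"
  have finE: "finite E" unfolding E_def using finite_inverted[OF rot_pow_M] by auto
  define t where "t n = cheb y (Suc n) *\<^sub>R b - cheb y n *\<^sub>R d" for n
  have tP: "t n \<in> P" for n unfolding t_def using dom_sequence[OF b_P d(1,3) y_def] .
  have tS: "S (t n) = (- cheb y n) *\<^sub>R S d" for n
    using S[of "- cheb y n" "cheb y (Suc n)" 0] by (simp add: t_def algebra_simps)
  have injt: "inj t"
  proof (rule injI, rule ccontr)
    fix m n assume "t m = t n" "m \<noteq> n"
    then have "(cheb y n - cheb y m) *\<^sub>R d + (cheb y (Suc m) - cheb y (Suc n)) *\<^sub>R b + 0 *\<^sub>R e = 0"
      by (simp add: t_def algebra_simps)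
    then have "cheb y n = cheb y m" using indep3[OF d(1,2)] y y_def by fastforce
    then show False using cheb_less[OF y, of m n] cheb_less[OF y, of n m] \<open>m \<noteq> n\<close> by (metis less_irrefl nat_neq_iff)
  qed
  have "infinite (t ` {1..})" using injt finite_imageD[of t "{1..}"] infinite_Ici[of "1::nat"] by (metis inj_on_subset subset_UNIV)
  \<comment> \<open>Index 0 is avoided because \<open>t 0 = b\<close> averages to 0. Since
    \<open>E\<close> is finite and \<open>t\<close> injective, some later \<open>t n\<close> stays
    positive under every rotation.\<close>
  then obtain n where n: "n \<ge> 1" "t n \<notin> E" using finE by (metis atLeast_iff finite_subset image_subsetI)
  then have tn: "(rot ^^ k) (t n) \<in> P" if "k < N" for k using tP that by (auto simp: E_def)
  have cn: "cheb y n > 0" using cheb_less[OF y, of 0 n] n by simp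
  have "above d \<subseteq> E"
  proof
    fix r assume "r \<in> above d"
    then obtain x p q where r: "r \<in> P" "x > 0" "r = x *\<^sub>R d + p *\<^sub>R b + q *\<^sub>R e" by (auto simp: above_def)
    show "r \<in> E"
    proof (rule ccontr)
      assume "r \<notin> E"
      then have rk: "(rot ^^ k) r \<in> P" if "k < N" for k using r that by (auto simp: E_def)
      have Sr: "S r = x *\<^sub>R S d" unfolding r(3) S ..
      have "cheb y n *\<^sub>R S r = - (x *\<^sub>R S (t n))" unfolding Sr tS by simp
      moreover have "S r \<in> K" "S (t n) \<in> K" unfolding S_def by (rule sum_in_K, use rk tn P_K in blast)+
      ultimately have "cheb y n *\<^sub>R S r = 0" using K_salient[of "x *\<^sub>R S (t n)"] K_scale[of "cheb y n" "S r"]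
         K_scale[of x "S (t n)"] cn r(2) by simp
      then have "S r = 0" using cn by simp
      moreover have "S r \<noteq> 0" unfolding S_def
        by (rule orbit_sum_nonzero) (use N r rk P_K P_R R_nonzero in auto)
      ultimately show False by simp
    qed
  qed
  then show ?thesis using finE finite_subset by blast
qed

text \<open>Roots of the plane average to 0, so each positive one is inverted by some rotation of a
  period, and a rotation inverts only finitely many.\<close>

lemma finite_plane_roots: "finite {r \<in> P. \<exists>y z. r = y *\<^sub>R b + z *\<^sub>R e}"
proof -
  obtain N where N: "N > 0" "(rot ^^ N) b = b" "(rot ^^ N) e = e" using rot_period by blast
  define E where "E = (\<Union>k<N. {r \<in> P. (rot ^^ k) r \<notin> P})"
  have finE: "finite E" unfolding E_def using finite_inverted[OF rot_pow_M] by auto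
  have "{r \<in> P. \<exists>y z. r = y *\<^sub>R b + z *\<^sub>R e} \<subseteq> E"
  proof
    fix r assume "r \<in> {r \<in> P. \<exists>y z. r = y *\<^sub>R b + z *\<^sub>R e}"
    then obtain y z where r: "r \<in> P" "r = y *\<^sub>R b + z *\<^sub>R e" by auto
    have "\<not> (\<forall>k<N. (rot ^^ k) r \<in> P)"
      using orbit_sum_nonzero[OF N(1), of r] orbit_sum_plane[OF N(2,3), of y z] r R_nonzero P_R P_K by metis
    then show "r \<in> E" using r by (auto simp: E_def)
  qed
  then show ?thesis using finE finite_subset by blast
qed

text \<open>If the dominated root were not higher, the roots of \<open>dom_sequence\<close> would
  have positive level from index 1 on, and there would be infinitely many of them. When both levels
  are 0, the norm \<open>2 - 2 * y\<close> of \<open>r - s\<close> is not positive in a definite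
  plane, so \<open>r = s\<close>.\<close>

lemma dom_level:
  assumes d: "d \<in> P" "d \<noteq> b" "dom b d"
    and r: "r \<in> P" "r = x *\<^sub>R d + p *\<^sub>R b + q *\<^sub>R e" "x \<ge> 0"
    and s: "s \<in> P" "s = x' *\<^sub>R d + p' *\<^sub>R b + q' *\<^sub>R e"
    and dom: "dom r s" "r \<noteq> s"
  shows "x' > x"
proof (rule ccontr)
  assume "\<not> ?thesis"
  then have le: "x' \<le> x" by simp
  define y where "y = B r s"
  have y: "y \<ge> 1" using dom_B[OF r(1) s(1) dom] by (simp add: y_def)
  define t where "t n = cheb y (Suc n) *\<^sub>R r - cheb y n *\<^sub>R s" for n
  define L where "L n = cheb y (Suc n) * x - cheb y n * x'" for n
  have tP: "t n \<in> P" for n unfolding t_def using dom_sequence[OF r(1) s(1) dom(1) y_def] .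
  have teq: "\<exists>p q. t n = L n *\<^sub>R d + p *\<^sub>R b + q *\<^sub>R e" for n
    by (rule exI[of _ "cheb y (Suc n) * p - cheb y n * p'"], rule exI[of _ "cheb y (Suc n) * q - cheb y n * q'"])
      (simp add: t_def L_def r(2) s(2) algebra_simps)
  show False
  proof (cases "x = 0 \<and> x' = 0")
    case True
    then have rs: "r = p *\<^sub>R b + q *\<^sub>R e" "s = p' *\<^sub>R b + q' *\<^sub>R e" using r s by auto
    have "B (r - s) (r - s) = 2 - 2 * y"
      using R_norm[OF P_R[OF r(1)]] R_norm[OF P_R[OF s(1)]] y_def B_sym[of s r]
      by (simp only: B_simps)
    moreover have "r - s = (p - p') *\<^sub>R b + (q - q') *\<^sub>R e" unfolding rs by (simp add: algebra_simps)
    ultimately have "p - p' = 0 \<and> q - q' = 0" using plane_norm_zero[of "p - p'" "q - q'"] y by simp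
    then show False using rs dom by simp
  next
    case False
    have Lpos: "L (Suc n) > 0" for n
    proof -
      have c: "cheb y (Suc (Suc n)) \<ge> cheb y (Suc n) + 1" "cheb y (Suc n) \<ge> cheb y n + 1" "cheb y n \<ge> 0"
        using cheb_diff_ge[OF y] by blast+
      have "L (Suc n) = (cheb y (Suc (Suc n)) - cheb y (Suc n)) * x + cheb y (Suc n) * (x - x')"
        by (simp only: L_def) (simp add: algebra_simps)
      moreover have "x > 0 \<or> x - x' > 0" using False le r(3) by auto
      moreover have "(cheb y (Suc (Suc n)) - cheb y (Suc n)) * x \<ge> 0" "cheb y (Suc n) * (x - x') \<ge> 0"
        using c r(3) le by (auto simp del: cheb.simps)
      moreover have "(cheb y (Suc (Suc n)) - cheb y (Suc n)) * x > 0" if "x > 0"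
        using c that by (simp del: cheb.simps)
      moreover have "cheb y (Suc n) * (x - x') > 0" if "x - x' > 0"
        using c that by (simp del: cheb.simps)
      ultimately show ?thesis by linarith
    qed
    have "range (\<lambda>n. t (Suc n)) \<subseteq> above d"
      using tP teq Lpos unfolding above_def by blast
    then have "finite (range (\<lambda>n. t (Suc n)))" using finite_above[OF d] finite_subset by blast
    moreover have "inj t" unfolding t_def
      using cheb_diff_inj[OF s(1) r(1) dom(2)[symmetric] y] .
    then have "inj (\<lambda>n. t (Suc n))" unfolding inj_def by blast
    ultimately show False using finite_imageD by blast
  qed
qed

end

text \<open>The exceptional configuration, in which \<open>b\<close> is non-small and \<open>refl b e\<close> is small. The root \<open>k\<close> has
  the least positive coefficient at \<open>d\<close> modulo the plane. The assumptions are contradictory.\<close>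

locale hard_case = obtuse_pair B K R M b e c
  for B :: "'a::real_vector \<Rightarrow> 'a \<Rightarrow> real" and K R :: "'a set" and M b e c +
  fixes k d :: 'a and l m x0 y0 z0 :: real
  assumes k_P: "k \<in> P" and B_kb: "B k b = l" and B_ke: "B k e = m"
    and l_nonneg: "l \<ge> 0" and m_nonneg: "m \<ge> 0"
    and d_P: "d \<in> P" and d_coords: "d = x0 *\<^sub>R k + y0 *\<^sub>R b + z0 *\<^sub>R e" and x0: "x0 \<ge> 1"
    and B_bd: "B b d \<ge> 1"
    and indep: "\<And>x y z. x *\<^sub>R k + y *\<^sub>R b + z *\<^sub>R e = 0 \<Longrightarrow> x = 0 \<and> y = 0 \<and> z = 0"
    and min_level: "\<And>x y z. x *\<^sub>R k + y *\<^sub>R b + z *\<^sub>R e \<in> P \<Longrightarrow> x > 0 \<Longrightarrow> x \<ge> 1"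
    and finite_level: "finite {r \<in> P. \<exists>x y z. x > 0 \<and> r = x *\<^sub>R k + y *\<^sub>R b + z *\<^sub>R e}"
    and level_dom: "\<And>x y z x' y' z'. x *\<^sub>R k + y *\<^sub>R b + z *\<^sub>R e \<in> P \<Longrightarrow> x' *\<^sub>R k + y' *\<^sub>R b + z' *\<^sub>R e \<in> P
      \<Longrightarrow> x \<ge> 0 \<Longrightarrow> dom (x *\<^sub>R k + y *\<^sub>R b + z *\<^sub>R e) (x' *\<^sub>R k + y' *\<^sub>R b + z' *\<^sub>R e)
      \<Longrightarrow> x *\<^sub>R k + y *\<^sub>R b + z *\<^sub>R e \<noteq> x' *\<^sub>R k + y' *\<^sub>R b + z' *\<^sub>R e \<Longrightarrow> x' > x"
    and c2_ge: "2 * c\<^sup>2 \<ge> 1"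
    and e1_small: "\<not> nonsmall (refl b e)"
begin

section \<open>The Gram matrix of the exceptional configuration\<close>

definition cb :: "real \<Rightarrow> real \<Rightarrow> real \<Rightarrow> 'a" where
  "cb x y z = x *\<^sub>R k + y *\<^sub>R b + z *\<^sub>R e"

lemma kR: "k \<in> R" using k_P P_R by blast

lemma k_eq: "k = cb 1 0 0" and b_eq: "b = cb 0 1 0" and e_eq: "e = cb 0 0 1" and mk_eq: "- k = cb (- 1) 0 0"
  by (simp_all add: cb_def)

lemma cb_plane: "cb 0 y z = y *\<^sub>R b + z *\<^sub>R e"
  by (simp add: cb_def)

lemma minus_cb: "- cb x y z = cb (- x) (- y) (- z)"
  by (simp add: cb_def)

lemma diff_cb: "cb x y z - cb x' y' z' = cb (x - x') (y - y') (z - z')"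
  by (simp add: cb_def algebra_simps)

lemma scale_cb: "t *\<^sub>R cb x y z = cb (t * x) (t * y) (t * z)"
  by (simp add: cb_def algebra_simps)

lemma cb_eq_iff: "cb x y z = cb x' y' z' \<longleftrightarrow> x = x' \<and> y = y' \<and> z = z'"
proof
  assume "cb x y z = cb x' y' z'"
  then have "cb (x - x') (y - y') (z - z') = 0" using diff_cb[of x y z x' y' z'] by simp
  then show "x = x' \<and> y = y' \<and> z = z'" using indep[of "x - x'" "y - y'" "z - z'"] by (simp add: cb_def)
qed auto

lemma B_cb: "B (cb x y z) (cb x' y' z') = x * x' + y * y' + z * z' + (x * y' + x' * y) * l
    + (x * z' + x' * z) * m - (y * z' + y' * z) * c"
  using R_norm[OF kR] B_sym[of b k] B_sym[of e k]
  by (simp add: cb_def B_simps B_bb B_ee B_be B_eb B_kb B_ke algebra_simps)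

lemma B_cb_b: "B (cb x y z) b = y + x * l - z * c"
  and B_cb_e: "B (cb x y z) e = z + x * m - y * c"
  and B_cb_k: "B (cb x y z) k = x + y * l + z * m"
  and B_cb_mk: "B (cb x y z) (- k) = - x - y * l - z * m"
  using B_cb[of x y z 0 1 0] B_cb[of x y z 0 0 1] B_cb[of x y z 1 0 0] B_cb[of x y z "- 1" 0 0]
  by (simp_all add: k_eq[symmetric] b_eq[symmetric] e_eq[symmetric] mk_eq[symmetric])

lemma refl_b_cb: "refl b (cb x y z) = cb x (- y - 2 * x * l + 2 * c * z) z"
proof -
  have "refl b (cb x y z) = cb x y z - cb 0 (2 * (y + x * l - z * c)) 0"
    unfolding refl_def B_sym[of b] B_cb_b by (simp add: cb_def)
  then show ?thesis unfolding diff_cb by (simp add: cb_eq_iff algebra_simps)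
qed

lemma refl_e_cb: "refl e (cb x y z) = cb x y (- z - 2 * x * m + 2 * c * y)"
proof -
  have "refl e (cb x y z) = cb x y z - cb 0 0 (2 * (z + x * m - y * c))"
    unfolding refl_def B_sym[of e] B_cb_e by (simp add: cb_def)
  then show ?thesis unfolding diff_cb by (simp add: cb_eq_iff algebra_simps)
qed

lemma refl_k_cb: "refl k (cb x y z) = cb (- x - 2 * y * l - 2 * z * m) y z"
proof -
  have "refl k (cb x y z) = cb x y z - cb (2 * (x + y * l + z * m)) 0 0"
    unfolding refl_def B_sym[of k] B_cb_k by (simp add: cb_def)
  then show ?thesis unfolding diff_cb by (simp add: cb_eq_iff algebra_simps)
qed

lemmas refl_cb = refl_b_cb refl_e_cb refl_k_cb

lemma cb_level: "cb x y z \<in> P \<Longrightarrow> x > 0 \<Longrightarrow> x \<ge> 1"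
  using min_level by (simp add: cb_def)

lemma cb_dom: "cb x y z \<in> P \<Longrightarrow> cb x' y' z' \<in> P \<Longrightarrow> x \<ge> 0 \<Longrightarrow> dom (cb x y z) (cb x' y' z')
    \<Longrightarrow> cb x y z \<noteq> cb x' y' z' \<Longrightarrow> x' > x"
  using level_dom by (simp add: cb_def)

lemma cb_canonical: "cb 0 y z \<in> P \<Longrightarrow> y \<ge> 0 \<and> z \<ge> 0"
  using canonical by (simp add: cb_plane)

lemma cb_plane_P: "cb 0 y z \<in> R \<Longrightarrow> y > 0 \<or> z > 0 \<Longrightarrow> cb 0 y z \<in> P"
  using plane_root_sign[of y z] by (auto simp: cb_plane)

lemma e1_eq: "refl b e = cb 0 (2 * c) 1"
  using refl_b_cb[of 0 0 1] by (simp add: e_eq[symmetric])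

lemma e1_P: "cb 0 (2 * c) 1 \<in> P"
  using cb_plane_P[of "2 * c" 1] refl_R[OF bR eR] by (simp add: e1_eq)

text \<open>The left side is the form value with \<open>refl b e\<close>. A value of at least 1
  would make the two roots comparable; but a root of positive level cannot dominate one of level 0,
  and if it were dominated by \<open>refl b e\<close>, that root would be non-small.\<close>

lemma level_e1:
  assumes "cb x y z \<in> P" "x > 0"
  shows "c * y + z * (1 - 2 * c\<^sup>2) + x * (2 * c * l + m) < 1"
proof (rule ccontr)
  assume "\<not> ?thesis"
  then have "B (cb x y z) (cb 0 (2 * c) 1) \<ge> 1"
    unfolding B_cb by (simp add: power2_eq_square algebra_simps)
  then have "dom (cb x y z) (cb 0 (2 * c) 1) \<or> dom (cb 0 (2 * c) 1) (cb x y z)"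
    using comparable assms e1_P by blast
  moreover have ne: "cb x y z \<noteq> cb 0 (2 * c) 1" using assms by (simp add: cb_eq_iff)
  moreover have "\<not> dom (cb x y z) (cb 0 (2 * c) 1)"
    using cb_dom[of x y z 0 "2 * c" 1] assms e1_P ne by auto
  ultimately show False using nonsmall_dom[of "cb 0 (2 * c) 1" "cb x y z"] assms e1_P e1_small e1_eq by auto
qed

lemma k_e1: "2 * c * l + m < 1"
  using level_e1[of 1 0 0] k_P k_eq by simp

text \<open>The values left over are those compatible with \<open>cos (pi / n)\<close>. For any
  other, alternating reflections in \<open>k\<close> and \<open>f\<close> give a positive root of
  level \<open>2 * q\<close> or \<open>4 * q\<^sup>2 - 1\<close>, strictly between 0 and the least
  positive level 1.\<close>

lemma coefficient_gap:
  assumes R: "f \<in> R" and f: "f = cb 0 y z" "y \<ge> 0" "z \<ge> 0" and q: "q = B k f" "q \<ge> 0"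
  shows "q = 0 \<or> q = 1 / 2 \<or> 2 * q\<^sup>2 \<ge> 1"
proof (rule ccontr)
  assume nt: "\<not> ?thesis"
  have fk: "B f k = q" using q B_sym by simp
  have f_K: "f \<in> K" unfolding f cb_plane using f b_P e_P P_K by (simp add: K_add K_scale)
  have lev: "s *\<^sub>R k + t *\<^sub>R f = cb s (t * y) (t * z)" for s t
    by (simp add: f cb_def algebra_simps)
  have rk: "refl k (s *\<^sub>R k + t *\<^sub>R f) = (- s - 2 * t * q) *\<^sub>R k + t *\<^sub>R f" for s t
    using refl_comb[OF kR, of s t f] q by simp
  have rf: "refl f (s *\<^sub>R k + t *\<^sub>R f) = s *\<^sub>R k + (- t - 2 * s * q) *\<^sub>R f" for s t
    using refl_comb[OF R, of t s k] fk by (simp add: add.commute)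
  have no: False if "s *\<^sub>R k + t *\<^sub>R f \<in> R" "0 < s" "s < 1" "t \<ge> 0" for s t
  proof -
    have "s *\<^sub>R k + t *\<^sub>R f \<in> P" using R_nonneg_comb that k_P P_K f_K by auto
    then show False using cb_level[of s "t * y" "t * z"] that lev by simp
  qed
  have "q \<noteq> 0" "q \<noteq> 1 / 2" "2 * q\<^sup>2 < 1" using nt by auto
  then consider "0 < q" "q < 1 / 2" | "1 / 2 < q" "2 * q\<^sup>2 < 1" using q(2) by linarith
  then show False
  proof cases
    case 1
    have "refl f (refl k (0 *\<^sub>R k + 1 *\<^sub>R f)) \<in> R" using refl_R[OF R refl_R[OF kR R]] by simp
    then have "(- 2 * q) *\<^sub>R k + (- 1 + 4 * q * q) *\<^sub>R f \<in> R" unfolding rk rf by (simp add: algebra_simps)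
    then have "- ((- 2 * q) *\<^sub>R k + (- 1 + 4 * q * q) *\<^sub>R f) \<in> R" by (rule neg_R)
    moreover have "- ((- 2 * q) *\<^sub>R k + (- 1 + 4 * q * q) *\<^sub>R f) = (2 * q) *\<^sub>R k + (1 - 4 * q * q) *\<^sub>R f"
      by (simp add: algebra_simps)
    ultimately have "(2 * q) *\<^sub>R k + (1 - 4 * q * q) *\<^sub>R f \<in> R" by (simp only:)
    moreover have "q * q \<le> 1 / 2 * (1 / 2)" using 1 by (intro mult_mono) auto
    ultimately show False using no[of "2 * q" "1 - 4 * q * q"] 1 by simp
  next
    case 2
    have "refl f (refl k (refl f (1 *\<^sub>R k + 0 *\<^sub>R f))) \<in> R"
      using refl_R[OF R refl_R[OF kR refl_R[OF R kR]]] by simp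
    then have *: "(- 1 - 2 * (- 2 * q) * q) *\<^sub>R k + (2 * q - 2 * (- 1 - 2 * (- 2 * q) * q) * q) *\<^sub>R f \<in> R"
      unfolding rk rf by simp
    have "q * q > 1 / 2 * (1 / 2)" using 2 by (intro mult_strict_mono) auto
    moreover have "q * q < 1 / 2" using 2 by (simp add: power2_eq_square)
    moreover have "2 * q - 2 * (- 1 - 2 * (- 2 * q) * q) * q = 4 * q * (1 - 2 * (q * q))"
      by (simp add: algebra_simps)
    moreover have "4 * q * (1 - 2 * (q * q)) \<ge> 0" using 2 \<open>q * q < 1 / 2\<close> by simp
    ultimately show False using no[OF *] by simp
  qed
qed

text \<open>\<open>coefficient_gap\<close> and \<open>k_e1\<close> restrict \<open>l\<close> and
  \<open>m\<close>. The lower bounds on \<open>c\<close> come from \<open>d\<close>: its part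
  orthogonal to \<open>b\<close> has norm \<open>1 - (B b d)\<^sup>2\<close>, which is not positive,
  so the form cannot be positive definite on the span of \<open>k\<close>, \<open>b\<close> and
  \<open>e\<close>. The completed squares compute that norm.\<close>

lemma gram_cases: "(l = 0 \<and> m \<ge> 1 / 2 \<and> m < 1 \<and> c\<^sup>2 + m\<^sup>2 \<ge> 1) \<or> (l = 1 / 2 \<and> m = 0 \<and> 4 * c\<^sup>2 \<ge> 3)"
proof -
  have l: "l = 0 \<or> l = 1 / 2 \<or> 2 * l\<^sup>2 \<ge> 1"
    by (rule coefficient_gap[OF bR b_eq]) (use B_kb l_nonneg in auto)
  have m: "m = 0 \<or> m = 1 / 2 \<or> 2 * m\<^sup>2 \<ge> 1"
    by (rule coefficient_gap[OF eR e_eq]) (use B_ke m_nonneg in auto)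
  have m1: "m < 1" using k_e1 c_pos l_nonneg by (smt (verit) mult_nonneg_nonneg)
  have c1: "c > 1 / 2"
  proof (rule ccontr)
    assume "\<not> ?thesis"
    then have "c * c \<le> 1 / 2 * (1 / 2)" using c_pos by (intro mult_mono) auto
    then show False using c2_ge by (simp add: power2_eq_square)
  qed
  have l2: "\<not> 2 * l\<^sup>2 \<ge> 1"
  proof
    assume "2 * l\<^sup>2 \<ge> 1"
    then have "1 * 1 \<le> (2 * c\<^sup>2) * (2 * l\<^sup>2)" using c2_ge by (intro mult_mono) auto
    then have "1\<^sup>2 \<le> (2 * c * l)\<^sup>2" by (simp add: power2_eq_square algebra_simps)
    then have "1 \<le> 2 * c * l" using c_pos l_nonneg by (simp only: power2_le_imp_le mult_nonneg_nonneg)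
    then show False using k_e1 m_nonneg by simp
  qed
  have mh: "m \<ge> 1 / 2" if "m \<noteq> 0"
  proof (rule ccontr)
    assume n: "\<not> ?thesis"
    then have "m * m \<le> 1 / 2 * (1 / 2)" using m_nonneg by (intro mult_mono) auto
    then have "\<not> 2 * m\<^sup>2 \<ge> 1" by (simp add: power2_eq_square)
    then show False using m that n by auto
  qed
  have nd: "x0\<^sup>2 + y0\<^sup>2 + z0\<^sup>2 + 2 * x0 * y0 * l + 2 * x0 * z0 * m - 2 * y0 * z0 * c = 1"
  proof -
    have "B (cb x0 y0 z0) (cb x0 y0 z0) = 1" using R_norm[OF P_R[OF d_P]] d_coords by (simp add: cb_def)
    then show ?thesis unfolding B_cb by (simp add: power2_eq_square algebra_simps)
  qed
  have bd: "y0 + x0 * l - z0 * c \<ge> 1"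
  proof -
    have "d = cb x0 y0 z0" using d_coords by (simp add: cb_def)
    then show ?thesis using B_bd B_cb_b[of x0 y0 z0] B_sym[of b d] by simp
  qed
  then have sq: "(y0 + x0 * l - z0 * c)\<^sup>2 \<ge> 1" by simp
  show ?thesis
  proof (cases "l = 0")
    case l0: True
    have "c\<^sup>2 + m\<^sup>2 \<ge> 1"
    proof (rule ccontr)
      assume n: "\<not> ?thesis"
      have "(x0 + z0 * m)\<^sup>2 + z0\<^sup>2 * (1 - c\<^sup>2 - m\<^sup>2) = 1 - (y0 + x0 * l - z0 * c)\<^sup>2"
        using nd l0 by (simp add: power2_eq_square algebra_simps)
      then have le: "(x0 + z0 * m)\<^sup>2 + z0\<^sup>2 * (1 - c\<^sup>2 - m\<^sup>2) \<le> 0" using sq by simp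
      have "z0\<^sup>2 * (1 - c\<^sup>2 - m\<^sup>2) \<ge> 0" using n by simp
      then have "z0\<^sup>2 * (1 - c\<^sup>2 - m\<^sup>2) = 0" "(x0 + z0 * m)\<^sup>2 = 0"
        using le zero_le_power2[of "x0 + z0 * m"] by linarith+
      then have "z0 = 0" "x0 + z0 * m = 0" using n by auto
      then show False using x0 by simp
    qed
    moreover have "m \<noteq> 0" using calculation c2_less by auto
    ultimately show ?thesis using l0 mh m1 by simp
  next
    case False
    then have lh: "l = 1 / 2" using l l2 by simp
    then have "2 * c * l = c" by simp
    then have "c + m < 1" using k_e1 by linarith
    then have m0: "m = 0" using mh c1 by fastforce
    have "4 * c\<^sup>2 \<ge> 3"
    proof (rule ccontr)
      assume n: "\<not> ?thesis"
      have "3 / 4 * (x0 + 2 / 3 * z0 * c)\<^sup>2 + z0\<^sup>2 * (1 - 4 / 3 * c\<^sup>2) = 1 - (y0 + x0 * l - z0 * c)\<^sup>2"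
        using nd unfolding lh m0 by (simp add: power2_eq_square algebra_simps)
      then have le: "3 / 4 * (x0 + 2 / 3 * z0 * c)\<^sup>2 + z0\<^sup>2 * (1 - 4 / 3 * c\<^sup>2) \<le> 0" using sq by simp
      have "z0\<^sup>2 * (1 - 4 / 3 * c\<^sup>2) \<ge> 0" using n by simp
      then have "z0\<^sup>2 * (1 - 4 / 3 * c\<^sup>2) = 0" "(x0 + 2 / 3 * z0 * c)\<^sup>2 = 0"
        using le zero_le_power2[of "x0 + 2 / 3 * z0 * c"] by linarith+
      then have "z0 = 0" "x0 + 2 / 3 * z0 * c = 0" using n by auto
      then show False using x0 by simp
    qed
    then show ?thesis using lh m0 by simp
  qed
qed

text \<open>A second positive system of the rank three root system: the plane of \<open>b\<close> and \<open>e\<close> keeps its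
  signs, and all other roots are signed by their level. Its simple roots include
  \<open>b\<close>, \<open>e\<close> and \<open>- k\<close>.\<close>

definition Psi :: "'a set" where
  "Psi = {r \<in> R. \<exists>x y z. r = cb x y z \<and> (x < 0 \<or> x = 0 \<and> r \<in> P)}"

lemma Psi_iff: "cb x y z \<in> Psi \<longleftrightarrow> cb x y z \<in> R \<and> (x < 0 \<or> x = 0 \<and> cb x y z \<in> P)"
  by (auto simp: Psi_def cb_eq_iff)

lemma PsiE:
  assumes "r \<in> Psi"
  obtains x y z where "r = cb x y z" "cb x y z \<in> R" "x < 0 \<or> x = 0 \<and> cb x y z \<in> P" "cb x y z \<in> Psi"
  using assms unfolding Psi_def by blast

text \<open>\<open>refl b\<close> preserves levels, so only level 0 matters, where \<open>b\<close>
  is a canonical root of the plane.\<close>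

lemma Psi_b: "r \<in> Psi \<Longrightarrow> r \<noteq> b \<Longrightarrow> refl b r \<in> Psi"
proof (erule PsiE)
  fix x y z assume r: "r = cb x y z" "cb x y z \<in> R" "x < 0 \<or> x = 0 \<and> cb x y z \<in> P" "r \<noteq> b"
  have R': "cb x (- y - 2 * x * l + 2 * c * z) z \<in> R" using refl_R[OF bR r(2)] by (simp add: refl_cb)
  show "refl b r \<in> Psi"
  proof (cases "x < 0")
    case True
    then show ?thesis using R' r by (simp add: refl_cb Psi_iff)
  next
    case False
    then have x: "x = 0" "cb 0 y z \<in> P" using r by auto
    then have yz: "y \<ge> 0" "z \<ge> 0" using cb_canonical by auto
    have "z \<noteq> 0"
    proof
      assume "z = 0"
      then have "y * y = 1" using R_norm[OF r(2)] x B_cb[of 0 y 0 0 y 0] by simp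
      then have "y = 1" using yz square_eq_1_iff[of y] by auto
      then show False using r x \<open>z = 0\<close> b_eq by simp
    qed
    then show ?thesis using R' r x yz cb_plane_P[of "- y + 2 * c * z" z] by (simp add: refl_cb Psi_iff)
  qed
qed

lemma Psi_e: "r \<in> Psi \<Longrightarrow> r \<noteq> e \<Longrightarrow> refl e r \<in> Psi"
proof (erule PsiE)
  fix x y z assume r: "r = cb x y z" "cb x y z \<in> R" "x < 0 \<or> x = 0 \<and> cb x y z \<in> P" "r \<noteq> e"
  have R': "cb x y (- z - 2 * x * m + 2 * c * y) \<in> R" using refl_R[OF eR r(2)] by (simp add: refl_cb)
  show "refl e r \<in> Psi"
  proof (cases "x < 0")
    case True
    then show ?thesis using R' r by (simp add: refl_cb Psi_iff)
  next
    case False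
    then have x: "x = 0" "cb 0 y z \<in> P" using r by auto
    then have yz: "y \<ge> 0" "z \<ge> 0" using cb_canonical by auto
    have "y \<noteq> 0"
    proof
      assume "y = 0"
      then have "z * z = 1" using R_norm[OF r(2)] x B_cb[of 0 0 z 0 0 z] by simp
      then have "z = 1" using yz square_eq_1_iff[of z] by auto
      then show False using r x \<open>y = 0\<close> e_eq by simp
    qed
    then show ?thesis using R' r x yz cb_plane_P[of y "- z + 2 * c * y"] by (simp add: refl_cb Psi_iff)
  qed
qed

text \<open>The core of the simplicity of \<open>- k\<close> in \<open>Psi\<close>. Suppose
  \<open>refl k\<close> moves a root from level \<open>- x\<close> to \<open>x' > 0\<close>. Unless
  the root is \<open>- k\<close>, its norm forces \<open>x' < 1\<close>, so the reflected root is
  negative and the form value \<open>q\<close> of \<open>k\<close> with the negated root lies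
  strictly between 0 and 1. Levels along the plane of these two roots then follow a recurrence that
  reaches a nonpositive value, although minimality of level 1 keeps them at 1 or above.\<close>

lemma Psi_k_aux:
  assumes r: "cb (- x) y z \<in> R" "x > 0" "cb (- x) y z \<notin> P"
    and r': "cb (- x') (- y) (- z) \<in> R" "x' > 0" and x': "x' = x - 2 * (y * l + z * m)"
  shows "x = 1 \<and> y = 0 \<and> z = 0"
proof (rule ccontr)
  assume ne: "\<not> ?thesis"
  define q where "q = (x + x') / 2"
  have mr: "cb x (- y) (- z) \<in> P" using not_P_iff[OF r(1)] r(3) by (simp add: minus_cb)
  have x1: "x \<ge> 1" using cb_level[OF mr r(2)] .
  have norm: "x * x' + (y\<^sup>2 + z\<^sup>2 - 2 * c * y * z) = 1"
    using R_norm[OF r(1)] unfolding B_cb x' by (simp add: power2_eq_square algebra_simps)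
  have pn: "y\<^sup>2 + z\<^sup>2 - 2 * c * y * z = B (y *\<^sub>R b + z *\<^sub>R e) (y *\<^sub>R b + z *\<^sub>R e)"
    unfolding plane_norm by (simp add: power2_eq_square algebra_simps)
  have x'lt: "x' < 1 \<and> cb (- x') (- y) (- z) \<in> P"
  proof -
    have *: "\<not> x' \<ge> 1"
    proof
      assume "x' \<ge> 1"
      then have "x * x' \<ge> 1 * 1" using x1 by (intro mult_mono) auto
      then have "y = 0 \<and> z = 0" using norm pn plane_norm_zero[of y z] by simp
      then have "x * x = 1" using norm x' by simp
      then have "x = 1" using x1 square_eq_1_iff[of x] by auto
      then show False using ne \<open>y = 0 \<and> z = 0\<close> by simp
    qed
    moreover have "cb (- x') (- y) (- z) \<in> P"
    proof (rule ccontr)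
      assume "\<not> ?thesis"
      then have "cb x' y z \<in> P" using not_P_iff[OF r'(1)] by (simp add: minus_cb)
      then show False using cb_level r'(2) * by blast
    qed
    ultimately show ?thesis by simp
  qed
  have q_eq: "q = x - y * l - z * m" by (simp add: q_def x' field_simps)
  have refl_eq: "refl k (cb x (- y) (- z)) = cb (- x') (- y) (- z)"
    by (simp add: refl_cb cb_eq_iff x' algebra_simps)
  have q1: "q < 1"
  proof (rule ccontr)
    assume "\<not> ?thesis"
    then have "B k (cb x (- y) (- z)) \<ge> 1" using q_eq B_cb_k[of x "- y" "- z"] B_sym by simp
    then have "dom k (cb x (- y) (- z)) \<or> dom (cb x (- y) (- z)) k" using comparable k_P mr by blast
    then show False
    proof
      assume "dom k (cb x (- y) (- z))"
      then have "refl k (cb x (- y) (- z)) \<notin> P" using domD[OF _ refl_M[OF kR]] refl_self[OF kR] P_neg[OF k_P] by auto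
      then show False using x'lt refl_eq by simp
    next
      assume "dom (cb x (- y) (- z)) k"
      moreover have "cb x (- y) (- z) \<noteq> cb 1 0 0" using ne by (simp add: cb_eq_iff)
      ultimately have "1 > x" using cb_dom[OF mr, of 1 0 0] k_P k_eq r(2) by simp
      then show False using x1 by simp
    qed
  qed
  have q0: "q > 0" using r r' by (simp add: q_def)
  define L where "L n = cheb q (Suc n) - cheb q n * x'" for n
  define t where "t n = cheb q (Suc n) *\<^sub>R (- k) - cheb q n *\<^sub>R cb (- x') (- y) (- z)" for n
  have tR: "t n \<in> R" for n unfolding t_def
  proof (rule cheb_roots'[OF neg_R[OF kR] r'(1)])
    show "q = B (- k) (cb (- x') (- y) (- z))"
      using B_cb_mk[of "- x'" "- y" "- z"] B_sym[of "- k"] by (simp add: q_def x')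
  qed
  have t_eq: "- t n = cb (L n) (- (cheb q n * y)) (- (cheb q n * z))" for n
    unfolding t_def L_def mk_eq scale_cb diff_cb minus_cb by (simp add: cb_eq_iff)
  have x_q: "x = 2 * q - x'" unfolding q_def by (simp add: field_simps)
  \<comment> \<open>The invariant of the recurrence. Its value is below 1 as \<open>x\<close> and
    \<open>x'\<close> are positive, whereas a step from \<open>L n \<ge> 1\<close> to a nonpositive
    level would make it at least 1.\<close>
  have Q: "(L (Suc n))\<^sup>2 + (L n)\<^sup>2 - 2 * q * L (Suc n) * L n = 1 - x * x'" for n
  proof (induction n)
    case 0
    show ?case unfolding x_q by (simp add: L_def power2_eq_square algebra_simps)
  next
    case (Suc n)
    have "L (Suc (Suc n)) = 2 * q * L (Suc n) - L n" by (simp add: L_def algebra_simps)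
    moreover have e: "(2 * q * p - r)\<^sup>2 + p\<^sup>2 - 2 * q * (2 * q * p - r) * p = p\<^sup>2 + r\<^sup>2 - 2 * q * p * r" for p r
      by (simp add: power2_eq_square algebra_simps)
    ultimately show ?case using Suc e[of "L (Suc n)" "L n"] by (simp only:)
  qed
  have xx': "x * x' > 0" using r r' by simp
  have inv: "cheb q (Suc n) > 0 \<and> L n \<ge> 1" for n
  proof (induction n)
    case 0
    show ?case by (simp add: L_def)
  next
    case (Suc n)
    have Lpos: "L (Suc n) > 0"
    proof (rule ccontr)
      assume "\<not> ?thesis"
      then have "q * L (Suc n) * L n \<le> 0" using q0 Suc by (simp add: mult_nonneg_nonpos mult_nonpos_nonneg)
      moreover have "(L n)\<^sup>2 \<ge> 1" using Suc by simp
      ultimately have "(L (Suc n))\<^sup>2 + (L n)\<^sup>2 - 2 * q * L (Suc n) * L n \<ge> 1"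
        using zero_le_power2[of "L (Suc n)"] by linarith
      then show False using Q[of n] xx' by simp
    qed
    have ch: "cheb q (Suc (Suc n)) = L (Suc n) + cheb q (Suc n) * x'" by (simp add: L_def)
    have cpos: "cheb q (Suc (Suc n)) > 0" unfolding ch using Lpos Suc r'(2) by (simp add: add_pos_nonneg)
    have "- t (Suc n) = cheb q (Suc (Suc n)) *\<^sub>R k + cheb q (Suc n) *\<^sub>R cb (- x') (- y) (- z)"
      by (simp add: t_def)
    then have "- t (Suc n) \<in> P"
      using R_nonneg_comb[of "cheb q (Suc (Suc n))" k "cheb q (Suc n)" "cb (- x') (- y) (- z)"]
        neg_R[OF tR[of "Suc n"]] cpos Suc k_P x'lt P_K by (simp del: cheb.simps)
    then have "L (Suc n) \<ge> 1" using cb_level Lpos unfolding t_eq by blast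
    then show ?case using cpos by blast
  qed
  have "\<exists>n. L n \<le> 0"
    by (rule oscillating_recurrence[OF _ q1]) (simp add: L_def algebra_simps)
  then show False using inv by (metis less_numeral_extra(1) not_less order_trans)
qed

lemma Psi_k: "r \<in> Psi \<Longrightarrow> r \<noteq> - k \<Longrightarrow> refl k r \<in> Psi"
proof (erule PsiE, rule ccontr)
  fix X y z assume r: "r = cb X y z" "cb X y z \<in> R" "X < 0 \<or> X = 0 \<and> cb X y z \<in> P" "r \<noteq> - k"
    and nP: "refl k r \<notin> Psi"
  define x where "x = - X"
  define x' where "x' = x - 2 * (y * l + z * m)"
  have rx: "r = cb (- x) y z" "cb (- x) y z \<in> R" "x > 0 \<or> x = 0 \<and> cb 0 y z \<in> P"
    using r(1-3) unfolding x_def by auto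
  have refl_r: "refl k r = cb x' y z" unfolding rx(1) by (simp add: refl_cb x'_def cb_eq_iff algebra_simps)
  have r'R: "cb (- x') (- y) (- z) \<in> R" "cb x' y z \<in> R"
    using neg_R[OF refl_R[OF kR rx(2)]] refl_R[OF kR rx(2)] refl_r rx(1) by (simp_all add: minus_cb)
  have x'0: "x' > 0 \<or> x' = 0 \<and> cb 0 (- y) (- z) \<in> P"
  proof -
    have "\<not> (x' < 0 \<or> x' = 0 \<and> cb x' y z \<in> P)" using nP r'R(2) unfolding refl_r Psi_iff by blast
    then have "x' \<ge> 0" "x' = 0 \<Longrightarrow> cb x' y z \<notin> P" by auto
    moreover have "cb 0 (- y) (- z) \<in> P" if "x' = 0" "cb x' y z \<notin> P"
      using not_P_iff[OF r'R(2)] that minus_cb[of x' y z] by simp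
    ultimately show ?thesis by fastforce
  qed
  have "x > 0"
  proof (rule ccontr)
    assume "\<not> ?thesis"
    then have x: "x = 0" "cb 0 y z \<in> P" using rx(3) by auto
    then have yz: "y \<ge> 0" "z \<ge> 0" using cb_canonical by auto
    then have "y * l + z * m \<ge> 0" using l_nonneg m_nonneg by simp
    then have "0 \<le> 2 * (y * l + z * m)" by (rule mult_nonneg_nonneg[OF zero_le_numeral])
    then have "x' \<le> 0" unfolding x'_def x(1) by (simp only: diff_le_0_iff_le)
    then have "cb 0 (- y) (- z) \<in> P" using x'0 by auto
    then have "y = 0" "z = 0" using cb_canonical[of "- y" "- z"] yz by auto
    then have "cb 0 y z = 0" by (simp add: cb_def)
    then show False using R_nonzero P_R[OF x(2)] by blast
  qed
  moreover have "x' > 0"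
  proof (rule ccontr)
    assume "\<not> ?thesis"
    then have x: "x' = 0" "cb 0 (- y) (- z) \<in> P" using x'0 by auto
    then have yz: "y \<le> 0" "z \<le> 0" using cb_canonical[of "- y" "- z"] by auto
    then have "y * l \<le> 0" "z * m \<le> 0" using l_nonneg m_nonneg by (simp_all add: mult_nonpos_nonneg)
    then have "0 \<le> - (y * l + z * m)" using add_nonpos_nonpos neg_0_le_iff_le by blast
    then have "x' \<ge> x" unfolding x'_def
      by (metis add_increasing2 diff_conv_add_uminus mult_minus_right mult_nonneg_nonneg order_refl zero_le_numeral)
    then show False using x(1) \<open>x > 0\<close> by simp
  qed
  ultimately have pos: "x > 0" "x' > 0" by auto
  have "x = 1 \<and> y = 0 \<and> z = 0"
  proof (cases "cb (- x) y z \<in> P")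
    case False
    then show ?thesis using Psi_k_aux[OF rx(2) pos(1) False r'R(1) pos(2) x'_def] by blast
  next
    case True
    \<comment> \<open>\<open>Psi_k_aux\<close> needs a root outside \<open>P\<close>, so it is
      applied to the negative of the reflected root. Were that root positive too, the sum of both
      positive roots would be a negative multiple of \<open>k\<close>.\<close>
    have "cb (- x') (- y) (- z) \<notin> P"
    proof
      assume P': "cb (- x') (- y) (- z) \<in> P"
      have "cb (- x) y z + cb (- x') (- y) (- z) = - ((x + x') *\<^sub>R k)"
        by (simp add: cb_def algebra_simps)
      then have "- ((x + x') *\<^sub>R k) \<in> K" using K_add[OF P_K[OF True] P_K[OF P']] by simp
      moreover have "(x + x') *\<^sub>R k \<in> K" using K_scale[of "x + x'" k] P_K[OF k_P] pos by simp
      ultimately have "(x + x') *\<^sub>R k = 0" using K_salient[of "(x + x') *\<^sub>R k"] by simp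
      then show False using pos R_nonzero[OF kR] by simp
    qed
    note nP' = this
    have xeq: "x = x' - 2 * (- y * l + - z * m)" unfolding x'_def by (simp add: algebra_simps)
    have xR: "cb (- x) (- (- y)) (- (- z)) \<in> R" using rx(2) by simp
    have "x' = 1 \<and> - y = 0 \<and> - z = 0"
      using Psi_k_aux[OF r'R(1) pos(2) nP' xR pos(1) xeq] .
    then show ?thesis using xeq by simp
  qed
  then show False using rx(1) r(4) mk_eq by simp
qed

text \<open>The premises say that \<open>cb (- x) y z\<close>, which has coordinates
  \<open>x\<close>, \<open>y\<close>, \<open>z\<close> in \<open>- k\<close>, \<open>b\<close>,
  \<open>e\<close>, has a nonpositive form value with each of these three roots.\<close>

definition acute :: bool where
  "acute \<longleftrightarrow> (\<forall>x y z. x \<ge> 0 \<longrightarrow> y \<le> x * l + z * c \<longrightarrow> z \<le> x * m + y * c \<longrightarrow> x \<le> y * l + z * m \<longrightarrow> y \<ge> 0 \<and> z \<ge> 0)"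

text \<open>Take a counterexample with least coordinate sum in \<open>- k\<close>, \<open>b\<close>,
  \<open>e\<close>. Reflecting in one of these with positive form value would lower the sum and
  leave a counterexample, so all three values are nonpositive. By \<open>acute\<close> the
  coordinates are nonnegative, and the norm, the sum of coordinates times form values, cannot be 1.
  A least one exists because counterexamples are inverted by \<open>u\<close> or are negatives of
  the finitely many positive roots of positive level.\<close>

lemma Psi_mapped_positive:
  assumes u: "u \<in> M" "u b \<in> P" "u e \<in> P" "u (- k) \<in> P"
    and acute: acute
    and r: "r \<in> Psi"
  shows "u r \<in> P"
proof (rule ccontr)
  assume "u r \<notin> P"
  define Bad where "Bad = {(x, y, z). cb (- x) y z \<in> Psi \<and> u (cb (- x) y z) \<notin> P}"
  have "(\<lambda>(x, y, z). cb (- x) y z) ` Bad \<subseteq> {r \<in> P. u r \<notin> P}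
      \<union> uminus ` {r \<in> P. \<exists>x y z. x > 0 \<and> r = x *\<^sub>R k + y *\<^sub>R b + z *\<^sub>R e}"
  proof
    fix s assume "s \<in> (\<lambda>(x, y, z). cb (- x) y z) ` Bad"
    then obtain x y z where s: "s = cb (- x) y z" "cb (- x) y z \<in> Psi" "u s \<notin> P" by (auto simp: Bad_def)
    show "s \<in> {r \<in> P. u r \<notin> P} \<union> uminus ` {r \<in> P. \<exists>x y z. x > 0 \<and> r = x *\<^sub>R k + y *\<^sub>R b + z *\<^sub>R e}"
    proof (cases "s \<in> P")
      case False
      have "s \<in> R" "x > 0" using s False by (auto simp: Psi_iff)
      then have "- s \<in> P" using False not_P_iff by blast
      moreover have "- s = x *\<^sub>R k + (- y) *\<^sub>R b + (- z) *\<^sub>R e" using s(1) by (simp add: cb_def)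
      ultimately have "- s \<in> {r \<in> P. \<exists>x y z. x > 0 \<and> r = x *\<^sub>R k + y *\<^sub>R b + z *\<^sub>R e}"
        using \<open>x > 0\<close> by blast
      then show ?thesis by (metis (no_types, lifting) UnI2 add.inverse_inverse image_eqI)
    qed (use s in auto)
  qed
  then have "finite ((\<lambda>(x, y, z). cb (- x) y z) ` Bad)"
    using finite_inverted[OF u(1)] finite_level by (meson finite_UnI finite_imageI finite_subset)
  moreover have "inj_on (\<lambda>(x, y, z). cb (- x) y z) Bad" by (auto simp: inj_on_def cb_eq_iff)
  ultimately have fin: "finite Bad" using finite_imageD by blast
  obtain X Y Z where "r = cb X Y Z" using r by (rule PsiE)
  then have "(- X, Y, Z) \<in> Bad" using r \<open>u r \<notin> P\<close> by (simp add: Bad_def)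
  then have ne: "Bad \<noteq> {}" by blast
  define h where "h = (\<lambda>(x, y, z). x + y + z :: real)"
  obtain s where s: "s \<in> Bad" "\<And>t. t \<in> Bad \<Longrightarrow> h s \<le> h t"
    using ex_is_arg_min_if_finite[OF fin ne, of h] by (auto simp: is_arg_min_linorder)
  obtain x y z where sxyz: "s = (x, y, z)" by (cases s)
  let ?r = "cb (- x) y z"
  have rPsi: "?r \<in> Psi" and rbad: "u ?r \<notin> P" using s(1) sxyz by (auto simp: Bad_def)
  have rR: "?r \<in> R" and xx: "x \<ge> 0" using rPsi by (auto simp: Psi_iff)
  have step: False if f: "f \<in> R" "u f \<in> P" "B f ?r > 0" and psi: "?r \<noteq> f \<Longrightarrow> refl f ?r \<in> Psi"
    and eq: "refl f ?r = cb (- x') y' z'" "x' + y' + z' < x + y + z" for f x' y' z'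
  proof -
    have "?r \<noteq> f" using f(2) rbad by auto
    then have P': "refl f ?r \<in> Psi" using psi by blast
    have "u (refl f ?r) \<notin> P"
    proof
      assume a: "u (refl f ?r) \<in> P"
      have "u (refl f ?r) = u ?r - (2 * B f ?r) *\<^sub>R u f"
        unfolding refl_def by (simp add: M_diff[OF u(1)] M_scale[OF u(1)])
      then have "u ?r = 1 *\<^sub>R u (refl f ?r) + (2 * B f ?r) *\<^sub>R u f" by simp
      then have "u ?r \<in> P" using R_nonneg_comb[of 1 "u (refl f ?r)" "2 * B f ?r" "u f"] a f P_K M_R[OF u(1) rR] by simp
      then show False using rbad by blast
    qed
    then have "(x', y', z') \<in> Bad" using P' eq by (simp add: Bad_def)
    then show False using s(2) eq(2) sxyz by (fastforce simp: h_def)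
  qed
  have 1: "y \<le> x * l + z * c"
  proof (rule ccontr)
    assume "\<not> ?thesis"
    then show False
      using step[OF bR u(2) _ Psi_b[OF rPsi], of x "- y + 2 * x * l + 2 * c * z" z] B_cb_b[of "- x" y z] B_sym[of b ?r]
      by (simp add: refl_cb algebra_simps)
  qed
  have 2: "z \<le> x * m + y * c"
  proof (rule ccontr)
    assume "\<not> ?thesis"
    then show False
      using step[OF eR u(3) _ Psi_e[OF rPsi], of x y "- z + 2 * x * m + 2 * c * y"] B_cb_e[of "- x" y z] B_sym[of e ?r]
      by (simp add: refl_cb algebra_simps)
  qed
  have 3: "x \<le> y * l + z * m"
  proof (rule ccontr)
    assume a: "\<not> ?thesis"
    have rm: "refl (- k) v = refl k v" for v by (simp add: refl_def B_simps)
    show False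
      using step[OF neg_R[OF kR] u(4), of "- x + 2 * y * l + 2 * z * m" y z] B_cb_mk[of "- x" y z] B_sym[of "- k" ?r]
        Psi_k[OF rPsi] a unfolding rm
      by (simp add: refl_cb algebra_simps)
  qed
  have yz: "y \<ge> 0" "z \<ge> 0" using acute xx 1 2 3 unfolding acute_def by blast+
  have "1 = x * (x - y * l - z * m) + y * (y - x * l - z * c) + z * (z - x * m - y * c)"
    using R_norm[OF rR] unfolding B_cb by (simp add: algebra_simps)
  moreover have "x * (x - y * l - z * m) \<le> 0" "y * (y - x * l - z * c) \<le> 0" "z * (z - x * m - y * c) \<le> 0"
    using 1 2 3 xx yz by (simp_all add: mult_nonneg_nonpos)
  ultimately show False by linarith
qed

text \<open>If \<open>u\<close> maps the simple roots of \<open>Psi\<close> into \<open>P\<close>, it maps \<open>Psi\<close> into \<open>P\<close>. A contradiction arises if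
  \<open>u\<close> maps a root of \<open>Psi\<close> to the negative root \<open>- d\<close>.\<close>

lemma hard_case_contradiction: False
proof -
  define s where "s = - d"
  have s_cb: "s = cb (- x0) (- y0) (- z0)" by (simp add: s_def d_coords cb_def)
  have s_R: "s \<in> R" and s_P: "s \<notin> P" using d_P P_R neg_R P_neg by (auto simp: s_def)
  have s_Psi: "s \<in> Psi" using s_R x0 unfolding s_cb Psi_iff by auto
  have s_B: "B s b \<le> - 1" using B_bd B_sym by (simp add: s_def B_simps)
  show False
  proof (cases "l = 0")
    case l0: True
    then have m: "m \<ge> 1 / 2" "m < 1" "c\<^sup>2 + m\<^sup>2 \<ge> 1" using gram_cases by auto
    have re: "refl k e = cb (- 2 * m) 0 1" using refl_k_cb[of 0 0 1] by (simp add: e_eq[symmetric])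
    have reR: "refl k e \<in> R" using refl_R kR eR by blast
    \<comment> \<open>Otherwise the negated root is positive of level \<open>2 * m\<close>, and
      \<open>c\<^sup>2 + m\<^sup>2 \<ge> 1\<close> contradicts \<open>level_e1\<close>.\<close>
    have ke: "refl k e \<in> P"
    proof (rule ccontr)
      assume "\<not> ?thesis"
      then have "cb (2 * m) 0 (- 1) \<in> P" using not_P_iff[OF reR] unfolding re by (simp add: minus_cb)
      from level_e1[OF this] m l0 show False by (simp add: power2_eq_square algebra_simps)
    qed
    have kb: "refl k b \<in> P" using b_P l0 B_kb by (simp add: refl_def)
    have kmk: "refl k (- k) \<in> P" using k_P refl_self[OF kR] by (simp add: refl_minus)
    have pos: "refl k r \<in> P" if "r \<in> Psi" for r
    proof (rule Psi_mapped_positive[OF refl_M[OF kR] kb ke kmk _ that])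
      show acute unfolding acute_def
      proof (intro allI impI)
      fix x y z :: real assume a: "x \<ge> 0" "y \<le> x * l + z * c" "z \<le> x * m + y * c" "x \<le> y * l + z * m"
      have zm: "x \<le> z * m" using a l0 by simp
      have z: "z \<ge> 0"
      proof (rule ccontr)
        assume "\<not> ?thesis"
        then have "z * m < 0" using m by (simp add: mult_neg_pos)
        then show False using zm a(1) by linarith
      qed
      have "x * m \<le> z * m * m" using zm m by (intro mult_right_mono) auto
      moreover have "m * m \<le> 1" using m mult_le_one[of m m] by simp
      then have "z * (m * m) \<le> z * 1" using z by (rule mult_left_mono)
      moreover have "z * m * m = z * (m * m)" by simp
      ultimately have "y * c \<ge> 0" using a(3) by linarith
      then show "y \<ge> 0 \<and> z \<ge> 0" using z c_pos by (simp add: zero_le_mult_iff)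
      qed
    qed
    have "s \<noteq> - k"
    proof
      assume "s = - k"
      then have "B s b = - l" using B_kb by (simp add: B_simps)
      then show False using s_B l0 by simp
    qed
    then have "refl k s \<in> Psi" using Psi_k s_Psi by blast
    then have "refl k (refl k s) \<in> P" using pos by blast
    then show False using s_P refl_refl[OF kR] by simp
  next
    case False
    then have l: "l = 1 / 2" and m: "m = 0" and c3: "4 * c\<^sup>2 \<ge> 3" using gram_cases by auto
    have acute: acute unfolding acute_def
    proof (intro allI impI)
      fix x y z :: real assume that: "x \<ge> 0" "y \<le> x * l + z * c" "z \<le> x * m + y * c" "x \<le> y * l + z * m"
      have "y \<ge> 0" using that l m by simp
      moreover have "z * c \<ge> 0" using that l m by simp
      ultimately show "y \<ge> 0 \<and> z \<ge> 0" using c_pos by (simp add: zero_le_mult_iff)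
    qed
    note E = Psi_mapped_positive[OF _ _ _ _ acute]
    have rb: "refl b (cb x y z) = cb x (- y - x + 2 * c * z) z" for x y z by (simp add: refl_cb l)
    have re: "refl e (cb x y z) = cb x y (- z + 2 * c * y)" for x y z by (simp add: refl_cb m)
    have rk: "refl k (cb x y z) = cb (- x - y) y z" for x y z by (simp add: refl_cb l m)
    \<comment> \<open>These roots stay in \<open>Psi\<close>: leaving it would make \<open>s\<close>
      one of a few explicit roots, all with form value above -1 with \<open>b\<close>. Each word
      \<open>u\<close> below satisfies \<open>u si = s\<close> for the matching index
      \<open>i\<close>; since \<open>s\<close> is not positive, no such \<open>u\<close> may map
      \<open>b\<close>, \<open>e\<close> and \<open>- k\<close> into \<open>P\<close>.\<close>
    define s1 s2 s3 s4 s5 where "s1 = refl k s" and "s2 = refl b s1" and "s3 = refl e s2"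
      and "s4 = refl b s3" and "s5 = refl k s4"
    have bk: "s = refl k s1" "s1 = refl b s2" "s2 = refl e s3" "s3 = refl b s4" "s4 = refl k s5"
      unfolding s1_def s2_def s3_def s4_def s5_def using refl_refl[OF kR] refl_refl[OF bR] refl_refl[OF eR]
      by (simp_all only:)
    have Bb: "B (cb x y z) b = y + x / 2 - z * c" for x y z using B_cb_b[of x y z] l by simp
    have "s \<noteq> - k" using s_B Bb[of "- 1" 0 0] by (auto simp: mk_eq[symmetric])
    then have s1: "s1 \<in> Psi" using Psi_k s_Psi by (simp add: s1_def)
    have "s1 \<noteq> b"
    proof
      assume "s1 = b"
      then have "s = refl k (cb 0 1 0)" using bk by (simp only: b_eq[symmetric])
      then show False using s_B unfolding rk by (simp add: Bb)
    qed
    then have s2: "s2 \<in> Psi" using Psi_b s1 by (simp add: s2_def)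
    have "s2 \<noteq> e"
    proof
      assume "s2 = e"
      then have "s = refl k (refl b (cb 0 0 1))" using bk by (simp only: e_eq[symmetric])
      then show False using s_B unfolding rk rb by (simp add: Bb field_simps)
    qed
    then have s3: "s3 \<in> Psi" using Psi_e s2 by (simp add: s3_def)
    have "s3 \<noteq> b"
    proof
      assume "s3 = b"
      then have "s = refl k (refl b (refl e (cb 0 1 0)))" using bk by (simp only: b_eq[symmetric])
      then show False using s_B unfolding rk rb re by (simp add: Bb field_simps)
    qed
    then have s4: "s4 \<in> Psi" using Psi_b s3 by (simp add: s4_def)
    have "s4 \<noteq> - k"
    proof
      assume "s4 = - k"
      then have "s = refl k (refl b (refl e (refl b (cb (- 1) 0 0))))" using bk by (simp only: mk_eq[symmetric])
      then show False using s_B unfolding rk rb re by (simp add: Bb field_simps)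
    qed
    then have s5: "s5 \<in> Psi" using Psi_k s4 by (simp add: s5_def)
    have M: "refl k \<in> M" "refl b \<in> M" "refl e \<in> M" using refl_M kR bR eR by auto
    define f0 f1 f2 f3 where "f0 = refl k b" and "f1 = refl k (refl b e)" and "f2 = refl k (refl b (refl e b))"
      and "f3 = refl k (refl b (refl e (refl b e)))"
    have fR: "f0 \<in> R" "f1 \<in> R" "f2 \<in> R" "f3 \<in> R"
      using refl_R kR bR eR by (simp_all add: f0_def f1_def f2_def f3_def)
    have f3_cb: "f3 = cb (- (8 * c ^ 3 - 4 * c)) (8 * c ^ 3 - 4 * c) (4 * c\<^sup>2 - 1)"
    proof -
      have "f3 = refl k (refl b (refl e (refl b (cb 0 0 1))))" by (simp only: f3_def e_eq[symmetric])
      then show ?thesis by (simp add: rk rb re cb_eq_iff power2_eq_square power3_eq_cube algebra_simps)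
    qed
    have kk: "refl k (- k) = k" "refl e (- k) = - k" "refl b (- k) = - k + b"
    proof -
      show "refl k (- k) = k" using refl_self[OF kR] by (simp add: refl_minus)
      show "refl e (- k) = - k" using m B_ke B_sym[of e k] by (simp add: refl_def B_simps)
      show "refl b (- k) = - k + b"
      proof -
        have "2 * B b k = 1" using B_kb B_sym[of b k] l by simp
        then show ?thesis unfolding refl_def B_simps mult_minus_right by simp
      qed
    qed
    have kbk: "refl k (refl b (- k)) = b"
    proof -
      have "refl k (refl b (cb (- 1) 0 0)) = cb 0 1 0" by (simp add: rk rb)
      then show ?thesis by (simp only: mk_eq b_eq[symmetric])
    qed
    have comp: "f \<circ> g \<in> M" if "f \<in> M" "g \<in> M" for f g using M_comp that by blast
    \<comment> \<open>Otherwise the negated root violates \<open>level_e1\<close>, because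
      \<open>4 * c\<^sup>2 \<ge> 3\<close>.\<close>
    have f3P: "f3 \<in> P"
    proof (rule ccontr)
      assume "\<not> ?thesis"
      then have T: "cb (8 * c ^ 3 - 4 * c) (- (8 * c ^ 3 - 4 * c)) (- (4 * c\<^sup>2 - 1)) \<in> P"
        using not_P_iff[OF fR(4)] unfolding f3_cb by (simp add: minus_cb)
      have a: "8 * c ^ 3 - 4 * c = 4 * c * (2 * c\<^sup>2 - 1)" by (simp add: power2_eq_square power3_eq_cube algebra_simps)
      then have "8 * c ^ 3 - 4 * c > 0" using c_pos c3 by simp
      from level_e1[OF T this] have "(4 * c\<^sup>2 - 1) * (2 * c\<^sup>2 - 1) < 1"
        using l m by (simp add: power2_eq_square power3_eq_cube algebra_simps)
      moreover have "2 * (1 / 2) \<le> (4 * c\<^sup>2 - 1) * (2 * c\<^sup>2 - 1)" using c3 by (intro mult_mono) auto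
      ultimately show False by simp
    qed
    \<comment> \<open>A negative image \<open>fi\<close> of a canonical root lengthens the word by
      one letter: the next word maps a canonical root to \<open>- fi\<close>, which is positive.
      Positivity of \<open>f3\<close> ends the process.\<close>
    consider "f0 \<in> P" | "f0 \<notin> P" "f1 \<in> P" | "f1 \<notin> P" "f2 \<in> P" | "f2 \<notin> P" by blast
    then show False
    proof cases
      case 1
      have "refl k s1 \<in> P" by (rule E[OF M(1) _ _ _ s1]) (use 1 k_P e_P m B_ke kk in \<open>auto simp: f0_def refl_def[of k e]\<close>)
      then show False using s_P bk by simp
    next
      case 2
      let ?u = "refl k \<circ> refl b"
      have "?u b = - f0" "?u e = f1" "?u (- k) = b"
        using refl_self[OF bR] kbk by (simp_all add: f0_def f1_def refl_minus)
      then have "?u s2 \<in> P" by (intro E[OF comp[OF M(1,2)] _ _ _ s2]) (use 2 b_P not_P_iff fR in auto)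
      then show False using s_P bk by simp
    next
      case 3
      let ?u = "refl k \<circ> (refl b \<circ> refl e)"
      have "?u (- k) = b" using kbk kk(2) by (simp only: comp_apply)
      moreover have "?u b = f2" "?u e = - f1"
        using refl_self[OF eR] by (simp_all add: f1_def f2_def refl_minus)
      ultimately have "?u s3 \<in> P" by (intro E[OF comp[OF M(1) comp[OF M(2,3)]] _ _ _ s3]) (use 3 b_P not_P_iff fR in auto)
      then show False using s_P bk by simp
    next
      case 4
      let ?u = "refl k \<circ> (refl b \<circ> (refl e \<circ> refl b))"
      have uM: "?u \<in> M" using comp M by simp
      have ub: "?u b = - f2" using refl_self[OF bR] by (simp add: f2_def refl_minus)
      have ue: "?u e = f3" by (simp add: f3_def)
      have uk: "?u (- k) = b + f2"
      proof -
        have "?u (- k) = refl k (refl b (refl e (- k + b)))" by (simp only: comp_apply kk(3))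
        also have "\<dots> = refl k (refl b (refl e (- k))) + f2" by (simp only: refl_add f2_def)
        finally show ?thesis by (simp only: kk(2) kbk)
      qed
      show False
      proof (cases "?u (- k) \<in> P")
        case True
        then have "?u s4 \<in> P" by (intro E[OF uM _ _ _ s4]) (use 4 ub ue not_P_iff[OF fR(3)] f3P in auto)
        then show False using s_P bk by simp
      next
        case False
        \<comment> \<open>A last reflection in \<open>k\<close> flips the sign of the image of
          \<open>- k\<close> and maps \<open>b\<close> back to \<open>b\<close>.\<close>
        let ?v = "?u \<circ> refl k"
        have "?v e = f3" using ue m B_ke by (simp add: refl_def[of k e])
        moreover have "?v (- k) = - ?u (- k)" using kk(1) M_minus[OF uM, of k] by simp
        then have "?v (- k) \<in> P" using False not_P_iff M_R[OF uM neg_R[OF kR]] by metis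
        moreover have "?v b = b"
        proof -
          have "refl k b = b + (- k)" using kk(1) kbk kk(3)
          by (metis B_kb l refl_def add_uminus_conv_diff divide_self_if mult_numeral_1_right nonzero_mult_div_cancel_left numeral_One scaleR_one times_divide_eq_right zero_neq_numeral)
          then have "?v b = ?u b + ?u (- k)" using M_add[OF uM, of b "- k"] by simp
          then show ?thesis unfolding ub uk by simp
        qed
        ultimately have "?v s5 \<in> P" by (intro E[OF comp[OF uM M(1)] _ _ _ s5]) (use f3P b_P in auto)
        then show False using s_P bk by simp
      qed
    qed
  qed
qed

end

section \<open>Non-small roots of a finite rank two system\<close>

context obtuse_pair
begin

text \<open>Construction of \<open>k\<close>: a positive root of least positive level over
  \<open>d\<close>, and among those one with the largest sum of the other two coordinates.
  Maximality makes its form values with \<open>b\<close> and \<open>e\<close> nonnegative, as a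
  reflection would otherwise raise that sum. Dividing by \<open>x1\<close> gives \<open>k\<close>
  level 1.\<close>

lemma nonsmall_refl_simple:
  assumes b: "nonsmall b" and c2: "2 * c\<^sup>2 \<ge> 1"
  shows "nonsmall (refl b e)"
proof (rule ccontr)
  assume small: "\<not> nonsmall (refl b e)"
  obtain d where d: "d \<in> P" "d \<noteq> b" "dom b d" "B b d \<ge> 1" using nonsmall_B[OF b_P b] .
  note ind = indep3[OF d(1,2,4)]
  have eq: "x = x' \<and> y = y' \<and> z = z'" if "x *\<^sub>R d + y *\<^sub>R b + z *\<^sub>R e = x' *\<^sub>R d + y' *\<^sub>R b + z' *\<^sub>R e" for x y z x' y' z'
  proof -
    have "(x - x') *\<^sub>R d + (y - y') *\<^sub>R b + (z - z') *\<^sub>R e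
        = (x *\<^sub>R d + y *\<^sub>R b + z *\<^sub>R e) - (x' *\<^sub>R d + y' *\<^sub>R b + z' *\<^sub>R e)"
      by (simp add: algebra_simps)
    also have "\<dots> = 0" unfolding that by simp
    finally show ?thesis using ind by fastforce
  qed
  define T where "T = {(x, y, z). x > 0 \<and> x *\<^sub>R d + y *\<^sub>R b + z *\<^sub>R e \<in> P}"
  have "(\<lambda>(x, y, z). x *\<^sub>R d + y *\<^sub>R b + z *\<^sub>R e) ` T \<subseteq> above d"
    by (auto simp: T_def above_def)
  moreover have "inj_on (\<lambda>(x, y, z). x *\<^sub>R d + y *\<^sub>R b + z *\<^sub>R e) T"
    by (rule inj_onI) (auto dest!: eq)
  ultimately have finT: "finite T" using finite_imageD[OF finite_subset[OF _ finite_above[OF d(1-3)]]] by blast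
  have d_T: "(1, 0, 0) \<in> T" using d by (simp add: T_def)
  then have "T \<noteq> {}" by blast
  from ex_is_arg_min_if_finite[OF finT this, of fst]
  obtain t where t: "t \<in> T" "\<And>s. s \<in> T \<Longrightarrow> fst t \<le> fst s"
    unfolding is_arg_min_linorder by blast
  define x1 where "x1 = fst t"
  have x1: "x1 > 0" "x1 \<le> 1" using t(1) t(2)[OF d_T] by (auto simp: x1_def T_def)
  define T' where "T' = {s \<in> T. fst s = x1}"
  have "t \<in> T'" using t(1) by (simp add: T'_def x1_def)
  then have "T' \<noteq> {}" by blast
  moreover have "finite T'" using finT finite_subset[of T' T] by (auto simp: T'_def)
  ultimately have "finite T'" "T' \<noteq> {}" by blast+
  from ex_is_arg_min_if_finite[OF this, of "\<lambda>(x, y, z). - y - z"]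
  obtain s where s: "s \<in> T'" "\<And>u. u \<in> T' \<Longrightarrow> (\<lambda>(x, y, z). - y - z) s \<le> (\<lambda>(x, y, z). - y - z) u"
    unfolding is_arg_min_linorder by blast
  obtain y1 z1 where s_eq: "s = (x1, y1, z1)" using s(1) by (cases s) (auto simp: T'_def)
  define k where "k = x1 *\<^sub>R d + y1 *\<^sub>R b + z1 *\<^sub>R e"
  have k_P: "k \<in> P" using s(1) s_eq by (simp add: T'_def T_def k_def)
  have maxi: "y + z \<le> y1 + z1" if "x1 *\<^sub>R d + y *\<^sub>R b + z *\<^sub>R e \<in> P" for y z
    using s(2)[of "(x1, y, z)"] that x1 s_eq by (simp add: T'_def T_def)
  have mini: "x \<ge> x1" if "x *\<^sub>R d + y *\<^sub>R b + z *\<^sub>R e \<in> P" "x > 0" for x y z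
    using t(2)[of "(x, y, z)"] that by (simp add: T_def x1_def)
  have kl: "B k b \<ge> 0"
  proof (rule ccontr)
    assume "\<not> ?thesis"
    then have neg: "B b k < 0" using B_sym[of b k] by simp
    have r: "refl b k = x1 *\<^sub>R d + (y1 - 2 * B b k) *\<^sub>R b + z1 *\<^sub>R e"
    proof -
      have "refl b k = (x1 *\<^sub>R d + y1 *\<^sub>R b + z1 *\<^sub>R e) - (2 * B b k) *\<^sub>R b"
        unfolding refl_def by (simp only: k_def[symmetric])
      then show ?thesis by (simp add: algebra_simps)
    qed
    have eq1: "refl b k = 1 *\<^sub>R k + (- 2 * B b k) *\<^sub>R b" unfolding refl_def by simp
    have "refl b k \<in> P"
      unfolding eq1 by (rule R_nonneg_comb) (use refl_R[OF bR P_R[OF k_P]] eq1 k_P b_P P_K neg in auto)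
    then show False using maxi[of "y1 - 2 * B b k" z1] r neg by simp
  qed
  have km: "B k e \<ge> 0"
  proof (rule ccontr)
    assume "\<not> ?thesis"
    then have neg: "B e k < 0" using B_sym[of e k] by simp
    have r: "refl e k = x1 *\<^sub>R d + y1 *\<^sub>R b + (z1 - 2 * B e k) *\<^sub>R e"
    proof -
      have "refl e k = (x1 *\<^sub>R d + y1 *\<^sub>R b + z1 *\<^sub>R e) - (2 * B e k) *\<^sub>R e"
        unfolding refl_def by (simp only: k_def[symmetric])
      then show ?thesis by (simp add: algebra_simps)
    qed
    have eq1: "refl e k = 1 *\<^sub>R k + (- 2 * B e k) *\<^sub>R e" unfolding refl_def by simp
    have "refl e k \<in> P"
      unfolding eq1 by (rule R_nonneg_comb) (use refl_R[OF eR P_R[OF k_P]] eq1 k_P e_P P_K neg in auto)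
    then show False using maxi[of y1 "z1 - 2 * B e k"] r neg by simp
  qed
  have conv: "x *\<^sub>R k + y *\<^sub>R b + z *\<^sub>R e = (x * x1) *\<^sub>R d + (x * y1 + y) *\<^sub>R b + (x * z1 + z) *\<^sub>R e" for x y z
    by (simp add: k_def algebra_simps)
  have "hard_case B K R M b e c k d (B k b) (B k e) (1 / x1) (- y1 / x1) (- z1 / x1)"
  proof (unfold_locales, fact k_P, rule refl, rule refl, fact kl, fact km, fact d)
    show "d = (1 / x1) *\<^sub>R k + (- y1 / x1) *\<^sub>R b + (- z1 / x1) *\<^sub>R e"
      unfolding conv using x1 by simp
    show "1 \<le> 1 / x1" using x1 by simp
    show "1 \<le> B b d" by (fact d(4))
    show "x = 0 \<and> y = 0 \<and> z = 0" if "x *\<^sub>R k + y *\<^sub>R b + z *\<^sub>R e = 0" for x y z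
    proof -
      have z: "x * x1 = 0 \<and> x * y1 + y = 0 \<and> x * z1 + z = 0" using ind[of "x * x1" "x * y1 + y" "x * z1 + z"] that unfolding conv by blast
      then have "x = 0" using x1 by simp
      then show ?thesis using z by simp
    qed
    show "1 \<le> x" if "x *\<^sub>R k + y *\<^sub>R b + z *\<^sub>R e \<in> P" "0 < x" for x y z
      using mini[of "x * x1"] that x1 unfolding conv by (simp add: zero_less_mult_iff)
    show "finite {r \<in> P. \<exists>x y z. 0 < x \<and> r = x *\<^sub>R k + y *\<^sub>R b + z *\<^sub>R e}"
    proof (rule finite_subset[OF _ finite_above[OF d(1-3)]])
      show "{r \<in> P. \<exists>x y z. 0 < x \<and> r = x *\<^sub>R k + y *\<^sub>R b + z *\<^sub>R e} \<subseteq> above d"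
        unfolding conv above_def using x1(1) by (auto simp: zero_less_mult_iff) (use mult_pos_pos in blast)
    qed
    show "x < x'" if "x *\<^sub>R k + y *\<^sub>R b + z *\<^sub>R e \<in> P" "x' *\<^sub>R k + y' *\<^sub>R b + z' *\<^sub>R e \<in> P" "0 \<le> x"
      "dom (x *\<^sub>R k + y *\<^sub>R b + z *\<^sub>R e) (x' *\<^sub>R k + y' *\<^sub>R b + z' *\<^sub>R e)"
      "x *\<^sub>R k + y *\<^sub>R b + z *\<^sub>R e \<noteq> x' *\<^sub>R k + y' *\<^sub>R b + z' *\<^sub>R e" for x y z x' y' z'
    proof -
      have "x' * x1 > x * x1"
        using dom_level[OF d(1-3) that(1) _ _ that(2) _ that(4,5), OF conv _ conv] that(3) x1 by simp
      then show ?thesis using x1 by simp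
    qed
    show "1 \<le> 2 * c\<^sup>2" by (fact c2)
    show "\<not> nonsmall (refl b e)" by (fact small)
  qed
  then show False by (rule hard_case.hard_case_contradiction)
qed

text \<open>The gap of \<open>coefficient_gap\<close>, here forced by equal signs of the two
  coordinates of a root: the first root gives \<open>4 * c\<^sup>2 \<ge> 1\<close>, the second
  \<open>2 * c\<^sup>2 \<ge> 1\<close> unless equality holds.\<close>

lemma c_gap: "c = 1 / 2 \<or> 2 * c\<^sup>2 \<ge> 1"
proof -
  have "refl b (refl e (1 *\<^sub>R b + 0 *\<^sub>R e)) \<in> R" using refl_R bR eR by simp
  then have r: "(2 * c * (2 * c) - 1) *\<^sub>R b + (2 * c) *\<^sub>R e \<in> R" unfolding refl_e_plane refl_b_plane by simp
  then have "2 * c * (2 * c) - 1 \<ge> 0" using plane_root_sign[OF r] c_pos by linarith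
  then have c4: "4 * c\<^sup>2 \<ge> 1" by (simp add: power2_eq_square)
  have "refl b (refl e (refl b (0 *\<^sub>R b + 1 *\<^sub>R e))) \<in> R" using refl_R bR eR by simp
  then have "(2 * c * (2 * c * (2 * c) - 1) - 2 * c) *\<^sub>R b + (2 * c * (2 * c) - 1) *\<^sub>R e \<in> R"
    unfolding refl_e_plane refl_b_plane by simp
  note s = plane_root_sign[OF this]
  show ?thesis
  proof (cases "4 * c\<^sup>2 = 1")
    case True
    then have "(2 * c) * (2 * c) = 1" by (simp add: power2_eq_square)
    then have "2 * c = 1" using c_pos square_eq_1_iff[of "2 * c"] by auto
    then show ?thesis by simp
  next
    case False
    then have "2 * c * (2 * c) - 1 > 0" using c4 by (simp add: power2_eq_square)
    then have "2 * c * (2 * c * (2 * c) - 1) - 2 * c \<ge> 0" using s by linarith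
    then have "4 * c * (2 * c\<^sup>2 - 1) \<ge> 0" by (simp add: power2_eq_square algebra_simps)
    then have "2 * c\<^sup>2 - 1 \<ge> 0" using c_pos by (simp add: zero_le_mult_iff)
    then show ?thesis by simp
  qed
qed

text \<open>For \<open>c = 1 / 2\<close> the roots \<open>refl b e\<close> and
  \<open>refl e b\<close> coincide, and the latter arises from the non-small \<open>b\<close> by an
  obtuse reflection.\<close>

lemma nonsmall_refl_b_e:
  assumes "nonsmall b"
  shows "nonsmall (refl b e)"
proof (cases "c = 1 / 2")
  case True
  have "2 * B b e = - 1" "2 * B e b = - 1" using True B_be B_eb by simp_all
  then have "refl b e = refl e b" by (simp add: refl_def)
  then show ?thesis using nonsmall_refl_obtuse[OF b_P assms e_P] B_be c_pos by simp
next
  case False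
  then show ?thesis using nonsmall_refl_simple[OF assms] c_gap by blast
qed

text \<open>A counterexample with least coordinate sum has positive form value with \<open>b\<close>
  or \<open>e\<close>. Reflecting there gives a root of smaller sum that is again interior, hence
  non-small, or is \<open>b\<close> or \<open>e\<close>; reflecting back is an obtuse step. Only the
  return from \<open>e\<close> needs \<open>nonsmall_refl_b_e\<close>.\<close>

lemma nonsmall_plane:
  assumes b: "nonsmall b" and r: "x *\<^sub>R b + y *\<^sub>R e \<in> P" "x > 0" "y > 0"
  shows "nonsmall (x *\<^sub>R b + y *\<^sub>R e)"
proof (rule ccontr)
  assume small: "\<not> ?thesis"
  define S where "S = {(x, y). x > 0 \<and> y > 0 \<and> x *\<^sub>R b + y *\<^sub>R e \<in> P \<and> \<not> nonsmall (x *\<^sub>R b + y *\<^sub>R e)}"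
  have "(\<lambda>(x, y). x *\<^sub>R b + y *\<^sub>R e) ` S \<subseteq> {r \<in> P. \<exists>y z. r = y *\<^sub>R b + z *\<^sub>R e}"
    by (auto simp: S_def)
  moreover have "inj_on (\<lambda>(x, y). x *\<^sub>R b + y *\<^sub>R e) S"
    by (rule inj_onI) (auto dest!: plane_eqD)
  ultimately have "finite S" using finite_imageD[OF finite_subset[OF _ finite_plane_roots]] by blast
  moreover have "S \<noteq> {}" using small r by (auto simp: S_def)
  ultimately obtain s where s: "s \<in> S" "\<And>t. t \<in> S \<Longrightarrow> (\<lambda>(x, y). x + y) s \<le> (\<lambda>(x, y). x + y) t"
    using ex_is_arg_min_if_finite[of S "\<lambda>(x, y). x + y"] unfolding is_arg_min_linorder by blast
  obtain p q where pq: "s = (p, q)" by (cases s)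
  let ?r = "p *\<^sub>R b + q *\<^sub>R e"
  have r: "p > 0" "q > 0" "?r \<in> P" "\<not> nonsmall ?r" using s(1) pq by (auto simp: S_def)
  have least: "nonsmall (x *\<^sub>R b + y *\<^sub>R e)" if "x > 0" "y > 0" "x *\<^sub>R b + y *\<^sub>R e \<in> P" "x + y < p + q" for x y
    using s(2)[of "(x, y)"] that pq by (auto simp: S_def)
  have "p * (p - c * q) + q * (q - c * p) = 1"
    using R_norm[OF P_R[OF r(3)]] by (simp add: B_simps B_bb B_ee B_be B_eb algebra_simps)
  moreover have "p * (p - c * q) \<le> 0" if "\<not> p - c * q > 0" using r(1) that by (simp add: mult_nonneg_nonpos)
  moreover have "q * (q - c * p) \<le> 0" if "\<not> q - c * p > 0" using r(2) that by (simp add: mult_nonneg_nonpos)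
  ultimately consider "q - c * p > 0" | "p - c * q > 0" by linarith
  then show False
  proof cases
    case 1
    let ?s = "refl e ?r"
    have s_eq: "?s = p *\<^sub>R b + (2 * c * p - q) *\<^sub>R e" unfolding refl_e_plane ..
    have sR: "?s \<in> R" using refl_R eR P_R r by blast
    then have sP: "?s \<in> P" "2 * c * p - q \<ge> 0" using plane_root_sign[of p "2 * c * p - q"] r(1) unfolding s_eq by auto
    have "nonsmall ?s"
    proof (cases "2 * c * p - q = 0")
      case True
      then have sp: "?s = p *\<^sub>R b" unfolding s_eq by simp
      then have "p * p = 1" using R_norm[OF sR] by (simp add: B_simps B_bb)
      then have "p = 1" using r(1) square_eq_1_iff[of p] by auto
      then show ?thesis using sp b by simp
    next
      case False
      then show ?thesis unfolding s_eq using sP r(1) 1 False by (intro least) (auto simp: s_eq)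
    qed
    moreover have "B ?s e \<le> 0" using 1 unfolding s_eq by (simp add: B_simps B_bb B_ee B_be B_eb algebra_simps)
    ultimately have "nonsmall (refl e ?s)" using nonsmall_refl_obtuse[OF sP(1) _ e_P] by blast
    then show False using r(4) refl_refl[OF eR] by simp
  next
    case 2
    let ?s = "refl b ?r"
    have s_eq: "?s = (2 * c * q - p) *\<^sub>R b + q *\<^sub>R e" unfolding refl_b_plane ..
    have sR: "?s \<in> R" using refl_R bR P_R r by blast
    then have sP: "?s \<in> P" "2 * c * q - p \<ge> 0" using plane_root_sign[of "2 * c * q - p" q] r(2) unfolding s_eq by auto
    show False
    proof (cases "2 * c * q - p = 0")
      case True
      then have sp: "?s = q *\<^sub>R e" unfolding s_eq by simp
      then have "q * q = 1" using R_norm[OF sR] by (simp add: B_simps B_ee)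
      then have "q = 1" using r(2) square_eq_1_iff[of q] by auto
      then have "?s = e" using sp by simp
      then have "?r = refl b e" using refl_refl[OF bR, of ?r] by simp
      then show False using nonsmall_refl_b_e[OF b] r(4) by simp
    next
      case False
      have "nonsmall ?s" unfolding s_eq using sP r(2) 2 False by (intro least) (auto simp: s_eq)
      moreover have "B ?s b \<le> 0" using 2 unfolding s_eq by (simp add: B_simps B_bb B_ee B_be B_eb algebra_simps)
      ultimately have "nonsmall (refl b ?s)" using nonsmall_refl_obtuse[OF sP(1) _ b_P] by blast
      then show False using r(4) refl_refl[OF bR] by simp
    qed
  qed
qed

end

section \<open>Transfer of non-smallness inside an arbitrary root plane\<close>

context reflection_system
begin

text \<open>The bipodality of the set of small roots, without reference to a Coxeter group.\<close>

lemma nonsmall_transfer: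
  assumes f: "f \<in> P" and a: "a \<in> P" and nf: "nonsmall f"
    and g: "g \<in> M" "g f \<notin> P" "g a \<notin> P"
    and indec: "\<And>p q s t s' t'. p > 0 \<Longrightarrow> q > 0 \<Longrightarrow> s *\<^sub>R f + t *\<^sub>R a \<in> P \<Longrightarrow> s' *\<^sub>R f + t' *\<^sub>R a \<in> P \<Longrightarrow>
      f = p *\<^sub>R (s *\<^sub>R f + t *\<^sub>R a) + q *\<^sub>R (s' *\<^sub>R f + t' *\<^sub>R a) \<Longrightarrow> t = 0"
    and a_eq: "a = x *\<^sub>R f + y *\<^sub>R e0" "x > 0" "y > 0" "e0 \<in> P"
  shows "nonsmall a"
proof -
  define h where "h = B f a"
  have R: "f \<in> R" "a \<in> R" using f a P_R by auto
  have Bs: "B f f = 1" "B a a = 1" "B a f = h" "B f a = h" using R_norm R B_sym h_def by auto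
  have h_gt: "h > - 1" using inverted_pair_B[OF g(1) f a g(2,3)] by (simp add: h_def)
  show ?thesis
  proof (cases "h \<ge> 1")
    case True
    obtain d where d: "d \<in> P" "d \<noteq> f" "dom f d" using nf by (auto simp: nonsmall_def)
    \<comment> \<open>If \<open>f\<close> dominated \<open>a\<close>, then \<open>- refl f a\<close>
      would be a positive root and \<open>f\<close> a positive combination of it and
      \<open>a\<close>, against indecomposability. So \<open>a\<close> dominates \<open>f\<close>
      and all that \<open>f\<close> dominates.\<close>
    have "\<not> dom f a"
    proof
      assume df: "dom f a"
      then have "refl f a \<notin> P" using domD[OF df refl_M[OF R(1)]] refl_self[OF R(1)] P_neg[OF f] by simp
      then have "- refl f a \<in> P" using not_P_iff refl_R R by blast
      moreover have e: "- refl f a = (2 * h) *\<^sub>R f + (- 1) *\<^sub>R a" by (simp add: refl_def h_def)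
      ultimately have 1: "(2 * h) *\<^sub>R f + (- 1) *\<^sub>R a \<in> P" by simp
      have 2: "0 *\<^sub>R f + 1 *\<^sub>R a \<in> P" using a by simp
      have "f = (1 / (2 * h)) *\<^sub>R ((2 * h) *\<^sub>R f + (- 1) *\<^sub>R a) + (1 / (2 * h)) *\<^sub>R (0 *\<^sub>R f + 1 *\<^sub>R a)"
        using True by (simp add: scaleR_right_diff_distrib)
      from indec[OF _ _ 1 2 this] True show False by simp
    qed
    then have da: "dom a f" using comparable[OF f a] True by (auto simp: h_def)
    then have "dom a d" using d dom_trans by blast
    moreover have "d \<noteq> a" using d(3) \<open>\<not> dom f a\<close> by blast
    ultimately show ?thesis using nonsmall_dom a d by blast
  next
    case False
    define pv where "pv s t = s *\<^sub>R f + t *\<^sub>R a" for s t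
    have h1: "1 - h\<^sup>2 > 0" using h_gt False abs_square_less_1[of h] by auto
    have norm: "B (pv s t) (pv s t) = (s + h * t)\<^sup>2 + (1 - h\<^sup>2) * t\<^sup>2" for s t
      by (simp add: pv_def B_simps Bs power2_eq_square algebra_simps)
    have pv0: "s = 0 \<and> t = 0" if "pv s t = 0" for s t
    proof -
      have n: "(s + h * t)\<^sup>2 + (1 - h\<^sup>2) * t\<^sup>2 = 0" using that norm[of s t] by (simp add: B_simps)
      then have "(1 - h\<^sup>2) * t\<^sup>2 = 0" using h1 zero_le_power2[of "s + h * t"] by (smt (verit) mult_nonneg_nonneg zero_le_power2)
      then have "t = 0" using h1 by simp
      then show ?thesis using n by simp
    qed
    have pvd: "pv s t - pv s' t' = pv (s - s') (t - t')" for s t s' t' by (simp add: pv_def algebra_simps)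
    have pveq: "s = s' \<and> t = t'" if "pv s t = pv s' t'" for s t s' t'
      using pv0[of "s - s'" "t - t'"] pvd[of s t s' t'] that by simp
    have pvm: "- pv s t = pv (- s) (- t)" for s t by (simp add: pv_def)
    \<comment> \<open>Since \<open>f\<close> is indecomposable, the coefficient at \<open>a\<close>
      decides the sign of every root of the plane other than \<open>f\<close> and
      \<open>- f\<close>.\<close>
    have pos1: "t > 0 \<or> t = 0 \<and> s = 1" if p: "pv s t \<in> P" for s t
    proof -
      have "\<not> t < 0"
      proof
        assume t: "t < 0"
        have "s > 0"
        proof (rule ccontr)
          assume "\<not> s > 0"
          then have "(- s) *\<^sub>R f + (- t) *\<^sub>R a \<in> P" using R_nonneg_comb[of "- s" f "- t" a] neg_R[OF P_R[OF p]] f a P_K t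
            by (simp add: pv_def)
          then show False using P_neg[OF p] by (simp add: pv_def)
        qed
        have 2: "0 *\<^sub>R f + 1 *\<^sub>R a \<in> P" using a by simp
        have "f = (1 / s) *\<^sub>R (s *\<^sub>R f + t *\<^sub>R a) + (- t / s) *\<^sub>R (0 *\<^sub>R f + 1 *\<^sub>R a)"
          using \<open>s > 0\<close> by (simp add: scaleR_right_distrib)
        from indec[OF _ _ p[unfolded pv_def] 2 this] \<open>s > 0\<close> t show False by (simp add: divide_neg_pos)
      qed
      moreover have "s = 1" if "t = 0"
      proof -
        have "s * s = 1" using norm[of s t] R_norm[OF P_R[OF p]] that by (simp add: power2_eq_square)
        moreover have "s \<noteq> - 1" using p P_neg[OF f] that by (auto simp: pv_def)
        ultimately show ?thesis using square_eq_1_iff[of s] by auto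
      qed
      ultimately show ?thesis by linarith
    qed
    have pos2: "pv s t \<in> P" if "pv s t \<in> R" "t > 0" for s t
    proof (rule ccontr)
      assume "\<not> ?thesis"
      then have "pv (- s) (- t) \<in> P" using not_P_iff[OF that(1)] pvm by simp
      then show False using pos1[of "- s" "- t"] that(2) by simp
    qed
    have reflf: "refl f (pv s t) = pv (- s - 2 * h * t) t" for s t
      unfolding pv_def using refl_comb[OF R(1), of s t a] by (simp add: h_def mult.commute mult.left_commute)
    \<comment> \<open>The second canonical root is the positive root of least slope
      \<open>s / t\<close>. Slopes up to \<open>- 2 * h\<close> suffice: the reflections of such
      roots in \<open>f\<close> are nonnegative combinations of \<open>f\<close> and
      \<open>a\<close>, hence inverted by \<open>g\<close>, so there are finitely many.\<close>
    define E where "E = {(s, t). pv s t \<in> P \<and> t > 0 \<and> s \<le> - 2 * h * t}"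
    have "(\<lambda>(s, t). pv (- s - 2 * h * t) t) ` E \<subseteq> {r \<in> P. g r \<notin> P}"
    proof
      fix r assume "r \<in> (\<lambda>(s, t). pv (- s - 2 * h * t) t) ` E"
      then obtain s t where st: "r = pv (- s - 2 * h * t) t" "pv s t \<in> P" "t > 0" "s \<le> - 2 * h * t" by (auto simp: E_def)
      have "r \<in> R" using st(1) reflf[of s t] refl_R[OF R(1) P_R[OF st(2)]] by simp
      then have rP: "r \<in> P" using pos2 st by simp
      have "- g r = (- s - 2 * h * t) *\<^sub>R (- g f) + t *\<^sub>R (- g a)"
        unfolding st(1) pv_def by (simp add: M_add[OF g(1)] M_scale[OF g(1)])
      moreover have "- g f \<in> P" "- g a \<in> P" using not_P_iff M_R[OF g(1)] R g by blast+
      ultimately have "- g r \<in> P"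
        using R_nonneg_comb[of "- s - 2 * h * t" "- g f" t "- g a"] neg_R[OF M_R[OF g(1) \<open>r \<in> R\<close>]] st P_K by simp
      then show "r \<in> {r \<in> P. g r \<notin> P}" using rP P_neg by fastforce
    qed
    moreover have "inj_on (\<lambda>(s, t). pv (- s - 2 * h * t) t) E"
      by (rule inj_onI) (auto dest!: pveq)
    ultimately have "finite E" using finite_imageD[OF finite_subset[OF _ finite_inverted[OF g(1)]]] by blast
    moreover have "(- 2 * h, 1) \<in> E"
    proof -
      have "refl f (pv 0 1) \<in> R" using refl_R R by (simp add: pv_def)
      then show ?thesis using pos2 unfolding reflf E_def by simp
    qed
    then have "E \<noteq> {}" by blast
    ultimately obtain st where st: "st \<in> E" "\<And>u. u \<in> E \<Longrightarrow> (\<lambda>(s, t). s / t) st \<le> (\<lambda>(s, t). s / t) u"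
      using ex_is_arg_min_if_finite[of E "\<lambda>(s, t). s / t"] unfolding is_arg_min_linorder by blast
    obtain s0 t0 where st0: "st = (s0, t0)" by (cases st)
    have e: "pv s0 t0 \<in> P" "t0 > 0" "s0 \<le> - 2 * h * t0" using st(1) st0 by (auto simp: E_def)
    have ratio: "s0 / t0 \<le> s / t" if "pv s t \<in> P" "t > 0" for s t
    proof (cases "s \<le> - 2 * h * t")
      case True
      then show ?thesis using st(2)[of "(s, t)"] that st0 by (simp add: E_def)
    next
      case False
      have "s0 / t0 \<le> - 2 * h" using e by (simp add: pos_divide_le_eq)
      moreover have "- 2 * h \<le> s / t" using False that(2) by (simp add: pos_le_divide_eq)
      ultimately show ?thesis by linarith
    qed
    define e where "e = pv s0 t0"
    define c where "c = - B f e"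
    have c_eq: "c = - (s0 + h * t0)" by (simp add: c_def e_def pv_def B_simps Bs mult.commute)
    have comb: "p *\<^sub>R f + q *\<^sub>R e = pv (p + q * s0) (q * t0)" for p q by (simp add: e_def pv_def algebra_simps)
    have canon: "p \<ge> 0 \<and> q \<ge> 0" if "p *\<^sub>R f + q *\<^sub>R e \<in> P" for p q
    proof -
      have pp: "pv (p + q * s0) (q * t0) \<in> P" using that comb by simp
      from pos1[OF this] show ?thesis
      proof
        assume qt: "q * t0 > 0"
        then have q: "q > 0" using \<open>t0 > 0\<close> by (simp add: zero_less_mult_iff)
        have "s0 / t0 \<le> (p + q * s0) / (q * t0)" using ratio[OF pp qt] .
        then have "s0 * q \<le> p + q * s0" using q \<open>t0 > 0\<close> by (simp add: field_simps)
        then show ?thesis using q by (simp add: mult.commute)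
      next
        assume "q * t0 = 0 \<and> p + q * s0 = 1"
        then show ?thesis using \<open>t0 > 0\<close> by auto
      qed
    qed
    have eR: "e \<in> R" using e_def \<open>pv s0 t0 \<in> P\<close> P_R by simp
    have c0: "c \<ge> 0"
    proof (rule ccontr)
      assume "\<not> ?thesis"
      have "refl f e = pv (s0 + 2 * c) t0" unfolding e_def reflf c_eq by (simp add: algebra_simps)
      then have "pv (s0 + 2 * c) t0 \<in> P" using pos2[of "s0 + 2 * c" t0] refl_R[OF R(1) eR] \<open>t0 > 0\<close> by simp
      then have "s0 / t0 \<le> (s0 + 2 * c) / t0" using ratio \<open>t0 > 0\<close> by blast
      then show False using \<open>\<not> c \<ge> 0\<close> \<open>t0 > 0\<close> by (simp add: divide_le_cancel)
    qed
    have c1: "c < 1"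
    proof -
      have "c\<^sup>2 + (1 - h\<^sup>2) * t0\<^sup>2 = 1" using norm[of s0 t0] R_norm[OF eR] unfolding e_def c_eq power2_minus by simp
      moreover have "(1 - h\<^sup>2) * t0\<^sup>2 > 0" using h1 \<open>t0 > 0\<close> by simp
      ultimately have "c\<^sup>2 < 1" by linarith
      then show ?thesis using c0 by (simp add: abs_square_less_1)
    qed
    \<comment> \<open>\<open>e0\<close> has negative slope, so the least slope is negative and
      \<open>a\<close> lies strictly between \<open>f\<close> and \<open>e\<close>.\<close>
    have s0_neg: "s0 < 0"
    proof -
      have "y *\<^sub>R pv (- x / y) (1 / y) = a - x *\<^sub>R f" using a_eq by (simp add: pv_def scaleR_right_distrib)
      also have "\<dots> = y *\<^sub>R e0" by (subst a_eq(1)) simp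
      finally have "e0 = pv (- x / y) (1 / y)" using a_eq by simp
      then have "s0 / t0 \<le> (- x / y) / (1 / y)" using ratio[of "- x / y" "1 / y"] a_eq by simp
      also have "\<dots> < 0" using a_eq by simp
      finally show ?thesis using \<open>t0 > 0\<close> by (simp add: divide_less_0_iff)
    qed
    have a_e: "a = (- s0 / t0) *\<^sub>R f + (1 / t0) *\<^sub>R e"
      using \<open>t0 > 0\<close> by (simp add: e_def pv_def scaleR_right_distrib)
    \<comment> \<open>If \<open>f\<close> and \<open>e\<close> were orthogonal,
      \<open>refl e a\<close> would have coefficients of opposite sign.\<close>
    have cpos: "c > 0"
    proof (rule ccontr)
      assume "\<not> ?thesis"
      then have "B e f = 0" using c0 B_sym by (simp add: c_def)
      then have "refl e ((1 / t0) *\<^sub>R e + (- s0 / t0) *\<^sub>R f) = (- (1 / t0)) *\<^sub>R e + (- s0 / t0) *\<^sub>R f"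
        using refl_comb[OF eR, of "1 / t0" "- s0 / t0" f] by simp
      then have "refl e a = (- s0 / t0) *\<^sub>R f + (- (1 / t0)) *\<^sub>R e" by (subst a_e) (simp only: add.commute)
      then have r: "(- s0 / t0) *\<^sub>R f + (- (1 / t0)) *\<^sub>R e \<in> R" using refl_R[OF eR R(2)] by simp
      have "- ((- s0 / t0) *\<^sub>R f + (- (1 / t0)) *\<^sub>R e) = (s0 / t0) *\<^sub>R f + (1 / t0) *\<^sub>R e" by simp
      then have "(- s0 / t0) *\<^sub>R f + (- (1 / t0)) *\<^sub>R e \<in> P \<or> (s0 / t0) *\<^sub>R f + (1 / t0) *\<^sub>R e \<in> P"
        using not_P_iff[OF r] by argo
      then have "- (1 / t0) \<ge> 0 \<or> s0 / t0 \<ge> 0" using canon by blast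
      then show False using \<open>t0 > 0\<close> s0_neg by (simp add: zero_le_divide_iff)
    qed
    interpret obtuse_pair B K R M f e c
      by unfold_locales (use f cpos c1 canon \<open>pv s0 t0 \<in> P\<close> in \<open>auto simp: e_def[symmetric] c_def\<close>)
    show ?thesis
      using nonsmall_plane[OF nf, of "- s0 / t0" "1 / t0"] a a_e s0_neg \<open>t0 > 0\<close> by (simp add: divide_neg_pos)
  qed
qed

lemma P_independent:
  assumes "a \<in> P" "b \<in> P" "a \<noteq> b" "x *\<^sub>R a + y *\<^sub>R b = 0"
  shows "x = 0 \<and> y = 0"
proof -
  have 0: "a \<noteq> 0" "b \<noteq> 0" using assms R_nonzero P_R by blast+
  have ratio: "a = b" if "a \<in> P" "b \<in> P" "x > 0" "y < 0" "x *\<^sub>R a + y *\<^sub>R b = 0" for a b x y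
  proof -
    define k where "k = - y / x"
    have "x *\<^sub>R a = (- y) *\<^sub>R b" using that(5) by (simp add: eq_neg_iff_add_eq_0)
    then have "(1 / x) *\<^sub>R (x *\<^sub>R a) = (1 / x) *\<^sub>R ((- y) *\<^sub>R b)" by (simp only:)
    then have ak: "a = k *\<^sub>R b" using that(3) by (simp add: k_def)
    have k: "k > 0" unfolding k_def using that(3,4) by (intro divide_pos_pos) auto
    have "B a a = k * k * B b b" unfolding ak by (simp add: B_simps)
    then have "k * k = 1" using R_norm[OF P_R[OF that(1)]] R_norm[OF P_R[OF that(2)]] by simp
    then have "k = 1" using k square_eq_1_iff[of k] by auto
    then show ?thesis using ak by simp
  qed
  consider "x \<ge> 0 \<and> y \<ge> 0" | "x \<le> 0 \<and> y \<le> 0" | "x > 0 \<and> y < 0" | "y > 0 \<and> x < 0" by linarith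
  then show ?thesis
  proof cases
    case 1
    then show ?thesis using positive_relation[OF assms(4)] assms(1,2) P_K 0 by blast
  next
    case 2
    have "(- x) *\<^sub>R a + (- y) *\<^sub>R b = - (x *\<^sub>R a + y *\<^sub>R b)" by simp
    then have "(- x) *\<^sub>R a + (- y) *\<^sub>R b = 0" unfolding assms(4) by simp
    then have "- x = 0 \<and> - y = 0"
      by (rule positive_relation) (use assms P_K 0 2 in auto)
    then show ?thesis by simp
  next
    case 3
    then show ?thesis using ratio[OF assms(1,2) _ _ assms(4)] assms(3) by blast
  next
    case 4
    have "y *\<^sub>R b + x *\<^sub>R a = 0" using assms(4) by (simp add: add.commute)
    then show ?thesis using ratio[OF assms(2,1)] 4 assms(3) by blast
  qed
qed

end

section \<open>Lengths and signs of roots\<close>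

lemma cheb_cos: "sin x \<noteq> 0 \<Longrightarrow> cheb (cos x) n = sin (real n * x) / sin x"
proof (induction "cos x" n rule: cheb.induct)
  case (3 n)
  have "sin (real (Suc (Suc n)) * x) + sin (real n * x) = 2 * cos x * sin (real (Suc n) * x)"
  proof -
    have "real (Suc (Suc n)) * x = real (Suc n) * x + x" "real n * x = real (Suc n) * x - x"
      by (simp_all add: algebra_simps)
    then show ?thesis by (simp only: sin_add sin_diff) simp
  qed
  then have "sin (real (Suc (Suc n)) * x) = 2 * cos x * sin (real (Suc n) * x) - sin (real n * x)" by linarith
  then show ?case using 3 by (simp add: diff_divide_distrib)
qed auto

lemma cheb_cos_nonneg:
  assumes "m \<ge> 2" "n \<le> m"
  shows "cheb (cos (pi / real m)) n \<ge> 0"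
proof -
  have x: "0 < pi / real m" "pi / real m < pi" using assms pi_gt_zero by (auto simp: field_simps)
  then have s: "sin (pi / real m) > 0" by (rule sin_gt_zero)
  have "real n * (pi / real m) \<le> pi" using assms by (simp add: field_simps)
  moreover have "real n * (pi / real m) \<ge> 0" using x by simp
  ultimately have "sin (real n * (pi / real m)) \<ge> 0" by (intro sin_ge_zero)
  then show ?thesis using cheb_cos[of "pi / real m" n] s by simp
qed

section \<open>Words and lengths in a Coxeter system\<close>

context coxeter_system
begin

lemma S_carrier: "s \<in> S \<Longrightarrow> s \<in> carrier W"
  using S_subset by blast

lemma S_square: "s \<in> S \<Longrightarrow> s \<otimes> s = \<one>"
  using S_involutions[of s] pow_ord_eq_1[of s] S_carrier[of s] by (simp add: numeral_2_eq_2)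

lemma S_inv: "s \<in> S \<Longrightarrow> inv s = s"
  using S_square S_carrier inv_equality by blast

lemma S_cancel: "s \<in> S \<Longrightarrow> w \<in> carrier W \<Longrightarrow> s \<otimes> (s \<otimes> w) = w"
  and S_cancel_right: "s \<in> S \<Longrightarrow> w \<in> carrier W \<Longrightarrow> (w \<otimes> s) \<otimes> s = w"
proof -
  assume a: "s \<in> S" "w \<in> carrier W"
  have "s \<otimes> (s \<otimes> w) = (s \<otimes> s) \<otimes> w" using a S_carrier m_assoc by metis
  then show "s \<otimes> (s \<otimes> w) = w" using a S_square by simp
next
  assume a: "s \<in> S" "w \<in> carrier W"
  have "(w \<otimes> s) \<otimes> s = w \<otimes> (s \<otimes> s)" using a S_carrier m_assoc by metis
  then show "(w \<otimes> s) \<otimes> s = w" using a S_square by simp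
qed

lemma word_prod_Nil: "word_prod [] = \<one>"
  and word_prod_Cons: "word_prod (s # ws) = s \<otimes> word_prod ws"
  by (simp_all add: word_prod_def)

lemma word_prod_closed: "ws \<in> lists S \<Longrightarrow> word_prod ws \<in> carrier W"
  by (induction ws) (auto simp: word_prod_Nil word_prod_Cons S_carrier)

lemma word_prod_append: "us \<in> lists S \<Longrightarrow> vs \<in> lists S \<Longrightarrow> word_prod (us @ vs) = word_prod us \<otimes> word_prod vs"
  by (induction us) (auto simp: word_prod_Nil word_prod_Cons S_carrier word_prod_closed m_assoc)

lemma word_prod_rev: "ws \<in> lists S \<Longrightarrow> word_prod (rev ws) = inv (word_prod ws)"
proof (induction ws)
  case (Cons s ws)
  then have s: "s \<in> S" "ws \<in> lists S" "rev ws \<in> lists S" by auto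
  then show ?case using Cons word_prod_append[of "rev ws" "[s]"]
    by (simp add: word_prod_Nil word_prod_Cons S_carrier word_prod_closed S_inv inv_mult_group)
qed (simp add: word_prod_Nil)

lemma exists_word: "w \<in> carrier W \<Longrightarrow> \<exists>ws \<in> lists S. word_prod ws = w"
proof -
  assume "w \<in> carrier W"
  then have "w \<in> generate W S" using S_generates by simp
  then show ?thesis
  proof (induction rule: generate.induct)
    case one
    then show ?case by (intro bexI[of _ "[]"]) (auto simp: word_prod_Nil)
  next
    case (incl h)
    then show ?case by (intro bexI[of _ "[h]"]) (auto simp: word_prod_Nil word_prod_Cons S_carrier)
  next
    case (inv h)
    then show ?case by (intro bexI[of _ "[h]"]) (auto simp: word_prod_Nil word_prod_Cons S_carrier S_inv)
  next
    case (eng h1 h2)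
    then obtain us vs where "us \<in> lists S" "vs \<in> lists S" "word_prod us = h1" "word_prod vs = h2" by blast
    then show ?case using word_prod_append by (intro bexI[of _ "us @ vs"]) auto
  qed
qed

lemma reduced_word:
  assumes "w \<in> carrier W"
  obtains ws where "ws \<in> lists S" "length ws = len w" "word_prod ws = w"
proof -
  have "\<exists>n. \<exists>ws \<in> lists S. length ws = n \<and> word_prod ws = w" using exists_word[OF assms] by blast
  from LeastI_ex[OF this] show ?thesis using that unfolding len_def by blast
qed

lemma len_le: "ws \<in> lists S \<Longrightarrow> len (word_prod ws) \<le> length ws"
  unfolding len_def by (rule Least_le) blast

lemma len_one: "len \<one> = 0"
  using len_le[of "[]"] by (simp add: word_prod_Nil)

lemma len_zero: "w \<in> carrier W \<Longrightarrow> len w = 0 \<Longrightarrow> w = \<one>"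
proof -
  assume w: "w \<in> carrier W" "len w = 0"
  obtain ws where "ws \<in> lists S" "length ws = len w" "word_prod ws = w" using reduced_word[OF w(1)] .
  then show "w = \<one>" using w(2) by (simp add: word_prod_Nil)
qed

lemma len_mult: "u \<in> carrier W \<Longrightarrow> v \<in> carrier W \<Longrightarrow> len (u \<otimes> v) \<le> len u + len v"
proof -
  assume c: "u \<in> carrier W" "v \<in> carrier W"
  obtain us where us: "us \<in> lists S" "length us = len u" "word_prod us = u" using reduced_word[OF c(1)] .
  obtain vs where vs: "vs \<in> lists S" "length vs = len v" "word_prod vs = v" using reduced_word[OF c(2)] .
  show ?thesis using us vs len_le[of "us @ vs"] word_prod_append[of us vs] by auto
qed

lemma len_inv: "w \<in> carrier W \<Longrightarrow> len (inv w) = len w"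
proof -
  have le: "len (inv w) \<le> len w" if wc: "w \<in> carrier W" for w
  proof -
    obtain ws where ws: "ws \<in> lists S" "length ws = len w" "word_prod ws = w" using reduced_word[OF wc] .
    then have "rev ws \<in> lists S" by auto
    then show ?thesis using len_le[of "rev ws"] word_prod_rev[OF ws(1)] ws by simp
  qed
  show "w \<in> carrier W \<Longrightarrow> len (inv w) = len w" using le[of w] le[of "inv w"] by simp
qed

text \<open>Relators have even length. Through the presentation this gives the sign character, so
  that multiplying by a generator changes \<open>len\<close> by exactly one.\<close>

lemma coxeter_equiv_parity: "coxeter_equiv S us vs \<Longrightarrow> even (length us) = even (length vs)"
proof (induction rule: coxeter_equiv.induct)
  case (relation us vs s t)
  have "length (concat (replicate n [s, t])) = 2 * n" for n by (induction n) auto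
  then show ?case by simp
qed auto

lemma word_parity: "ws \<in> lists S \<Longrightarrow> even (length ws) = even (len (word_prod ws))"
proof -
  assume ws: "ws \<in> lists S"
  obtain us where "us \<in> lists S" "length us = len (word_prod ws)" "word_prod us = word_prod ws"
    using reduced_word[OF word_prod_closed[OF ws]] .
  then show ?thesis using coxeter_equiv_parity[OF presentation[OF ws]] by metis
qed

lemma len_S: "s \<in> S \<Longrightarrow> len s = 1"
proof -
  assume s: "s \<in> S"
  have "word_prod [s] = s" using s S_carrier by (simp add: word_prod_Nil word_prod_Cons)
  then have "len s \<le> 1" "odd (len s)" using s len_le[of "[s]"] word_parity[of "[s]"] by auto
  then show "len s = 1" by (cases "len s") auto
qed

lemma len_parity: "u \<in> carrier W \<Longrightarrow> v \<in> carrier W \<Longrightarrow> even (len (u \<otimes> v)) = (even (len u) = even (len v))"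
proof -
  assume c: "u \<in> carrier W" "v \<in> carrier W"
  obtain us where us: "us \<in> lists S" "length us = len u" "word_prod us = u" using reduced_word[OF c(1)] .
  obtain vs where vs: "vs \<in> lists S" "length vs = len v" "word_prod vs = v" using reduced_word[OF c(2)] .
  show ?thesis using us vs word_parity[of "us @ vs"] word_prod_append[of us vs] by auto
qed

lemma len_mult_S:
  assumes w: "w \<in> carrier W" and s: "s \<in> S"
  shows "len (w \<otimes> s) = len w + 1 \<or> len (w \<otimes> s) + 1 = len w"
proof -
  have c: "s \<in> carrier W" using s S_carrier by blast
  have 1: "len (w \<otimes> s) \<le> len w + 1" using len_mult[OF w c] len_S[OF s] by simp
  have 2: "len w \<le> len (w \<otimes> s) + 1" using len_mult[of "w \<otimes> s" s] len_S[OF s] S_cancel_right[OF s w] w c by simp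
  have "even (len (w \<otimes> s)) \<noteq> even (len w)" using len_parity[OF w c] len_S[OF s] by simp
  then have "len (w \<otimes> s) \<noteq> len w" by metis
  then show ?thesis using 1 2 by linarith
qed

lemma len_S_mult:
  assumes w: "w \<in> carrier W" and s: "s \<in> S"
  shows "len (s \<otimes> w) = len w + 1 \<or> len (s \<otimes> w) + 1 = len w"
  using len_mult_S[of "inv w" s] assms len_inv[of w] len_inv[of "s \<otimes> w"] S_carrier[OF s] S_inv[OF s]
  by (simp add: inv_mult_group)

lemma right_descent_exists:
  assumes "w \<in> carrier W" "w \<noteq> \<one>"
  obtains s where "s \<in> S" "len (w \<otimes> s) < len w"
proof -
  obtain ws where ws: "ws \<in> lists S" "length ws = len w" "word_prod ws = w" using reduced_word[OF assms(1)] .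
  then have "ws \<noteq> []" using assms word_prod_Nil by auto
  then obtain us s where us: "ws = us @ [s]" by (metis rev_exhaust)
  then have S: "us \<in> lists S" "s \<in> S" using ws by auto
  have "w = word_prod us \<otimes> s" using ws us S word_prod_append[of us "[s]"] S_carrier by (simp add: word_prod_Nil word_prod_Cons)
  then have "w \<otimes> s = word_prod us" using S_cancel_right[OF S(2) word_prod_closed[OF S(1)]] by simp
  then have "len (w \<otimes> s) < len w" using len_le[OF S(1)] ws us by simp
  then show ?thesis using that S by blast
qed

text \<open>The alternating product of \<open>k\<close> letters whose rightmost letter is
  \<open>t\<close>.\<close>

primrec alt :: "'w \<Rightarrow> 'w \<Rightarrow> nat \<Rightarrow> 'w" where
  "alt s t 0 = \<one>"
| "alt s t (Suc k) = (if even k then t else s) \<otimes> alt s t k"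

lemma alt_closed: "s \<in> S \<Longrightarrow> t \<in> S \<Longrightarrow> alt s t k \<in> carrier W"
  by (induction k) (auto simp: S_carrier)

lemma len_alt: "s \<in> S \<Longrightarrow> t \<in> S \<Longrightarrow> len (alt s t k) \<le> k"
proof (induction k)
  case (Suc k)
  then show ?case
    using len_mult[of "if even k then t else s" "alt s t k"] alt_closed[of s t k] S_carrier len_S by fastforce
qed (simp add: len_one)

lemma alt_Suc_right: "s \<in> S \<Longrightarrow> t \<in> S \<Longrightarrow> alt s t (Suc k) = alt t s k \<otimes> t"
proof (induction k)
  case (Suc k)
  let ?x = "if even (Suc k) then t else s"
  have "alt s t (Suc (Suc k)) = ?x \<otimes> (alt t s k \<otimes> t)" using Suc by (simp only: alt.simps(2))
  also have "\<dots> = (?x \<otimes> alt t s k) \<otimes> t" using Suc.prems S_carrier alt_closed[of t s k] by (intro m_assoc[symmetric]) auto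
  also have "?x \<otimes> alt t s k = alt t s (Suc k)" by simp
  finally show ?case .
qed (simp add: S_carrier)

lemma alt_even: "s \<in> S \<Longrightarrow> t \<in> S \<Longrightarrow> alt s t (2 * j) = (s \<otimes> t) [^] j"
  and alt_odd: "s \<in> S \<Longrightarrow> t \<in> S \<Longrightarrow> alt s t (Suc (2 * j)) = t \<otimes> (s \<otimes> t) [^] j"
proof -
  show e: "alt s t (2 * j) = (s \<otimes> t) [^] j" if "s \<in> S" "t \<in> S"
  proof (induction j)
    case (Suc j)
    have "alt s t (2 * Suc j) = s \<otimes> (t \<otimes> alt s t (2 * j))" by simp
    also have "\<dots> = (s \<otimes> t) \<otimes> (s \<otimes> t) [^] j" using Suc that S_carrier by (simp add: m_assoc)
    also have "\<dots> = (s \<otimes> t) [^] Suc j" using that S_carrier by (simp only: nat_pow_Suc2 m_closed)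
    finally show ?case .
  qed simp
  show "alt s t (Suc (2 * j)) = t \<otimes> (s \<otimes> t) [^] j" if "s \<in> S" "t \<in> S" using e[OF that] by simp
qed

text \<open>For infinite order \<open>ord\<close> is 0, and both sides are empty products.\<close>

lemma alt_braid:
  assumes s: "s \<in> S" and t: "t \<in> S" and m: "m = ord (s \<otimes> t)"
  shows "alt s t m = alt t s m"
proof -
  have c: "s \<in> carrier W" "t \<in> carrier W" "s \<otimes> t \<in> carrier W" "t \<otimes> s \<in> carrier W" using s t S_carrier by auto
  have ts: "t \<otimes> s = inv (s \<otimes> t)" using s t c S_inv by (simp add: inv_mult_group)
  have one: "(s \<otimes> t) [^] m = \<one>" using m c pow_ord_eq_1 by simp
  have inv_pow: "(t \<otimes> s) [^] j = inv ((s \<otimes> t) [^] j)" for j :: nat unfolding ts using nat_pow_inv[OF c(3)] by simp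
  show ?thesis
  proof (cases "even m")
    case True
    then obtain j where j: "m = 2 * j" by blast
    have "(s \<otimes> t) [^] j \<otimes> (s \<otimes> t) [^] j = \<one>" using one j c by (simp add: nat_pow_mult mult_2)
    then have "inv ((s \<otimes> t) [^] j) = (s \<otimes> t) [^] j" using c inv_equality by (metis nat_pow_closed)
    then show ?thesis unfolding j using alt_even[OF s t] alt_even[OF t s] inv_pow by simp
  next
    case False
    then obtain j where j: "m = Suc (2 * j)" by (metis oddE Suc_eq_plus1)
    have p: "(s \<otimes> t) [^] j \<in> carrier W" using c by simp
    have "(s \<otimes> t) [^] Suc j \<otimes> (s \<otimes> t) [^] j = \<one>" using one j c by (simp only: nat_pow_mult) (simp add: mult_2)
    then have "inv ((s \<otimes> t) [^] j) = (s \<otimes> t) [^] Suc j" using c inv_equality by (metis nat_pow_closed)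
    also have "\<dots> = s \<otimes> (t \<otimes> (s \<otimes> t) [^] j)" using c by (simp only: nat_pow_Suc2) (simp add: m_assoc)
    finally have "s \<otimes> inv ((s \<otimes> t) [^] j) = t \<otimes> (s \<otimes> t) [^] j" using S_cancel[OF s] c p by simp
    then show ?thesis unfolding j using alt_odd[OF s t] alt_odd[OF t s] inv_pow by simp
  qed
qed

lemma ord_product_ge_2:
  assumes "s \<in> S" "t \<in> S" "s \<noteq> t" "ord (s \<otimes> t) \<noteq> 0"
  shows "ord (s \<otimes> t) \<ge> 2"
proof (rule ccontr)
  assume "\<not> ?thesis"
  then have "ord (s \<otimes> t) = 1" using assms by linarith
  then have "s \<otimes> t = \<one>" using pow_ord_eq_1[of "s \<otimes> t"] assms S_carrier by simp
  then have "inv t = s" using assms S_carrier inv_equality by blast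
  then show False using assms S_inv by simp
qed

end

section \<open>The geometric representation and the cone of the simple roots\<close>

context geometric_representation
begin

abbreviation Cone :: "'v set" where "Cone \<equiv> convex_cone hull (\<alpha> ` S)"

lemma rho_mult: "u \<in> carrier W \<Longrightarrow> w \<in> carrier W \<Longrightarrow> \<rho> (u \<otimes> w) v = \<rho> u (\<rho> w v)"
  using action.composition_rule by simp

lemma rho_one: "\<rho> \<one> v = v"
  using action.id_eq_one by (metis UNIV_I restrict_apply')

lemma rho_inv: "w \<in> carrier W \<Longrightarrow> \<rho> (inv w) (\<rho> w v) = v"
  and rho_inv': "w \<in> carrier W \<Longrightarrow> \<rho> w (\<rho> (inv w) v) = v"
  using rho_mult[of "inv w" w v] rho_mult[of w "inv w" v] rho_one by simp_all

lemmas form_simps = bilinear_ladd[OF bilinear_B] bilinear_radd[OF bilinear_B]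
  bilinear_lmul[OF bilinear_B] bilinear_rmul[OF bilinear_B]
  bilinear_lsub[OF bilinear_B] bilinear_rsub[OF bilinear_B]
  bilinear_lneg[OF bilinear_B] bilinear_rneg[OF bilinear_B]
  bilinear_lzero[OF bilinear_B] bilinear_rzero[OF bilinear_B]

lemma word_induct [consumes 1, case_names one mult]:
  assumes "w \<in> carrier W" and one: "Q \<one>"
    and mult: "\<And>s w. s \<in> S \<Longrightarrow> w \<in> carrier W \<Longrightarrow> Q w \<Longrightarrow> Q (s \<otimes> w)"
  shows "Q w"
proof -
  obtain ws where ws: "ws \<in> lists S" "word_prod ws = w" using exists_word[OF assms(1)] by blast
  have "Q (word_prod ws)" using ws(1)
    by (induction ws) (auto simp: word_prod_Nil word_prod_Cons one mult word_prod_closed)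
  then show ?thesis using ws by simp
qed

lemma rho_linear: "w \<in> carrier W \<Longrightarrow> linear (\<rho> w)"
proof (induction rule: word_induct)
  case one
  then show ?case using rho_one by (simp add: linear_iff)
next
  case (mult s w)
  then show ?case
    by (simp add: linear_iff rho_mult S_carrier simple_reflection form_simps algebra_simps)
qed

lemma rho_add: "w \<in> carrier W \<Longrightarrow> \<rho> w (u + v) = \<rho> w u + \<rho> w v"
  and rho_scale: "w \<in> carrier W \<Longrightarrow> \<rho> w (c *\<^sub>R v) = c *\<^sub>R \<rho> w v"
  and rho_minus: "w \<in> carrier W \<Longrightarrow> \<rho> w (- v) = - \<rho> w v"
  and rho_diff: "w \<in> carrier W \<Longrightarrow> \<rho> w (u - v) = \<rho> w u - \<rho> w v"
  using rho_linear[of w] by (auto simp: linear_add linear_scale linear_neg linear_diff)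

lemma rho_B: "w \<in> carrier W \<Longrightarrow> B (\<rho> w u) (\<rho> w v) = B u v"
proof (induction arbitrary: u v rule: word_induct)
  case (mult s w)
  have "B (\<rho> s u) (\<rho> s v) = B u v" for u v
    using mult(1) simple_norm[of s] symmetric_B[of u "\<alpha> s"]
    by (simp add: simple_reflection form_simps)
  then show ?case using mult by (simp add: rho_mult S_carrier)
qed (simp add: rho_one)

lemma simple_reflection_self: "s \<in> S \<Longrightarrow> \<rho> s (\<alpha> s) = - \<alpha> s"
  using simple_norm[of s] by (simp add: simple_reflection scaleR_2)

lemma simple_obtuse: "s \<in> S \<Longrightarrow> t \<in> S \<Longrightarrow> s \<noteq> t \<Longrightarrow> B (\<alpha> s) (\<alpha> t) \<le> 0"
proof (cases "ord (s \<otimes> t) = 0")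
  case False
  assume a: "s \<in> S" "t \<in> S" "s \<noteq> t"
  have m: "ord (s \<otimes> t) \<ge> 2" using ord_product_ge_2 a False by blast
  then have "pi / real (ord (s \<otimes> t)) \<le> pi / 2" by (intro divide_left_mono) auto
  then have "cos (pi / real (ord (s \<otimes> t))) \<ge> 0" using m by (intro cos_ge_zero) (auto intro: order_trans[of _ 0])
  then show ?thesis using simple_finite a False by simp
qed (use simple_infinite in force)

lemma Cone_add: "x \<in> Cone \<Longrightarrow> y \<in> Cone \<Longrightarrow> x + y \<in> Cone"
  and Cone_scale: "0 \<le> c \<Longrightarrow> x \<in> Cone \<Longrightarrow> c *\<^sub>R x \<in> Cone"
  and simple_Cone: "s \<in> S \<Longrightarrow> \<alpha> s \<in> Cone"
  using convex_cone_add[OF convex_cone_convex_cone_hull] convex_cone_scaleR[OF convex_cone_convex_cone_hull]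
  by (auto intro: hull_inc)

lemma Cone_sum:
  assumes "x \<in> Cone"
  shows "\<exists>F c. finite F \<and> F \<subseteq> S \<and> (\<forall>s. 0 \<le> c s) \<and> (\<forall>s. s \<notin> F \<longrightarrow> c s = 0) \<and> x = (\<Sum>s\<in>F. c s *\<^sub>R \<alpha> s)"
proof -
  define Z where "Z = {x. \<exists>F c. finite F \<and> F \<subseteq> S \<and> (\<forall>s. 0 \<le> c s) \<and> (\<forall>s. s \<notin> F \<longrightarrow> c s = (0::real)) \<and> x = (\<Sum>s\<in>F. c s *\<^sub>R \<alpha> s)}"
  have "convex_cone Z"
    unfolding convex_cone_iff
  proof (intro conjI ballI allI impI)
    show "0 \<in> Z" unfolding Z_def by (intro CollectI exI[of _ "{}"] exI[of _ "\<lambda>_. 0"]) auto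
  next
    fix x y assume "x \<in> Z" "y \<in> Z"
    then obtain F c G d where F: "finite F" "F \<subseteq> S" "\<forall>s. 0 \<le> c s" "\<forall>s. s \<notin> F \<longrightarrow> c s = (0::real)" "x = (\<Sum>s\<in>F. c s *\<^sub>R \<alpha> s)"
      and G: "finite G" "G \<subseteq> S" "\<forall>s. 0 \<le> d s" "\<forall>s. s \<notin> G \<longrightarrow> d s = (0::real)" "y = (\<Sum>s\<in>G. d s *\<^sub>R \<alpha> s)"
      unfolding Z_def by blast
    have "x = (\<Sum>s\<in>F \<union> G. c s *\<^sub>R \<alpha> s)" unfolding F(5) by (rule sum.mono_neutral_left) (use F G in auto)
    moreover have "y = (\<Sum>s\<in>F \<union> G. d s *\<^sub>R \<alpha> s)" unfolding G(5) by (rule sum.mono_neutral_left) (use F G in auto)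
    ultimately have "x + y = (\<Sum>s\<in>F \<union> G. (c s + d s) *\<^sub>R \<alpha> s)" by (simp add: sum.distrib scaleR_left_distrib)
    then show "x + y \<in> Z" unfolding Z_def
      by (intro CollectI exI[of _ "F \<union> G"] exI[of _ "\<lambda>s. c s + d s"]) (use F G in auto)
  next
    fix x and r :: real assume "x \<in> Z" "0 \<le> r"
    then obtain F c where F: "finite F" "F \<subseteq> S" "\<forall>s. 0 \<le> c s" "\<forall>s. s \<notin> F \<longrightarrow> c s = (0::real)" "x = (\<Sum>s\<in>F. c s *\<^sub>R \<alpha> s)"
      unfolding Z_def by blast
    then show "r *\<^sub>R x \<in> Z" unfolding Z_def using \<open>0 \<le> r\<close>
      by (intro CollectI exI[of _ F] exI[of _ "\<lambda>s. r * c s"]) (auto simp: scaleR_right.sum)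
  qed
  moreover have "\<alpha> ` S \<subseteq> Z"
  proof
    fix x assume "x \<in> \<alpha> ` S"
    then obtain s where "s \<in> S" "x = \<alpha> s" by blast
    then show "x \<in> Z" unfolding Z_def
      by (intro CollectI exI[of _ "{s}"] exI[of _ "\<lambda>t. if t = s then 1 else 0"]) auto
  qed
  ultimately have "Cone \<subseteq> Z" by (intro hull_minimal)
  then show ?thesis using assms unfolding Z_def by blast
qed

lemma Cone_pair_sum:
  assumes "x \<in> Cone" "y \<in> Cone"
  obtains F c d where "finite F" "F \<subseteq> S" "\<And>s. 0 \<le> c s" "\<And>s. 0 \<le> (d s :: real)"
    "x = (\<Sum>s\<in>F. c s *\<^sub>R \<alpha> s)" "y = (\<Sum>s\<in>F. d s *\<^sub>R \<alpha> s)"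
proof -
  obtain F c G d where F: "finite F" "F \<subseteq> S" "\<forall>s. 0 \<le> c s" "\<forall>s. s \<notin> F \<longrightarrow> c s = (0::real)" "x = (\<Sum>s\<in>F. c s *\<^sub>R \<alpha> s)"
    and G: "finite G" "G \<subseteq> S" "\<forall>s. 0 \<le> d s" "\<forall>s. s \<notin> G \<longrightarrow> d s = (0::real)" "y = (\<Sum>s\<in>G. d s *\<^sub>R \<alpha> s)"
    using Cone_sum[OF assms(1)] Cone_sum[OF assms(2)] by blast
  have "x = (\<Sum>s\<in>F \<union> G. c s *\<^sub>R \<alpha> s)" unfolding F(5) by (rule sum.mono_neutral_left) (use F G in auto)
  moreover have "y = (\<Sum>s\<in>F \<union> G. d s *\<^sub>R \<alpha> s)" unfolding G(5) by (rule sum.mono_neutral_left) (use F G in auto)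
  ultimately show ?thesis using that[of "F \<union> G" c d] F G by simp
qed

lemma Cone_salient:
  assumes "x \<in> Cone" "- x \<in> Cone"
  shows "x = 0"
proof -
  obtain F c d where F: "finite F" "F \<subseteq> S" "\<And>s. 0 \<le> c s" "\<And>s. 0 \<le> (d s :: real)"
    "x = (\<Sum>s\<in>F. c s *\<^sub>R \<alpha> s)" "- x = (\<Sum>s\<in>F. d s *\<^sub>R \<alpha> s)"
    using Cone_pair_sum[OF assms] by blast
  have "(\<Sum>s\<in>F. (c s + d s) *\<^sub>R \<alpha> s) = x + (- x)"
    unfolding F(5,6)[symmetric] scaleR_left_distrib sum.distrib using F(5,6) by simp
  then have "c s + d s = 0" if "s \<in> F" for s
    using simple_positively_independent[of F "\<lambda>s. c s + d s" s] F that by simp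
  then have "c s = 0" if "s \<in> F" for s using F(3,4)[of s] that by (metis add_nonneg_eq_0_iff)
  then show ?thesis using F(5) by simp
qed

text \<open>The simple roots may be linearly dependent, so coefficients cannot simply be compared.
  Pairing with \<open>\<alpha> s\<close>, obtuse to the others, bounds \<open>k\<close> by the total
  coefficient at \<open>s\<close>; moving everything to one side then leaves a nonnegative relation,
  and positive independence applies.\<close>

lemma simple_extreme:
  assumes x: "x \<in> Cone" and y: "y \<in> Cone" and s: "s \<in> S" and eq: "x + y = k *\<^sub>R \<alpha> s"
  shows "\<exists>r \<ge> 0. x = r *\<^sub>R \<alpha> s"
proof -
  obtain F' c' d' where F': "finite F'" "F' \<subseteq> S" "\<And>s. 0 \<le> c' s" "\<And>s. 0 \<le> (d' s :: real)"
    "x = (\<Sum>s\<in>F'. c' s *\<^sub>R \<alpha> s)" "y = (\<Sum>s\<in>F'. d' s *\<^sub>R \<alpha> s)" using Cone_pair_sum[OF x y] by blast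
  define F c d where "F = insert s F'" and "c t = (if t \<in> F' then c' t else 0)" and "d t = (if t \<in> F' then d' t else 0)" for t
  have F: "finite F" "F \<subseteq> S" "s \<in> F" "\<And>s. 0 \<le> c s" "\<And>s. 0 \<le> d s"
    using F' s by (auto simp: F_def c_def d_def)
  have xs: "x = (\<Sum>t\<in>F. c t *\<^sub>R \<alpha> t)"
    unfolding F'(5) by (rule sum.mono_neutral_cong_left) (use F' in \<open>auto simp: F_def c_def\<close>)
  have ys: "y = (\<Sum>t\<in>F. d t *\<^sub>R \<alpha> t)"
    unfolding F'(6) by (rule sum.mono_neutral_cong_left) (use F' in \<open>auto simp: F_def d_def\<close>)
  define a where "a t = c t + d t" for t
  have a: "a t \<ge> 0" for t using F(4,5)[of t] by (simp add: a_def)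
  have sum: "(\<Sum>t\<in>F. a t *\<^sub>R \<alpha> t) = k *\<^sub>R \<alpha> s"
    using eq unfolding xs ys a_def by (simp add: scaleR_left_distrib sum.distrib)
  then have rest: "(\<Sum>t\<in>F - {s}. a t *\<^sub>R \<alpha> t) = (k - a s) *\<^sub>R \<alpha> s"
    using sum.remove[OF F(1,3), of "\<lambda>t. a t *\<^sub>R \<alpha> t"] by (simp add: algebra_simps)
  have "k - a s \<le> 0"
  proof (rule ccontr)
    assume "\<not> ?thesis"
    have B_sum: "B (\<Sum>t\<in>G. a t *\<^sub>R \<alpha> t) (\<alpha> s) \<le> 0" if "finite G" "G \<subseteq> S - {s}" for G
      using that
    proof (induction G rule: finite_induct)
      case (insert t G)
      have "a t * B (\<alpha> t) (\<alpha> s) \<le> 0" using simple_obtuse[of t s] insert s a[of t] by (simp add: mult_nonneg_nonpos)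
      then show ?case using insert by (simp add: form_simps)
    qed (simp add: form_simps)
    have "B ((k - a s) *\<^sub>R \<alpha> s) (\<alpha> s) \<le> 0" unfolding rest[symmetric] by (rule B_sum) (use F in auto)
    then show False using simple_norm[OF s] \<open>\<not> k - a s \<le> 0\<close> by (simp add: form_simps)
  qed
  define b where "b t = (if t = s then a s - k else a t)" for t
  have "(\<Sum>t\<in>F. b t *\<^sub>R \<alpha> t) = (a s - k) *\<^sub>R \<alpha> s + (\<Sum>t\<in>F - {s}. a t *\<^sub>R \<alpha> t)"
    by (subst sum.remove[OF F(1,3)]) (simp add: b_def)
  also have "\<dots> = 0" unfolding rest by (simp add: algebra_simps)
  finally have bz: "b t = 0" if "t \<in> F" for t
    using simple_positively_independent[of F b t] F a \<open>k - a s \<le> 0\<close> that by (simp add: b_def)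
  then have "c t = 0" if "t \<in> F - {s}" for t
    using that F(4,5)[of t] bz[of t] by (simp add: b_def a_def)
  then have "x = c s *\<^sub>R \<alpha> s" unfolding xs by (subst sum.remove[OF F(1,3)]) simp
  then show ?thesis using F(4) by blast
qed

lemma rho_alt:
  assumes s: "s \<in> S" and t: "t \<in> S" and c: "c = - B (\<alpha> s) (\<alpha> t)"
  shows "\<rho> (alt s t k) (\<alpha> s) = (if even k then cheb c (Suc k) *\<^sub>R \<alpha> s + cheb c k *\<^sub>R \<alpha> t
    else cheb c k *\<^sub>R \<alpha> s + cheb c (Suc k) *\<^sub>R \<alpha> t)"
proof (induction k)
  case (Suc k)
  have act_t: "\<rho> t (x *\<^sub>R \<alpha> s + y *\<^sub>R \<alpha> t) = x *\<^sub>R \<alpha> s + (2 * c * x - y) *\<^sub>R \<alpha> t" for x y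
  proof -
    have "\<rho> t (\<alpha> s) = \<alpha> s + (2 * c) *\<^sub>R \<alpha> t"
      using symmetric_B[of "\<alpha> t" "\<alpha> s"] c simple_reflection[OF t, of "\<alpha> s"] by simp
    then show ?thesis using simple_reflection_self[OF t]
      by (simp add: rho_add[OF S_carrier[OF t]] rho_scale[OF S_carrier[OF t]] algebra_simps)
  qed
  have act_s: "\<rho> s (x *\<^sub>R \<alpha> s + y *\<^sub>R \<alpha> t) = (2 * c * y - x) *\<^sub>R \<alpha> s + y *\<^sub>R \<alpha> t" for x y
  proof -
    have "\<rho> s (\<alpha> t) = \<alpha> t + (2 * c) *\<^sub>R \<alpha> s"
      using c simple_reflection[OF s, of "\<alpha> t"] by simp
    then show ?thesis using simple_reflection_self[OF s]
      by (simp add: rho_add[OF S_carrier[OF s]] rho_scale[OF S_carrier[OF s]] algebra_simps)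
  qed
  show ?case
    using Suc act_s act_t by (auto simp: rho_mult S_carrier s t alt_closed[OF s t])
qed (simp add: rho_one)

text \<open>Split off the longest alternating suffix in \<open>s\<close> and a right descent
  \<open>t\<close>. Neither letter shortens the remaining \<open>v\<close>, so induction applies to
  \<open>v\<close>, while the suffix sends \<open>\<alpha> s\<close> to a combination of
  \<open>\<alpha> s\<close> and \<open>\<alpha> t\<close> with Chebyshev coefficients.\<close>

theorem root_positive:
  assumes "w \<in> carrier W" "s \<in> S" "len (w \<otimes> s) > len w"
  shows "\<rho> w (\<alpha> s) \<in> Cone"
  using assms
proof (induction "len w" arbitrary: w s rule: less_induct)
  case less
  note w = less.prems(1) and s = less.prems(2) and lt = less.prems(3)
  show ?case
  proof (cases "w = \<one>")
    case True
    then show ?thesis using simple_Cone[OF s] rho_one by simp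
  next
    case False
    obtain t where t: "t \<in> S" "len (w \<otimes> t) < len w" using right_descent_exists[OF w False] .
    have st: "s \<noteq> t" using t lt by auto
    define Q where "Q k \<longleftrightarrow> (\<exists>v \<in> carrier W. w = v \<otimes> alt s t k \<and> len w = len v + k)" for k
    note ac = alt_closed[OF s t(1)]
    have sc: "s \<in> carrier W" "t \<in> carrier W" using s t S_carrier by auto
    have Q1: "Q 1"
      unfolding Q_def using len_mult_S[OF w t(1)] t S_cancel_right[OF t(1) w] w sc by (intro bexI[of _ "w \<otimes> t"]) auto
    have Q_le: "Q k \<Longrightarrow> k \<le> len w" for k by (auto simp: Q_def)
    define N where "N = (GREATEST k. Q k)"
    have QN: "Q N" unfolding N_def by (rule GreatestI_nat[of Q 1 "len w"]) (use Q1 Q_le in auto)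
    have N_max: "k \<le> N" if "Q k" for k unfolding N_def by (rule Greatest_le_nat[of Q k "len w"]) (use that Q_le in auto)
    obtain N' where N': "N = Suc N'" using N_max[OF Q1] by (cases N) auto
    obtain v where v: "v \<in> carrier W" "w = v \<otimes> alt s t N" "len w = len v + N" using QN by (auto simp: Q_def)
    define x y where "x = (if even N' then t else s)" and "y = (if even N' then s else t)"
    have xy: "x \<in> S" "y \<in> S" "x \<in> carrier W" "y \<in> carrier W" using s t sc by (auto simp: x_def y_def)
    have down: "Q k \<Longrightarrow> k = Suc k' \<Longrightarrow> Q k'" for k k'
    proof -
      assume "Q k" "k = Suc k'"
      then obtain v where v: "v \<in> carrier W" "w = v \<otimes> alt s t k" "len w = len v + k" by (auto simp: Q_def)
      let ?x = "if even k' then t else s"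
      have eq: "w = (v \<otimes> ?x) \<otimes> alt s t k'" using v \<open>k = Suc k'\<close> sc ac by (simp add: m_assoc)
      have "len w \<le> len (v \<otimes> ?x) + k'"
        using len_mult[of "v \<otimes> ?x" "alt s t k'"] eq v(1) sc ac len_alt[OF s t(1), of k'] by simp
      moreover have "len (v \<otimes> ?x) \<le> len v + 1" using len_mult[of v ?x] v(1) sc len_S s t by simp
      ultimately have "len w = len (v \<otimes> ?x) + k'" using v(3) \<open>k = Suc k'\<close> by linarith
      then show "Q k'" unfolding Q_def using eq v(1) sc by (intro bexI[of _ "v \<otimes> ?x"]) auto
    qed
    have down': "Q k \<Longrightarrow> j \<le> k \<Longrightarrow> Q j" for j k
      by (induction k) (auto simp: le_Suc_eq dest: down)
    have vx: "len (v \<otimes> x) > len v"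
    proof -
      have eq: "w = (v \<otimes> x) \<otimes> alt s t N'" using v N' sc ac by (simp add: m_assoc x_def)
      have "len w \<le> len (v \<otimes> x) + N'"
        using len_mult[of "v \<otimes> x" "alt s t N'"] eq v(1) xy ac len_alt[OF s t(1), of N'] by simp
      then show ?thesis using v(3) N' by linarith
    qed
    have vy: "len (v \<otimes> y) > len v"
    proof (rule ccontr)
      assume "\<not> ?thesis"
      then have l: "len (v \<otimes> y) + 1 = len v" using len_mult_S[OF v(1) xy(2)] by linarith
      have "alt s t (Suc N) = y \<otimes> alt s t N" by (simp add: N' y_def)
      then have "w = (v \<otimes> y) \<otimes> alt s t (Suc N)"
        using v S_cancel_right[OF xy(2) v(1)] xy ac by (simp add: m_assoc[symmetric] del: alt.simps)
      then have "Q (Suc N)" unfolding Q_def using l v xy by (intro bexI[of _ "v \<otimes> y"]) auto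
      then show False using N_max by fastforce
    qed
    have lv: "len v < len w" using v(3) N' by simp
    have "\<rho> v (\<alpha> x) \<in> Cone" "\<rho> v (\<alpha> y) \<in> Cone"
      using less.hyps[OF lv v(1) xy(1) vx] less.hyps[OF lv v(1) xy(2) vy] .
    then have pos: "\<rho> v (\<alpha> s) \<in> Cone" "\<rho> v (\<alpha> t) \<in> Cone" by (auto simp: x_def y_def split: if_splits)
    define c where "c = - B (\<alpha> s) (\<alpha> t)"
    have cheb_pos: "cheb c N \<ge> 0 \<and> cheb c (Suc N) \<ge> 0"
    proof (cases "ord (s \<otimes> t) = 0")
      case True
      then have "c \<ge> 1" using simple_infinite[OF s t(1) st] by (simp add: c_def)
      then show ?thesis using cheb_nonneg by blast
    next
      case False
      define m where "m = ord (s \<otimes> t)"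
      have m2: "m \<ge> 2" using ord_product_ge_2[OF s t(1) st False] by (simp add: m_def)
      have cm: "c = cos (pi / real m)" using simple_finite[OF s t(1) st False] by (simp add: c_def m_def)
      \<comment> \<open>A suffix of \<open>m\<close> letters could be rewritten by the braid
        relation to end in \<open>s\<close>, making \<open>s\<close> a descent of \<open>w\<close>.
        Up to index \<open>m\<close> the Chebyshev values are nonnegative.\<close>
      have "N < m"
      proof (rule ccontr)
        assume "\<not> N < m"
        then have "Q m" using down'[OF QN] by simp
        then obtain u where u: "u \<in> carrier W" "w = u \<otimes> alt s t m" "len w = len u + m" by (auto simp: Q_def)
        obtain m' where m': "m = Suc m'" using m2 by (cases m) auto
        have "alt s t m = alt s t m' \<otimes> s"
          using alt_braid[OF s t(1) m_def] alt_Suc_right[OF t(1) s, of m'] m' by simp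
        then have "w \<otimes> s = u \<otimes> alt s t m'" using u sc ac S_square[OF s] by (simp add: m_assoc)
        then have "len (w \<otimes> s) \<le> len u + m'"
          using len_mult[OF u(1) ac, of m'] len_alt[OF s t(1), of m'] by simp
        then show False using lt u(3) m' by linarith
      qed
      then show ?thesis unfolding cm using cheb_cos_nonneg[OF m2] by simp
    qed
    have "\<rho> w (\<alpha> s) = \<rho> v (\<rho> (alt s t N) (\<alpha> s))" unfolding v(2) by (rule rho_mult[OF v(1) ac])
    also have "\<dots> \<in> Cone"
      unfolding rho_alt[OF s t(1) c_def] using cheb_pos pos
      by (simp add: rho_add[OF v(1)] rho_scale[OF v(1)] Cone_add Cone_scale del: cheb.simps)
    finally show ?thesis .
  qed
qed

section \<open>Short inversions\<close>

lemma rho_roots: "w \<in> carrier W \<Longrightarrow> r \<in> roots \<Longrightarrow> \<rho> w r \<in> roots"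
proof -
  assume w: "w \<in> carrier W" and "r \<in> roots"
  then obtain u s where u: "u \<in> carrier W" "s \<in> S" "r = \<rho> u (\<alpha> s)" unfolding roots_def by blast
  then have "\<rho> w r = \<rho> (w \<otimes> u) (\<alpha> s)" using rho_mult w by simp
  then show "\<rho> w r \<in> roots" unfolding roots_def using u w by blast
qed

lemma simple_roots: "s \<in> S \<Longrightarrow> \<alpha> s \<in> roots"
  unfolding roots_def using rho_one[of "\<alpha> s"] one_closed by (metis (mono_tags, lifting) mem_Collect_eq)

lemma rootsE:
  assumes "r \<in> roots"
  obtains w s where "w \<in> carrier W" "s \<in> S" "r = \<rho> w (\<alpha> s)"
  using assms unfolding roots_def by blast

lemma roots_norm: "r \<in> roots \<Longrightarrow> B r r = 1"
  by (erule rootsE) (simp add: rho_B simple_norm)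

lemma roots_signed: "r \<in> roots \<Longrightarrow> r \<in> Cone \<or> - r \<in> Cone"
proof (erule rootsE)
  fix w s assume w: "w \<in> carrier W" and s: "s \<in> S" and r: "r = \<rho> w (\<alpha> s)"
  show ?thesis
  proof (cases "len (w \<otimes> s) > len w")
    case True
    then show ?thesis using root_positive w s r by blast
  next
    case False
    then have "len ((w \<otimes> s) \<otimes> s) > len (w \<otimes> s)" using len_mult_S[OF w s] S_cancel_right[OF s w] by simp
    then have "\<rho> (w \<otimes> s) (\<alpha> s) \<in> Cone" using root_positive[of "w \<otimes> s" s] w s S_carrier by simp
    then show ?thesis using r w s by (simp add: rho_mult S_carrier simple_reflection_self rho_minus)
  qed
qed

lemma root_multiple_simple:
  assumes "r \<in> roots" "s \<in> S" "r = k *\<^sub>R \<alpha> s" "k \<ge> 0"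
  shows "r = \<alpha> s"
proof -
  have "k * k = 1" using roots_norm[OF assms(1)] simple_norm[OF assms(2)] unfolding assms(3) by (simp add: form_simps)
  then have "k = 1" using assms(4) square_eq_1_iff[of k] by auto
  then show ?thesis using assms(3) by simp
qed

lemma simple_permutes:
  assumes s: "s \<in> S" and r: "r \<in> roots" "r \<in> Cone" "r \<noteq> \<alpha> s"
  shows "\<rho> s r \<in> Cone"
proof (rule ccontr)
  assume "\<rho> s r \<notin> Cone"
  then have "- \<rho> s r \<in> Cone" using roots_signed[OF rho_roots[OF S_carrier[OF s] r(1)]] by blast
  moreover have "r + (- \<rho> s r) = (2 * B (\<alpha> s) r) *\<^sub>R \<alpha> s" using simple_reflection[OF s, of r] by simp
  ultimately obtain k where "k \<ge> 0" "r = k *\<^sub>R \<alpha> s" using simple_extreme[OF r(2) _ s] by blast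
  then show False using root_multiple_simple r s by blast
qed

lemma finite_negated: "w \<in> carrier W \<Longrightarrow> finite {r \<in> roots \<inter> Cone. \<rho> w r \<notin> Cone}"
proof (induction rule: word_induct)
  case one
  then show ?case by (simp add: rho_one)
next
  case (mult s w)
  have "{r \<in> roots \<inter> Cone. \<rho> (s \<otimes> w) r \<notin> Cone} \<subseteq> {r \<in> roots \<inter> Cone. \<rho> w r \<notin> Cone} \<union> {\<rho> (inv w) (\<alpha> s)}"
  proof
    fix r assume r: "r \<in> {r \<in> roots \<inter> Cone. \<rho> (s \<otimes> w) r \<notin> Cone}"
    have "\<rho> w r = \<alpha> s" if "\<rho> w r \<in> Cone"
      using simple_permutes[OF mult(1) rho_roots[OF mult(2), of r] that] r mult by (auto simp: rho_mult S_carrier)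
    then show "r \<in> {r \<in> roots \<inter> Cone. \<rho> w r \<notin> Cone} \<union> {\<rho> (inv w) (\<alpha> s)}"
      using r rho_inv[OF mult(2), of r] by auto
  qed
  then show ?case using mult finite_subset by blast
qed

lemma rho_conjugate_reflection:
  assumes "w \<in> carrier W" "s \<in> S"
  shows "\<rho> (w \<otimes> s \<otimes> inv w) v = v - (2 * B (\<rho> w (\<alpha> s)) v) *\<^sub>R \<rho> w (\<alpha> s)"
proof -
  have "\<rho> (w \<otimes> s \<otimes> inv w) v = \<rho> w (\<rho> s (\<rho> (inv w) v))"
    using assms S_carrier by (simp add: rho_mult)
  also have "\<dots> = v - (2 * B (\<alpha> s) (\<rho> (inv w) v)) *\<^sub>R \<rho> w (\<alpha> s)"
    unfolding simple_reflection[OF assms(2)] by (simp add: rho_diff rho_scale rho_inv' assms)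
  also have "B (\<alpha> s) (\<rho> (inv w) v) = B (\<rho> w (\<alpha> s)) v"
    using rho_B[OF assms(1), of "\<alpha> s" "\<rho> (inv w) v"] rho_inv'[OF assms(1)] by simp
  finally show ?thesis .
qed

sublocale rs: reflection_system B Cone roots "\<rho> ` carrier W"
proof
  fix r assume r: "r \<in> roots"
  then obtain w s where "w \<in> carrier W" "s \<in> S" "r = \<rho> w (\<alpha> s)" by (rule rootsE)
  then have "(\<lambda>v. v - (2 * B r v) *\<^sub>R r) = \<rho> (w \<otimes> s \<otimes> inv w)" "w \<otimes> s \<otimes> inv w \<in> carrier W"
    using rho_conjugate_reflection S_carrier by auto
  then show "(\<lambda>v. v - (2 * B r v) *\<^sub>R r) \<in> \<rho> ` carrier W" by blast
next
  fix g assume "g \<in> \<rho> ` carrier W"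
  then obtain w where w: "w \<in> carrier W" "g = \<rho> w" by blast
  then show "\<exists>h \<in> \<rho> ` carrier W. h \<circ> g = id \<and> g \<circ> h = id"
    by (intro bexI[of _ "\<rho> (inv w)"]) (auto simp: rho_inv rho_inv')
next
  fix g h assume "g \<in> \<rho> ` carrier W" "h \<in> \<rho> ` carrier W"
  then obtain u w where "u \<in> carrier W" "w \<in> carrier W" "g = \<rho> u" "h = \<rho> w" by blast
  then show "g \<circ> h \<in> \<rho> ` carrier W" by (intro image_eqI[of _ _ "u \<otimes> w"]) (auto simp: rho_mult)
next
  fix g assume "g \<in> \<rho> ` carrier W"
  then obtain w where w: "w \<in> carrier W" "g = \<rho> w" by blast
  show "finite {r \<in> roots \<inter> Cone. g r \<notin> Cone}" unfolding w(2) by (rule finite_negated[OF w(1)])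
next
  fix g u v assume "g \<in> \<rho> ` carrier W"
  then show "g (u + v) = g u + g v" using rho_add by auto
next
  fix g u and k :: real assume "g \<in> \<rho> ` carrier W"
  then show "g (k *\<^sub>R u) = k *\<^sub>R g u" using rho_scale by auto
next
  fix g u v assume "g \<in> \<rho> ` carrier W"
  then show "B (g u) (g v) = B u v" using rho_B by auto
next
  fix g r assume "g \<in> \<rho> ` carrier W" "r \<in> roots"
  then show "g r \<in> roots" using rho_roots by auto
next
  fix x assume "x \<in> Cone" "- x \<in> Cone"
  then show "x = 0" using Cone_salient by blast
next
  fix r assume "r \<in> roots"
  then show "r \<in> Cone \<or> - r \<in> Cone" using roots_signed by blast
qed (rule bilinear_B symmetric_B roots_norm Cone_add Cone_scale; assumption?)+

lemma pos_roots_P: "pos_roots = rs.P"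
  by (simp add: pos_roots_def rs.P_def)

lemma simple_P: "s \<in> S \<Longrightarrow> \<alpha> s \<in> rs.P"
  using simple_roots simple_Cone by (simp add: rs.P_def)

lemma rho_minus_P: "w \<in> carrier W \<Longrightarrow> r \<in> roots \<Longrightarrow> \<rho> w r \<notin> rs.P \<longleftrightarrow> - \<rho> w r \<in> rs.P"
  using rs.not_P_iff rho_roots by blast

lemma simple_permutes_P: "s \<in> S \<Longrightarrow> r \<in> rs.P \<Longrightarrow> r \<noteq> \<alpha> s \<Longrightarrow> \<rho> s r \<in> rs.P"
  using simple_permutes rho_roots S_carrier by (auto simp: rs.P_def)

lemma rho_simple_refl: "s \<in> S \<Longrightarrow> \<rho> s v = rs.refl (\<alpha> s) v"
  by (simp add: simple_reflection rs.refl_def)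

lemma len_increases_iff:
  assumes w: "w \<in> carrier W" and s: "s \<in> S"
  shows "len (w \<otimes> s) > len w \<longleftrightarrow> \<rho> w (\<alpha> s) \<in> rs.P"
proof
  assume "len (w \<otimes> s) > len w"
  then show "\<rho> w (\<alpha> s) \<in> rs.P" using root_positive w s rho_roots simple_roots by (simp add: rs.P_def)
next
  assume p: "\<rho> w (\<alpha> s) \<in> rs.P"
  show "len (w \<otimes> s) > len w"
  proof (rule ccontr)
    assume "\<not> ?thesis"
    then have "len ((w \<otimes> s) \<otimes> s) > len (w \<otimes> s)" using len_mult_S[OF w s] S_cancel_right[OF s w] by simp
    then have "\<rho> (w \<otimes> s) (\<alpha> s) \<in> Cone" using root_positive[of "w \<otimes> s" s] w s S_carrier by simp
    then have "- \<rho> w (\<alpha> s) \<in> rs.P" using w s rho_roots[OF w simple_roots[OF s]] rs.neg_R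
      by (simp add: rho_mult S_carrier simple_reflection_self rho_minus rs.P_def)
    then show False using rs.P_neg p by blast
  qed
qed

lemma len_increases_left_iff:
  assumes w: "w \<in> carrier W" and s: "s \<in> S"
  shows "len (s \<otimes> w) > len w \<longleftrightarrow> \<rho> (inv w) (\<alpha> s) \<in> rs.P"
  using len_increases_iff[of "inv w" s] assms len_inv[of w] len_inv[of "s \<otimes> w"] S_carrier[OF s] S_inv[OF s]
  by (simp add: inv_mult_group)

lemma rho_faithful:
  assumes u: "u \<in> carrier W" and w: "w \<in> carrier W" and eq: "\<And>v. \<rho> u v = \<rho> w v"
  shows "u = w"
proof -
  define g where "g = inv u \<otimes> w"
  have g: "g \<in> carrier W" "\<And>v. \<rho> g v = v" using u w eq[symmetric] by (auto simp: g_def rho_mult rho_inv)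
  have "g = \<one>"
  proof (rule ccontr)
    assume "g \<noteq> \<one>"
    then obtain s where s: "s \<in> S" "len (g \<otimes> s) < len g" using right_descent_exists g by blast
    then show False using len_increases_iff[OF g(1) s(1)] g simple_P by simp
  qed
  then have "u \<otimes> (inv u \<otimes> w) = u" using u by (simp add: g_def)
  then show ?thesis using u w by (simp add: m_assoc[symmetric])
qed

lemma root_reflection:
  assumes "r \<in> roots"
  shows "root_reflection r \<in> carrier W" "\<rho> (root_reflection r) v = rs.refl r v"
proof -
  obtain w s where ws: "w \<in> carrier W" "s \<in> S" "r = \<rho> w (\<alpha> s)" using assms by (rule rootsE)
  let ?Q = "\<lambda>t. t \<in> carrier W \<and> (\<forall>v. \<rho> t v = v - (2 * B r v) *\<^sub>R r)"
  have Q: "?Q (w \<otimes> s \<otimes> inv w)" using ws rho_conjugate_reflection S_carrier by simp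
  have "?Q (root_reflection r)" unfolding root_reflection_def
    by (rule theI[of ?Q, OF Q]) (use Q rho_faithful in auto)
  then show "root_reflection r \<in> carrier W" "\<rho> (root_reflection r) v = rs.refl r v"
    by (auto simp: rs.refl_def)
qed

lemma root_reflection_eqI:
  assumes "r \<in> roots" "t \<in> carrier W" "\<And>v. \<rho> t v = rs.refl r v"
  shows "root_reflection r = t"
  using rho_faithful[OF root_reflection(1)[OF assms(1)] assms(2)] root_reflection(2)[OF assms(1)] assms(3) by simp

lemma root_reflection_simple: "s \<in> S \<Longrightarrow> root_reflection (\<alpha> s) = s"
  by (rule root_reflection_eqI) (auto simp: simple_roots S_carrier rho_simple_refl)

lemma refl_neg: "rs.refl (- r) v = rs.refl r v"
  by (simp add: rs.refl_def form_simps)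

lemma root_reflection_minus: "r \<in> roots \<Longrightarrow> root_reflection (- r) = root_reflection r"
  by (rule root_reflection_eqI) (auto simp: rs.neg_R root_reflection refl_neg)

lemma refl_rho: "w \<in> carrier W \<Longrightarrow> rs.refl (\<rho> w r) (\<rho> w v) = \<rho> w (rs.refl r v)"
  by (simp add: rs.refl_def rho_B rho_diff rho_scale)

lemma root_reflection_rho:
  assumes "w \<in> carrier W" "r \<in> roots"
  shows "root_reflection (\<rho> w r) = w \<otimes> root_reflection r \<otimes> inv w"
proof (rule root_reflection_eqI)
  fix v
  have "rs.refl (\<rho> w r) v = \<rho> w (rs.refl r (\<rho> (inv w) v))"
    using refl_rho[OF assms(1), of r "\<rho> (inv w) v"] rho_inv'[OF assms(1)] by simp
  then show "\<rho> (w \<otimes> root_reflection r \<otimes> inv w) v = rs.refl (\<rho> w r) v"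
    using assms root_reflection[OF assms(2)] by (simp add: rho_mult)
qed (use assms rho_roots root_reflection in auto)

lemma root_reflection_square:
  assumes "r \<in> roots" shows "root_reflection r \<otimes> root_reflection r = \<one>"
  by (rule rho_faithful) (use assms root_reflection[OF assms] rs.refl_refl in \<open>auto simp: rho_mult rho_one\<close>)

lemma root_reflection_cancel:
  assumes "r \<in> roots" "w \<in> carrier W"
  shows "root_reflection r \<otimes> (root_reflection r \<otimes> w) = w"
  using assms root_reflection_square[OF assms(1)] root_reflection(1)[OF assms(1)]
  by (simp add: m_assoc[symmetric])

lemma root_reflection_inv: "r \<in> roots \<Longrightarrow> inv (root_reflection r) = root_reflection r"
  using root_reflection_square root_reflection(1) inv_equality by blast

lemma card_negated:
  assumes "w \<in> carrier W"
  shows "card {r \<in> rs.P. \<rho> w r \<notin> rs.P} = len w"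
  using assms
proof (induction "len w" arbitrary: w rule: less_induct)
  case less
  note g = less.prems
  show ?case
  proof (cases "w = \<one>")
    case True
    then show ?thesis by (simp add: rho_one len_one)
  next
    case False
    obtain s where s: "s \<in> S" "len (w \<otimes> s) < len w" using right_descent_exists[OF g False] .
    define h where "h = w \<otimes> s"
    have sc: "s \<in> carrier W" using s S_carrier by blast
    have h: "h \<in> carrier W" "len h < len w" "w = h \<otimes> s" using g s sc S_cancel_right[OF s(1) g] by (simp_all add: h_def)
    have lw: "len w = Suc (len h)" using len_mult_S[OF h(1) s(1)] h by simp
    have ps: "\<rho> h (\<alpha> s) \<in> rs.P" using len_increases_iff[OF h(1) s(1)] h by simp
    have ss: "\<rho> s (\<rho> s v) = v" for v using rho_simple_refl[OF s(1)] rs.refl_refl[OF simple_roots[OF s(1)]] by simp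
    have sa: "\<rho> s (\<alpha> s) = - \<alpha> s" using simple_reflection_self[OF s(1)] .
    have wh: "\<rho> w v = \<rho> h (\<rho> s v)" for v using rho_mult[OF h(1) sc, of v] unfolding h(3)[symmetric] .
    have eq: "{r \<in> rs.P. \<rho> w r \<notin> rs.P} = insert (\<alpha> s) (\<rho> s ` {r \<in> rs.P. \<rho> h r \<notin> rs.P})"
    proof (intro equalityI subsetI)
      fix r assume r: "r \<in> {r \<in> rs.P. \<rho> w r \<notin> rs.P}"
      show "r \<in> insert (\<alpha> s) (\<rho> s ` {r \<in> rs.P. \<rho> h r \<notin> rs.P})"
      proof (cases "r = \<alpha> s")
        case False
        then have "\<rho> s r \<in> {r \<in> rs.P. \<rho> h r \<notin> rs.P}"
          using r simple_permutes_P[OF s(1)] wh[of r] by simp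
        then have "\<rho> s (\<rho> s r) \<in> \<rho> s ` {r \<in> rs.P. \<rho> h r \<notin> rs.P}" by (rule imageI)
        then show ?thesis unfolding ss by blast
      qed simp
    next
      fix r assume "r \<in> insert (\<alpha> s) (\<rho> s ` {r \<in> rs.P. \<rho> h r \<notin> rs.P})"
      then consider "r = \<alpha> s" | q where "q \<in> rs.P" "\<rho> h q \<notin> rs.P" "r = \<rho> s q" by blast
      then show "r \<in> {r \<in> rs.P. \<rho> w r \<notin> rs.P}"
      proof cases
        case 1
        then show ?thesis using rs.P_neg[OF ps] simple_P[OF s(1)] by (simp add: wh sa rho_minus[OF h(1)])
      next
        case 2
        then have "q \<noteq> \<alpha> s" using ps by blast
        then show ?thesis using 2 simple_permutes_P[OF s(1)] by (simp add: wh ss)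
      qed
    qed
    have fin: "finite {r \<in> rs.P. \<rho> h r \<notin> rs.P}" using rs.finite_inverted h(1) by blast
    have inj: "inj_on (\<rho> s) {r \<in> rs.P. \<rho> h r \<notin> rs.P}" by (rule inj_on_inverseI[of _ "\<rho> s"]) (simp add: ss)
    have notin: "\<alpha> s \<notin> \<rho> s ` {r \<in> rs.P. \<rho> h r \<notin> rs.P}"
    proof
      assume "\<alpha> s \<in> \<rho> s ` {r \<in> rs.P. \<rho> h r \<notin> rs.P}"
      then obtain q where q: "q \<in> rs.P" "\<alpha> s = \<rho> s q" by blast
      then have "q = - \<alpha> s" using ss[of q] sa by simp
      then show False using q(1) rs.P_neg simple_P s by blast
    qed
    show ?thesis
      unfolding eq using fin notin less.hyps[OF h(2,1)] card_image[OF inj] lw by simp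
  qed
qed

text \<open>Compare the inversions of \<open>y\<close> and of the reflected element: outside
  \<open>N\<close> the reflection matches the two sets, and inside \<open>N\<close> its negative
  matches one with the complement of the other.\<close>

lemma length_difference:
  assumes y: "y \<in> carrier W" and c: "c \<in> rs.P"
  defines "N \<equiv> {r \<in> rs.P. rs.refl c r \<notin> rs.P}" and "I \<equiv> {r \<in> rs.P. \<rho> (inv y) r \<notin> rs.P}"
  shows "len y + card N = len (root_reflection c \<otimes> y) + 2 * card (N \<inter> I)"
    and "finite N"
proof -
  have cR: "c \<in> roots" using c rs.P_R by blast
  have t: "root_reflection c \<in> carrier W" "\<And>v. \<rho> (root_reflection c) v = rs.refl c v" using root_reflection[OF cR] by auto
  define J where "J = {r \<in> rs.P. \<rho> (inv y) (rs.refl c r) \<notin> rs.P}"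
  have lenI: "card I = len y" unfolding I_def using card_negated[of "inv y"] y len_inv[OF y] by simp
  have inv_ty: "inv (root_reflection c \<otimes> y) = inv y \<otimes> root_reflection c"
    using y t root_reflection_inv[OF cR] by (simp add: inv_mult_group)
  have lenJ: "card J = len (root_reflection c \<otimes> y)"
    unfolding J_def using card_negated[of "inv (root_reflection c \<otimes> y)"] y t len_inv[of "root_reflection c \<otimes> y"]
    by (simp add: inv_ty rho_mult)
  have finI: "finite I" unfolding I_def using rs.finite_inverted y by blast
  have "inv (root_reflection c \<otimes> y) \<in> carrier W" using y t by simp
  then have "finite {r \<in> rs.P. \<rho> (inv (root_reflection c \<otimes> y)) r \<notin> rs.P}" using rs.finite_inverted by blast
  then have finJ: "finite J" unfolding J_def by (simp add: inv_ty rho_mult y t)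
  show finN: "finite N" unfolding N_def using rs.finite_inverted[OF rs.refl_M[OF cR]] .
  note rr = rs.refl_refl[OF cR]
  have 1: "card (J - N) = card (I - N)"
  proof (rule bij_betw_same_card[of "rs.refl c"])
    show "bij_betw (rs.refl c) (J - N) (I - N)"
      by (rule bij_betwI[where g = "rs.refl c"]) (auto simp: J_def I_def N_def rr)
  qed
  have 2: "card (J \<inter> N) = card (N - I)"
  proof (rule bij_betw_same_card[of "\<lambda>r. - rs.refl c r"])
    have a: "- rs.refl c r \<in> N - I" if "r \<in> J \<inter> N" for r
    proof -
      have r: "r \<in> rs.P" "rs.refl c r \<notin> rs.P" "\<rho> (inv y) (rs.refl c r) \<notin> rs.P" using that by (auto simp: J_def N_def)
      have rR: "rs.refl c r \<in> roots" using rs.refl_R cR r(1) rs.P_R by blast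
      have "- rs.refl c r \<in> rs.P" using rs.not_P_iff[OF rR] r(2) by blast
      moreover have "rs.refl c (- rs.refl c r) = - r" by (simp add: rs.refl_minus rr)
      moreover have "\<rho> (inv y) (- rs.refl c r) \<in> rs.P"
        using rho_minus_P[of "inv y", OF _ rR] r(3) y by (simp add: rho_minus)
      ultimately show ?thesis using rs.P_neg[OF r(1)] by (auto simp: N_def I_def)
    qed
    have b: "- rs.refl c r \<in> J \<inter> N" if "r \<in> N - I" for r
    proof -
      have r: "r \<in> rs.P" "rs.refl c r \<notin> rs.P" "\<rho> (inv y) r \<in> rs.P" using that by (auto simp: I_def N_def)
      have rR: "rs.refl c r \<in> roots" using rs.refl_R cR r(1) rs.P_R by blast
      have "- rs.refl c r \<in> rs.P" using rs.not_P_iff[OF rR] r(2) by blast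
      moreover have "rs.refl c (- rs.refl c r) = - r" by (simp add: rs.refl_minus rr)
      moreover have "\<rho> (inv y) (- r) \<notin> rs.P" using rs.P_neg[OF r(3)] y by (simp add: rho_minus)
      ultimately show ?thesis using rs.P_neg[OF r(1)] by (auto simp: N_def J_def)
    qed
    show "bij_betw (\<lambda>r. - rs.refl c r) (J \<inter> N) (N - I)"
      by (rule bij_betwI[where g = "\<lambda>r. - rs.refl c r"]) (use a b in \<open>auto simp: rs.refl_minus rr\<close>)
  qed
  have "card J = card (J - N) + card (J \<inter> N)" using finJ card_Diff_subset_Int[of J N] card_mono[of J "J \<inter> N"] by simp
  moreover have "card I = card (I - N) + card (N \<inter> I)"
    using finI card_Diff_subset_Int[of I N] card_mono[of I "I \<inter> N"] by (simp add: Int_commute)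
  moreover have "card N = card (N - I) + card (N \<inter> I)"
    using finN card_Diff_subset_Int[of N I] card_mono[of N "N \<inter> I"] by simp
  ultimately show "len y + card N = len (root_reflection c \<otimes> y) + 2 * card (N \<inter> I)"
    using 1 2 lenI lenJ by linarith
qed

text \<open>The negated reflection injects \<open>N - I\<close> into \<open>N \<inter> I\<close>
  without \<open>c\<close>, so most of \<open>N\<close> is inverted and the length drops. A drop by
  exactly one makes the injection bijective, hence every inverted \<open>h \<noteq> c\<close> in
  \<open>N\<close> is paired with a root that is not inverted.\<close>

lemma inverted_reflection:
  assumes y: "y \<in> carrier W" and c: "c \<in> rs.P" and neg: "\<rho> (inv y) c \<notin> rs.P"
  shows "len (root_reflection c \<otimes> y) < len y"
    and "len (root_reflection c \<otimes> y) + 1 = len y \<Longrightarrow> h \<in> rs.P \<Longrightarrow> \<rho> (inv y) h \<notin> rs.P \<Longrightarrow> h \<noteq> c \<Longrightarrow>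
      rs.refl c h \<notin> rs.P \<Longrightarrow> \<rho> (inv y) (rs.refl c h) \<notin> rs.P"
proof -
  define N I where "N = {r \<in> rs.P. rs.refl c r \<notin> rs.P}" and "I = {r \<in> rs.P. \<rho> (inv y) r \<notin> rs.P}"
  have cR: "c \<in> roots" using c rs.P_R by blast
  have diff: "len y + card N = len (root_reflection c \<otimes> y) + 2 * card (N \<inter> I)" and finN: "finite N"
    using length_difference[OF y c] by (auto simp: N_def I_def)
  have cNI: "c \<in> N \<inter> I" using c neg rs.P_neg[OF c] rs.refl_self[OF cR] by (simp add: N_def I_def)
  define f where "f r = - rs.refl c r" for r
  have f: "f r \<in> N \<inter> I - {c}" if "r \<in> N - I" for r
  proof -
    have r: "r \<in> rs.P" "rs.refl c r \<notin> rs.P" "\<rho> (inv y) r \<in> rs.P" using that by (auto simp: I_def N_def)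
    have rR: "rs.refl c r \<in> roots" "r \<in> roots" using rs.refl_R cR r(1) rs.P_R by blast+
    have fP: "f r \<in> rs.P" using rs.not_P_iff[OF rR(1)] r(2) by (simp add: f_def)
    have fN: "f r \<in> N" using fP rs.P_neg[OF r(1)] by (simp add: N_def f_def rs.refl_minus rs.refl_refl[OF cR])
    have "\<rho> (inv y) (f r) \<notin> rs.P"
    proof
      assume p: "\<rho> (inv y) (f r) \<in> rs.P"
      have Bpos: "B c r > 0"
      proof (rule ccontr)
        assume "\<not> ?thesis"
        then have "1 *\<^sub>R r + (- 2 * B c r) *\<^sub>R c \<in> rs.P"
          using rs.R_nonneg_comb[of 1 r "- 2 * B c r" c] rR r(1) c rs.P_K by (simp add: rs.refl_def)
        then show False using r(2) by (simp add: rs.refl_def)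
      qed
      have "\<rho> (inv y) (f r) + \<rho> (inv y) r = (2 * B c r) *\<^sub>R \<rho> (inv y) c"
        using y by (simp add: f_def rs.refl_def rho_add rho_scale rho_minus rho_diff)
      then have in_K: "(2 * B c r) *\<^sub>R \<rho> (inv y) c \<in> Cone"
        using Cone_add[OF rs.P_K[OF p] rs.P_K[OF r(3)]] by simp
      have "\<rho> (inv y) c = (1 / (2 * B c r)) *\<^sub>R ((2 * B c r) *\<^sub>R \<rho> (inv y) c)" using Bpos by simp
      also have "\<dots> \<in> Cone" by (rule Cone_scale[OF _ in_K]) (use Bpos in simp)
      finally show False using neg rho_roots[of "inv y" c] y cR by (simp add: rs.P_def)
    qed
    moreover have "f r \<noteq> c"
    proof
      assume "f r = c"
      then have "rs.refl c r = - c" by (simp add: f_def minus_equation_iff)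
      then have "rs.refl c (rs.refl c r) = c" by (simp add: rs.refl_minus rs.refl_self[OF cR])
      then have "r = c" using rs.refl_refl[OF cR] by simp
      then show False using that cNI by blast
    qed
    ultimately show ?thesis using fP fN by (auto simp: I_def)
  qed
  have inj: "inj_on f (N - I)"
    by (rule inj_on_inverseI[of _ f]) (simp add: f_def rs.refl_minus rs.refl_refl[OF cR])
  have finNI: "finite (N \<inter> I - {c})" using finN by simp
  have le: "card (N - I) \<le> card (N \<inter> I - {c})"
    using card_inj_on_le[OF inj _ finNI] f by blast
  have cardc: "card (N \<inter> I) = Suc (card (N \<inter> I - {c}))" using card.remove[of "N \<inter> I" c] finN cNI by simp
  have cardN: "card N = card (N - I) + card (N \<inter> I)"
    using finN card_Diff_subset_Int[of N I] card_mono[of N "N \<inter> I"] by simp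
  show "len (root_reflection c \<otimes> y) < len y" using diff le cardc cardN by linarith
  assume len: "len (root_reflection c \<otimes> y) + 1 = len y" and h: "h \<in> rs.P" "\<rho> (inv y) h \<notin> rs.P" "h \<noteq> c" "rs.refl c h \<notin> rs.P"
  have "card (N - I) = card (N \<inter> I - {c})" using diff len cardc cardN by linarith
  then have "f ` (N - I) = N \<inter> I - {c}"
    using card_image[OF inj] card_subset_eq[OF finNI, of "f ` (N - I)"] f by auto
  then have "h \<in> f ` (N - I)" using h by (auto simp: N_def I_def)
  then obtain r where r: "r \<in> N - I" "h = f r" by blast
  then have "rs.refl c h = - r" by (simp add: f_def rs.refl_minus rs.refl_refl[OF cR])
  then show "\<rho> (inv y) (rs.refl c h) \<notin> rs.P"
    using r rs.P_neg y by (auto simp: N_def I_def rho_minus)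
qed

lemma reflection_len_iff:
  assumes y: "y \<in> carrier W" and c: "c \<in> rs.P"
  shows "len (root_reflection c \<otimes> y) < len y \<longleftrightarrow> \<rho> (inv y) c \<notin> rs.P"
proof
  show "\<rho> (inv y) c \<notin> rs.P" if "len (root_reflection c \<otimes> y) < len y"
  proof
    assume p: "\<rho> (inv y) c \<in> rs.P"
    have cR: "c \<in> roots" using c rs.P_R by blast
    have t: "root_reflection c \<in> carrier W" using root_reflection[OF cR] by auto
    have "\<rho> (inv (root_reflection c \<otimes> y)) c = - \<rho> (inv y) c"
      using y t root_reflection_inv[OF cR] root_reflection(2)[OF cR] rs.refl_self[OF cR]
      by (simp add: inv_mult_group rho_mult rho_minus)
    then have "\<rho> (inv (root_reflection c \<otimes> y)) c \<notin> rs.P" using rs.P_neg[OF p] by simp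
    then have "len (root_reflection c \<otimes> (root_reflection c \<otimes> y)) < len (root_reflection c \<otimes> y)"
      using inverted_reflection(1)[of "root_reflection c \<otimes> y" c] y t c by simp
    then show False using that root_reflection_cancel[OF cR y] by simp
  qed
qed (rule inverted_reflection(1)[OF y c])

section \<open>Short inversions under multiplication, and their extremality\<close>

definition short :: "'v \<Rightarrow> 'w \<Rightarrow> bool" where
  "short c y \<longleftrightarrow> c \<in> rs.P \<and> len (root_reflection c \<otimes> y) + 1 = len y"

lemma short_inversions_iff: "c \<in> short_inversions y \<longleftrightarrow> short c y"
  by (simp add: short_inversions_def short_def pos_roots_P)

lemma short_P: "short c y \<Longrightarrow> c \<in> rs.P"
  by (simp add: short_def)

lemma short_neg: "y \<in> carrier W \<Longrightarrow> short c y \<Longrightarrow> \<rho> (inv y) c \<notin> rs.P"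
  using reflection_len_iff[of y c] by (auto simp: short_def)

lemma short_simple:
  assumes "y \<in> carrier W" "s \<in> S" "\<rho> (inv y) (\<alpha> s) \<notin> rs.P"
  shows "short (\<alpha> s) y"
  using assms len_increases_left_iff[of y s] len_S_mult[of y s] simple_P
  by (auto simp: short_def root_reflection_simple)

lemma short_pairs:
  assumes "y \<in> carrier W" "short c y" "h \<in> rs.P" "\<rho> (inv y) h \<notin> rs.P" "h \<noteq> c" "rs.refl c h \<notin> rs.P"
  shows "\<rho> (inv y) (rs.refl c h) \<notin> rs.P"
  using inverted_reflection(2)[OF assms(1) short_P[OF assms(2)] short_neg[OF assms(1,2)]] assms
  by (simp add: short_def)

lemma short_inverse:
  assumes y: "y \<in> carrier W" and c: "short c y"
  shows "short (- \<rho> (inv y) c) (inv y)"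
proof -
  have cR: "c \<in> roots" using short_P[OF c] rs.P_R by blast
  have P: "- \<rho> (inv y) c \<in> rs.P" using rho_minus_P[of "inv y" c] y cR short_neg[OF y c] by simp
  have t: "root_reflection c \<in> carrier W" using root_reflection[OF cR] by auto
  have "root_reflection (- \<rho> (inv y) c) \<otimes> inv y = inv y \<otimes> root_reflection c \<otimes> y \<otimes> inv y"
    using y cR by (simp add: root_reflection_minus root_reflection_rho rho_roots)
  also have "\<dots> = inv (root_reflection c \<otimes> y)"
    using y t root_reflection_inv[OF cR] by (simp add: m_assoc inv_mult_group)
  finally have "len (root_reflection (- \<rho> (inv y) c) \<otimes> inv y) = len (root_reflection c \<otimes> y)"
    using len_inv[of "root_reflection c \<otimes> y"] y t by simp
  then show ?thesis using P c len_inv[OF y] by (simp add: short_def)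
qed

text \<open>Left multiplication by \<open>inv v\<close> changes length by at most
  \<open>len v\<close>. As the lengths add up, the drop at \<open>w\<close> is at most one, and the
  sign of the root makes it at least one.\<close>

lemma short_pull:
  assumes v: "v \<in> carrier W" and w: "w \<in> carrier W" and len: "len (inv v \<otimes> w) = len v + len w"
    and c: "short c (inv v \<otimes> w)" and P: "\<rho> v c \<in> rs.P"
  shows "short (\<rho> v c) w"
proof -
  have cR: "c \<in> roots" using short_P[OF c] rs.P_R by blast
  have t: "root_reflection c \<in> carrier W" using root_reflection[OF cR] by auto
  have eq: "root_reflection (\<rho> v c) \<otimes> w = v \<otimes> (root_reflection c \<otimes> (inv v \<otimes> w))"
    using root_reflection_rho[OF v cR] v w t by (simp add: m_assoc)
  have "len (root_reflection c \<otimes> (inv v \<otimes> w)) \<le> len (inv v) + len (v \<otimes> (root_reflection c \<otimes> (inv v \<otimes> w)))"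
    using len_mult[of "inv v" "v \<otimes> (root_reflection c \<otimes> (inv v \<otimes> w))"] v w t by (simp add: m_assoc[symmetric])
  then have ge: "len w \<le> len (root_reflection (\<rho> v c) \<otimes> w) + 1"
    using c len len_inv[OF v] unfolding eq by (simp add: short_def)
  have "\<rho> (inv w) (\<rho> v c) = \<rho> (inv (inv v \<otimes> w)) c" using v w by (simp add: inv_mult_group rho_mult)
  then have "\<rho> (inv w) (\<rho> v c) \<notin> rs.P" using short_neg[OF _ c] v w by simp
  then have "len (root_reflection (\<rho> v c) \<otimes> w) < len w" using reflection_len_iff[OF w P] by blast
  then show ?thesis using ge P by (simp add: short_def)
qed

text \<open>The positive form value makes \<open>s\<close> an ascent of the reflected element as
  well, so both lengths rise by one and still differ by one.\<close>

lemma short_push: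
  assumes y: "y \<in> carrier W" and c: "short c y" and s: "s \<in> S" "\<rho> (inv y) (\<alpha> s) \<in> rs.P" and Bc: "B (\<alpha> s) c > 0"
  shows "short (\<rho> s c) (s \<otimes> y)"
proof -
  have sc: "s \<in> carrier W" using s S_carrier by blast
  have cP: "c \<in> rs.P" and cR: "c \<in> roots" using short_P[OF c] rs.P_R by auto
  have t: "root_reflection c \<in> carrier W" using root_reflection[OF cR] by auto
  have "c \<noteq> \<alpha> s" using short_neg[OF y c] s by blast
  then have P: "\<rho> s c \<in> rs.P" using simple_permutes_P s cP by blast
  have "root_reflection (\<rho> s c) \<otimes> (s \<otimes> y) = s \<otimes> (root_reflection c \<otimes> y)"
    using root_reflection_rho[OF sc cR] sc y t S_inv[OF s(1)] S_cancel[OF s(1) y] by (simp add: m_assoc)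
  moreover have "len (s \<otimes> (root_reflection c \<otimes> y)) > len (root_reflection c \<otimes> y)"
  proof -
    have e: "\<rho> (inv (root_reflection c \<otimes> y)) (\<alpha> s) = \<rho> (inv y) (\<alpha> s) + (2 * B (\<alpha> s) c) *\<^sub>R (- \<rho> (inv y) c)"
      using y t root_reflection_inv[OF cR] root_reflection(2)[OF cR] symmetric_B[of c "\<alpha> s"]
      by (simp add: inv_mult_group rho_mult rs.refl_def rho_diff rho_scale)
    have "- \<rho> (inv y) c \<in> rs.P" using rho_minus_P[of "inv y" c] y cR short_neg[OF y c] by simp
    then have "\<rho> (inv (root_reflection c \<otimes> y)) (\<alpha> s) \<in> Cone"
      unfolding e using Bc s rs.P_K by (intro Cone_add Cone_scale) auto
    then have "\<rho> (inv (root_reflection c \<otimes> y)) (\<alpha> s) \<in> rs.P"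
      using rho_roots[of "inv (root_reflection c \<otimes> y)" "\<alpha> s"] simple_roots[OF s(1)] y t by (simp add: rs.P_def)
    then show ?thesis using len_increases_left_iff[of "root_reflection c \<otimes> y" s] s y t by simp
  qed
  moreover have "len (s \<otimes> y) > len y" using len_increases_left_iff[OF y s(1)] s by blast
  ultimately show ?thesis using c P len_S_mult[OF y s(1)] len_S_mult[of "root_reflection c \<otimes> y" s] y t s
    by (auto simp: short_def)
qed

lemma positive_multiple:
  assumes "p > 0" "q > 0" "a \<in> rs.P" "b \<in> rs.P" "c \<in> rs.P" "p *\<^sub>R a + q *\<^sub>R b = k *\<^sub>R c"
  shows "k > 0"
proof (rule ccontr)
  assume "\<not> ?thesis"
  have K: "p *\<^sub>R a + q *\<^sub>R b \<in> Cone" using assms rs.P_K by (intro Cone_add Cone_scale) auto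
  have "- (p *\<^sub>R a + q *\<^sub>R b) = (- k) *\<^sub>R c" using assms(6) by simp
  also have "\<dots> \<in> Cone" using \<open>\<not> k > 0\<close> assms rs.P_K by (intro Cone_scale) auto
  finally have "p *\<^sub>R a + q *\<^sub>R b = 0" using K Cone_salient by blast
  then have "p = 0"
    using rs.positive_relation[of p a q b] assms(1,2) rs.P_K[OF assms(3)] rs.P_K[OF assms(4)]
      rs.R_nonzero[OF rs.P_R[OF assms(3)]] rs.R_nonzero[OF rs.P_R[OF assms(4)]] by simp
  then show False using assms(1) by simp
qed

text \<open>Short inversions span extreme rays of the cone of inversions. Reflecting
  \<open>a\<close> in \<open>c\<close> shows \<open>p * B c a < 1 / 2\<close>, and similarly
  \<open>q * B c b < 1 / 2\<close>, but these add up to \<open>B c c = 1\<close>. When the reflected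
  root is negative, \<open>short_pairs\<close> allows the same sign argument after applying
  \<open>inv y\<close>.\<close>

lemma short_extreme:
  assumes y: "y \<in> carrier W" and c: "short c y" and pq: "p > 0" "q > 0"
    and a: "a \<in> rs.P" "\<rho> (inv y) a \<notin> rs.P" and b: "b \<in> rs.P" "\<rho> (inv y) b \<notin> rs.P"
    and c_eq: "c = p *\<^sub>R a + q *\<^sub>R b"
  shows "a = c"
proof (rule ccontr)
  assume ne: "a \<noteq> c"
  have cR: "c \<in> roots" and cP: "c \<in> rs.P" using short_P[OF c] rs.P_R by auto
  have half: "p * B c a < 1 / 2" if "p > 0" "q > 0" "a \<in> rs.P" "\<rho> (inv y) a \<notin> rs.P" "b \<in> rs.P"
    "\<rho> (inv y) b \<notin> rs.P" "c = p *\<^sub>R a + q *\<^sub>R b" "a \<noteq> c" for p q a b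
  proof -
    have e: "p *\<^sub>R rs.refl c a + q *\<^sub>R b = (1 - 2 * (p * B c a)) *\<^sub>R c"
    proof -
      have "p *\<^sub>R rs.refl c a + q *\<^sub>R b = (p *\<^sub>R a + q *\<^sub>R b) - (2 * (p * B c a)) *\<^sub>R c"
        by (simp add: rs.refl_def algebra_simps)
      then show ?thesis unfolding that(7)[symmetric] by (simp add: algebra_simps)
    qed
    have "1 - 2 * (p * B c a) > 0"
    proof (cases "rs.refl c a \<in> rs.P")
      case True
      then show ?thesis using positive_multiple[OF that(1,2) True that(5) cP e] by simp
    next
      case False
      have n: "\<rho> (inv y) (rs.refl c a) \<notin> rs.P" using short_pairs[OF y c that(3,4,8) False] .
      have yc: "inv y \<in> carrier W" using y by simp
      have "p *\<^sub>R (- \<rho> (inv y) (rs.refl c a)) + q *\<^sub>R (- \<rho> (inv y) b) = - \<rho> (inv y) (p *\<^sub>R rs.refl c a + q *\<^sub>R b)"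
        by (simp add: rho_add[OF yc] rho_scale[OF yc])
      also have "\<dots> = (1 - 2 * (p * B c a)) *\<^sub>R (- \<rho> (inv y) c)" unfolding e by (simp add: rho_scale[OF yc])
      finally show ?thesis
        using positive_multiple[OF that(1,2)] rho_minus_P[OF yc] n that(6) short_neg[OF y c]
          rs.refl_R[OF cR rs.P_R[OF that(3)]] rs.P_R[OF that(5)] cR by blast
    qed
    then show ?thesis by simp
  qed
  have "b \<noteq> c"
  proof
    assume "b = c"
    then have "p *\<^sub>R a + q *\<^sub>R c = c" using c_eq[symmetric] by (simp only:)
    then have "p *\<^sub>R a = c - q *\<^sub>R c" by (simp only: eq_diff_eq)
    then have e: "p *\<^sub>R a = (1 - q) *\<^sub>R c" by (simp only: scaleR_left_diff_distrib scaleR_one)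
    define k where "k = (1 - q) / p"
    have "(1 / p) *\<^sub>R (p *\<^sub>R a) = k *\<^sub>R c" unfolding e k_def by simp
    then have ak: "a = k *\<^sub>R c" using pq(1) by simp
    have "k * k = 1" using roots_norm[OF rs.P_R[OF a(1)]] roots_norm[OF cR] unfolding ak by (simp add: form_simps)
    then have "k = 1 \<or> k = - 1" using square_eq_1_iff by blast
    then show False using ak ne a(1) rs.P_neg[OF cP] by auto
  qed
  have h1: "p * B c a < 1 / 2" using half[OF pq a b c_eq ne] .
  have "c = q *\<^sub>R b + p *\<^sub>R a" using c_eq by (simp add: add.commute)
  then have h2: "q * B c b < 1 / 2" using half[OF pq(2,1) b a _ \<open>b \<noteq> c\<close>] by blast
  have "B c c = p * B c a + q * B c b" by (subst (2) c_eq) (simp add: form_simps)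
  then show False using h1 h2 roots_norm[OF cR] by simp
qed

section \<open>Depth\<close>

definition depth :: "'v \<Rightarrow> nat" where
  "depth r = (LEAST n. \<exists>w \<in> carrier W. len w = n \<and> \<rho> w r \<notin> rs.P)"

lemma depth_le: "w \<in> carrier W \<Longrightarrow> \<rho> w r \<notin> rs.P \<Longrightarrow> depth r \<le> len w"
  unfolding depth_def by (rule Least_le) blast

lemma depth_witness:
  assumes "r \<in> roots"
  obtains w where "w \<in> carrier W" "len w = depth r" "\<rho> w r \<notin> rs.P"
proof -
  have "\<exists>n. \<exists>w \<in> carrier W. len w = n \<and> \<rho> w r \<notin> rs.P"
  proof (cases "r \<in> rs.P")
    case True
    have "\<rho> (root_reflection r) r \<notin> rs.P"
      using root_reflection(2)[OF assms] rs.refl_self[OF assms] rs.P_neg[OF True] by simp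
    then show ?thesis using root_reflection(1)[OF assms] by blast
  next
    case False
    then have "\<rho> \<one> r \<notin> rs.P" by (simp add: rho_one)
    then show ?thesis using one_closed by blast
  qed
  then have "\<exists>w \<in> carrier W. len w = depth r \<and> \<rho> w r \<notin> rs.P" unfolding depth_def by (rule LeastI_ex)
  then show ?thesis using that by blast
qed

lemma depth_rho:
  assumes w: "w \<in> carrier W" and r: "r \<in> roots"
  shows "depth r \<le> len w + depth (\<rho> w r)"
proof -
  obtain v where v: "v \<in> carrier W" "len v = depth (\<rho> w r)" "\<rho> v (\<rho> w r) \<notin> rs.P"
    using depth_witness[OF rho_roots[OF w r]] .
  then have "depth r \<le> len (v \<otimes> w)" using depth_le[of "v \<otimes> w" r] w by (simp add: rho_mult)
  then show ?thesis using len_mult[OF v(1) w] v(2) by simp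
qed

lemma depth_pos_iff:
  assumes "r \<in> roots"
  shows "depth r > 0 \<longleftrightarrow> r \<in> rs.P"
proof
  assume "depth r > 0"
  then show "r \<in> rs.P" using depth_le[of \<one> r] len_one by (auto simp: rho_one)
next
  assume r: "r \<in> rs.P"
  obtain w where w: "w \<in> carrier W" "len w = depth r" "\<rho> w r \<notin> rs.P" using depth_witness[OF assms] .
  show "depth r > 0"
  proof (rule ccontr)
    assume "\<not> ?thesis"
    then have "w = \<one>" using len_zero w by simp
    then show False using w(3) r by (simp add: rho_one)
  qed
qed

text \<open>\<open>s\<close> is the last letter of a shortest \<open>w\<close> inverting
  \<open>r\<close>. With a nonpositive form value, \<open>\<rho> w r\<close> would be a nonnegative
  combination of positive roots.\<close>

lemma depth_down:
  assumes r: "r \<in> rs.P"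
  obtains s where "s \<in> S" "depth (\<rho> s r) + 1 = depth r" "B (\<alpha> s) r > 0"
proof -
  have rR: "r \<in> roots" using r rs.P_R by blast
  obtain w where w: "w \<in> carrier W" "len w = depth r" "\<rho> w r \<notin> rs.P" using depth_witness[OF rR] .
  have "w \<noteq> \<one>" using w(3) r rho_one[of r] by metis
  then obtain s where s: "s \<in> S" "len (w \<otimes> s) < len w" using right_descent_exists[OF w(1)] by blast
  have sc: "s \<in> carrier W" using s S_carrier by blast
  have len: "len (w \<otimes> s) + 1 = len w" using len_mult_S[OF w(1) s(1)] s(2) by simp
  have ss: "\<rho> s (\<rho> s v) = v" for v using rho_simple_refl[OF s(1)] rs.refl_refl[OF simple_roots[OF s(1)]] by simp
  have "depth (\<rho> s r) \<le> len (w \<otimes> s)" using depth_le[of "w \<otimes> s" "\<rho> s r"] w sc by (simp add: rho_mult ss)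
  moreover have "depth r \<le> 1 + depth (\<rho> s r)" using depth_rho[OF sc rR] len_S[OF s(1)] by simp
  ultimately have 1: "depth (\<rho> s r) + 1 = depth r" using len w(2) by linarith
  have "B (\<alpha> s) r > 0"
  proof (rule ccontr)
    assume neg: "\<not> ?thesis"
    have h: "w \<otimes> s \<in> carrier W" using w sc by simp
    have hP: "\<rho> (w \<otimes> s) r \<in> rs.P" using depth_le[OF h] len w(2) by (metis less_add_one not_le)
    have sP: "\<rho> (w \<otimes> s) (\<alpha> s) \<in> rs.P"
      using len_increases_iff[OF h s(1)] S_cancel_right[OF s(1) w(1)] s(2) by simp
    have "\<rho> w r = \<rho> (w \<otimes> s) (\<rho> s r)" using w sc by (simp add: rho_mult ss)
    also have "\<dots> = \<rho> (w \<otimes> s) r + (- 2 * B (\<alpha> s) r) *\<^sub>R \<rho> (w \<otimes> s) (\<alpha> s)"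
      unfolding simple_reflection[OF s(1)] by (simp only: rho_diff[OF h] rho_scale[OF h]) simp
    also have "\<dots> \<in> Cone" using neg rs.P_K[OF hP] rs.P_K[OF sP] by (intro Cone_add Cone_scale) auto
    finally show False using w(3) rho_roots[OF w(1) rR] by (simp add: rs.P_def)
  qed
  then show ?thesis using that s(1) 1 by blast
qed

lemma depth_simple:
  assumes "s \<in> S" shows "depth (\<alpha> s) = 1"
proof -
  have "\<rho> s (\<alpha> s) \<notin> rs.P" using simple_reflection_self[OF assms] rs.P_neg[OF simple_P[OF assms]] by simp
  then have "depth (\<alpha> s) \<le> 1" using depth_le[OF S_carrier[OF assms]] len_S[OF assms] by simp
  then show ?thesis using depth_pos_iff[OF simple_roots[OF assms]] simple_P[OF assms] by simp
qed

lemma depth_not_simple: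
  assumes r: "r \<in> rs.P" "r \<notin> \<alpha> ` S"
  shows "depth r \<ge> 2"
proof -
  obtain s where s: "s \<in> S" "depth (\<rho> s r) + 1 = depth r" using depth_down[OF r(1)] .
  have "\<rho> s r \<in> rs.P" using simple_permutes_P s(1) r by blast
  then have "depth (\<rho> s r) > 0" using depth_pos_iff rs.P_R by blast
  then show ?thesis using s(2) by simp
qed

lemma depth_inv:
  assumes "v \<in> carrier W" "r \<in> roots"
  shows "depth (\<rho> v r) \<le> len v + depth r"
  using depth_rho[of "inv v" "\<rho> v r"] assms rho_roots by (simp add: rho_inv len_inv)

lemma simple_pair_coefficients:
  assumes p: "p \<in> S" and q: "q \<in> S" "\<alpha> p \<noteq> \<alpha> q" and K: "x *\<^sub>R \<alpha> p + y *\<^sub>R \<alpha> q \<in> Cone"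
  shows "x \<ge> 0"
proof (rule ccontr)
  assume "\<not> ?thesis"
  then have "(- x) *\<^sub>R \<alpha> p \<in> Cone" using p simple_Cone by (intro Cone_scale) auto
  moreover have "(- x) *\<^sub>R \<alpha> p + (x *\<^sub>R \<alpha> p + y *\<^sub>R \<alpha> q) = y *\<^sub>R \<alpha> q" by simp
  ultimately obtain k where "(- x) *\<^sub>R \<alpha> p = k *\<^sub>R \<alpha> q" using simple_extreme[OF _ K q(1)] by blast
  then have "(- x) *\<^sub>R \<alpha> p + (- k) *\<^sub>R \<alpha> q = 0" by simp
  then have "- x = 0" using rs.P_independent[OF simple_P[OF p] simple_P[OF q(1)] q(2)] by blast
  then show False using \<open>\<not> 0 \<le> x\<close> by simp
qed

lemma simple_inj: "p \<in> S \<Longrightarrow> q \<in> S \<Longrightarrow> p \<noteq> q \<Longrightarrow> \<alpha> p \<noteq> \<alpha> q"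
  using simple_obtuse[of p q] simple_norm[of p] by auto

text \<open>An application of \<open>nonsmall_transfer\<close>, with \<open>\<rho> y\<close> as the
  element inverting both roots. The indecomposability needed there follows from
  \<open>short_extreme\<close> for \<open>c\<close> and from the extremality of
  \<open>\<alpha> r\<close> in the cone.\<close>

lemma nonsmall_transfer_short:
  assumes y: "y \<in> carrier W" and c: "short c y" and r: "r \<in> S" "\<rho> (inv y) (\<alpha> r) \<notin> rs.P" and ne: "c \<noteq> \<alpha> r"
    and nf: "rs.nonsmall (- \<rho> (inv y) c)"
    and eq: "- \<rho> (inv y) (\<alpha> r) = k *\<^sub>R (- \<rho> (inv y) c) + l *\<^sub>R e" "k > 0" "l > 0" "e \<in> rs.P"
  shows "rs.nonsmall (- \<rho> (inv y) (\<alpha> r))"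
proof -
  define f a where "f = - \<rho> (inv y) c" and "a = - \<rho> (inv y) (\<alpha> r)"
  have yc: "inv y \<in> carrier W" using y by simp
  have cP: "c \<in> rs.P" using short_P[OF c] .
  have cR: "c \<in> roots" using cP rs.P_R by blast
  have rP: "\<alpha> r \<in> rs.P" using simple_P r by blast
  have f: "f \<in> rs.P" unfolding f_def using rho_minus_P[OF yc cR] short_neg[OF y c] by blast
  have a: "a \<in> rs.P" unfolding a_def using rho_minus_P[OF yc simple_roots[OF r(1)]] r(2) by blast
  have yf: "\<rho> y f = - c" and ya: "\<rho> y a = - \<alpha> r" unfolding f_def a_def rho_minus[OF y] rho_inv'[OF y] by simp_all
  have "a \<noteq> f"
  proof
    assume "a = f"
    then have "- \<alpha> r = - c" using yf ya by (simp only:)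
    then show False using ne by simp
  qed
  have comb: "\<rho> (inv y) (s *\<^sub>R c + t *\<^sub>R \<alpha> r) = (- s) *\<^sub>R f + (- t) *\<^sub>R a" for s t
    by (simp add: f_def a_def rho_add[OF yc] rho_scale[OF yc])
  \<comment> \<open>A decomposition of \<open>f\<close> becomes one of \<open>c\<close> into roots
    that \<open>inv y\<close> makes negative. If the coefficient \<open>t\<close> at
    \<open>\<alpha> r\<close> is negative, the first part is positive; the second may be negative
    and is then traded for \<open>\<alpha> r\<close>, so that \<open>short_extreme\<close> applies
    in either case.\<close>
  have signs: False if pq: "p > 0" "q > 0" "p * s + q * s' = 1" "p * t + q * t' = 0" "t < 0"
    and R: "s *\<^sub>R c + t *\<^sub>R \<alpha> r \<in> roots" "s' *\<^sub>R c + t' *\<^sub>R \<alpha> r \<in> roots"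
    and neg: "\<rho> (inv y) (s *\<^sub>R c + t *\<^sub>R \<alpha> r) \<notin> rs.P" "\<rho> (inv y) (s' *\<^sub>R c + t' *\<^sub>R \<alpha> r) \<notin> rs.P"
    for p q s t s' t'
  proof -
    define h h' where "h = s *\<^sub>R c + t *\<^sub>R \<alpha> r" and "h' = s' *\<^sub>R c + t' *\<^sub>R \<alpha> r"
    have "p * t < 0" using pq by (simp add: mult_pos_neg)
    then have "q * t' > 0" using pq(4) by linarith
    then have t': "t' > 0" using pq(2) by (simp add: zero_less_mult_iff)
    have s: "s > 0"
    proof (rule ccontr)
      assume "\<not> ?thesis"
      then have "(- s) *\<^sub>R f + (- t) *\<^sub>R a \<in> Cone" using pq(5) f a rs.P_K by (intro Cone_add Cone_scale) auto
      then show False using neg(1) rho_roots[OF yc R(1)] by (simp add: comb rs.P_def)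
    qed
    have hP: "h \<in> rs.P"
    proof (rule ccontr)
      assume "h \<notin> rs.P"
      then have "- h \<in> Cone" using rs.not_P_iff[OF R(1)] rs.P_K by (simp add: h_def)
      moreover have "s *\<^sub>R c \<in> Cone" using s cP rs.P_K by (intro Cone_scale) auto
      moreover have "s *\<^sub>R c + (- h) = (- t) *\<^sub>R \<alpha> r" by (simp add: h_def)
      ultimately obtain j where "s *\<^sub>R c = j *\<^sub>R \<alpha> r" using simple_extreme r(1) by blast
      then have "s *\<^sub>R c + (- j) *\<^sub>R \<alpha> r = 0" by simp
      then show False using rs.P_independent[OF cP rP ne] s by blast
    qed
    have hc: "h \<noteq> c"
    proof
      assume "h = c"
      then have "(s - 1) *\<^sub>R c + t *\<^sub>R \<alpha> r = 0" by (simp add: h_def algebra_simps)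
      then show False using rs.P_independent[OF cP rP ne] pq(5) by blast
    qed
    have "p *\<^sub>R h + q *\<^sub>R h' = (p * s + q * s') *\<^sub>R c + (p * t + q * t') *\<^sub>R \<alpha> r"
      by (simp add: h_def h'_def algebra_simps)
    then have ceq: "c = p *\<^sub>R h + q *\<^sub>R h'" unfolding pq(3,4) by simp
    have nh: "\<rho> (inv y) h \<notin> rs.P" and nh': "\<rho> (inv y) h' \<notin> rs.P" using neg by (simp_all only: h_def h'_def not_False_eq_True)
    show False
    proof (cases "h' \<in> rs.P")
      case True
      then show False using short_extreme[OF y c pq(1,2) hP nh True nh' ceq] hc by blast
    next
      case False
      have s': "s' < 0"
      proof (rule ccontr)
        assume "\<not> ?thesis"
        then have "h' \<in> Cone" unfolding h'_def using t' cP rP rs.P_K by (intro Cone_add Cone_scale) auto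
        then show False using False R(2) by (simp add: h'_def rs.P_def)
      qed
      define d where "d = 1 - q * s'"
      have d: "d > 0" using mult_pos_neg[OF pq(2) s'] by (simp add: d_def)
      have "d *\<^sub>R c = p *\<^sub>R h + (q * t') *\<^sub>R \<alpha> r"
      proof -
        have "p *\<^sub>R h + (q * t') *\<^sub>R \<alpha> r = (p *\<^sub>R h + q *\<^sub>R h') - (q * s') *\<^sub>R c"
          by (simp add: h'_def algebra_simps)
        also have "\<dots> = d *\<^sub>R c" unfolding ceq[symmetric] by (simp add: d_def algebra_simps)
        finally show ?thesis by simp
      qed
      then have "(1 / d) *\<^sub>R (d *\<^sub>R c) = (1 / d) *\<^sub>R (p *\<^sub>R h + (q * t') *\<^sub>R \<alpha> r)" by (simp only:)
      then have e: "c = (p / d) *\<^sub>R h + (q * t' / d) *\<^sub>R \<alpha> r" using d by (simp add: scaleR_add_right)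
      have "p / d > 0" "q * t' / d > 0" using d pq(1,2) t' by simp_all
      then show False using short_extreme[OF y c _ _ hP nh rP r(2) e] hc by blast
    qed
  qed
  have indec: "t = 0" if pq: "p > 0" "q > 0" and P: "s *\<^sub>R f + t *\<^sub>R a \<in> rs.P" "s' *\<^sub>R f + t' *\<^sub>R a \<in> rs.P"
    and feq: "f = p *\<^sub>R (s *\<^sub>R f + t *\<^sub>R a) + q *\<^sub>R (s' *\<^sub>R f + t' *\<^sub>R a)" for p q s t s' t'
  proof -
    have "p *\<^sub>R (s *\<^sub>R f + t *\<^sub>R a) + q *\<^sub>R (s' *\<^sub>R f + t' *\<^sub>R a) = (p * s + q * s') *\<^sub>R f + (p * t + q * t') *\<^sub>R a"
      by (simp add: algebra_simps)
    then have "(p * s + q * s') *\<^sub>R f + (p * t + q * t') *\<^sub>R a = f" using feq by (simp only:)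
    then have "(p * s + q * s' - 1) *\<^sub>R f + (p * t + q * t') *\<^sub>R a = 0" by (simp add: algebra_simps)
    then have "p * s + q * s' - 1 = 0 \<and> p * t + q * t' = 0" using rs.P_independent[OF f a] \<open>a \<noteq> f\<close> by blast
    then have sums: "p * s + q * s' = 1" "p * t + q * t' = 0" by simp_all
    have root: "u *\<^sub>R c + v *\<^sub>R \<alpha> r \<in> roots \<and> \<rho> (inv y) (u *\<^sub>R c + v *\<^sub>R \<alpha> r) \<notin> rs.P"
      if "u *\<^sub>R f + v *\<^sub>R a \<in> rs.P" for u v
    proof -
      have e: "\<rho> y (u *\<^sub>R f + v *\<^sub>R a) = - (u *\<^sub>R c + v *\<^sub>R \<alpha> r)" by (simp add: rho_add[OF y] rho_scale[OF y] yf ya)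
      have "- (u *\<^sub>R c + v *\<^sub>R \<alpha> r) \<in> roots" using rho_roots[OF y rs.P_R[OF that]] unfolding e .
      then have "u *\<^sub>R c + v *\<^sub>R \<alpha> r \<in> roots" using rs.neg_R by (metis minus_minus)
      moreover have e': "\<rho> (inv y) (u *\<^sub>R c + v *\<^sub>R \<alpha> r) = - (u *\<^sub>R f + v *\<^sub>R a)" by (simp add: comb)
      ultimately show ?thesis using rs.P_neg[OF that] unfolding e' by blast
    qed
    note r1 = root[OF P(1)] and r2 = root[OF P(2)]
    consider "t = 0" | "t < 0" | "t > 0" by linarith
    then show ?thesis
    proof cases
      case 2
      then show ?thesis using signs[OF pq sums] r1 r2 by blast
    next
      case 3
      then have "p * t > 0" using pq(1) by simp
      then have "q * t' < 0" using sums(2) by linarith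
      then have "t' < 0" using pq(2) by (simp add: mult_less_0_iff)
      moreover have "q * s' + p * s = 1" "q * t' + p * t = 0" using sums by simp_all
      ultimately show ?thesis using signs[OF pq(2,1)] r1 r2 by blast
    qed
  qed
  have "rs.nonsmall a"
  proof (rule rs.nonsmall_transfer[OF f a])
    show "rs.nonsmall f" using nf by (simp add: f_def)
    show "\<rho> y \<in> \<rho> ` carrier W" using y by blast
    show "\<rho> y f \<notin> rs.P" "\<rho> y a \<notin> rs.P" unfolding yf ya using rs.P_neg cP rP by blast+
    show "a = k *\<^sub>R f + l *\<^sub>R e" using eq(1) by (simp add: f_def a_def)
  qed (use eq indec in blast)+
  then show ?thesis by (simp add: a_def)
qed

section \<open>Descent of non-small roots\<close>

text \<open>By the depth condition each letter of a reduced word of \<open>v\<close> takes \<open>c\<close> down by one in depth.\<close>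

definition down_prefix :: "'v \<Rightarrow> 'w \<Rightarrow> 'w \<Rightarrow> bool" where
  "down_prefix c w v \<longleftrightarrow> v \<in> carrier W \<and> depth (\<rho> (inv v) c) + len v = depth c \<and>
    len (inv v \<otimes> w) = len v + len w \<and> short (\<rho> (inv v) c) (inv v \<otimes> w)"

text \<open>The depth and length conditions are equality cases of triangle inequalities, so they
  pass to shorter prefixes; shortness passes by \<open>short_pull\<close>.\<close>

lemma down_prefix_shorten:
  assumes w: "w \<in> carrier W" and c: "c \<in> roots" and v: "down_prefix c w v"
    and p: "p \<in> S" "len (v \<otimes> p) < len v"
  shows "down_prefix c w (v \<otimes> p)" "depth (\<rho> (inv (v \<otimes> p)) c) = Suc (depth (\<rho> (inv v) c))"
proof -
  have vc: "v \<in> carrier W" and dv: "depth (\<rho> (inv v) c) + len v = depth c"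
    and lv: "len (inv v \<otimes> w) = len v + len w" and sh: "short (\<rho> (inv v) c) (inv v \<otimes> w)"
    using v by (auto simp: down_prefix_def)
  have pc: "p \<in> carrier W" using p S_carrier by blast
  define u where "u = v \<otimes> p"
  have u: "u \<in> carrier W" "v = u \<otimes> p" using vc pc S_cancel_right[OF p(1) vc] by (simp_all add: u_def)
  have lu: "len v = len u + 1" using len_mult_S[OF vc p(1)] p(2) by (simp add: u_def)
  have iu: "inv u = p \<otimes> inv v" using vc pc S_inv[OF p(1)] by (simp add: u_def inv_mult_group)
  define c' where "c' = \<rho> (inv v) c"
  have c'R: "c' \<in> roots" using rho_roots c vc by (simp add: c'_def)
  have uc: "\<rho> (inv u) c = \<rho> p c'" using pc vc by (simp add: iu c'_def rho_mult)
  have d1: "depth c \<le> len u + depth (\<rho> p c')" using depth_rho[of "inv u" c] u c len_inv[of u] uc by simp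
  have d2: "depth (\<rho> p c') \<le> 1 + depth c'" using depth_inv[OF pc c'R] len_S[OF p(1)] by simp
  have d: "depth (\<rho> p c') = Suc (depth c')" "depth (\<rho> p c') + len u = depth c"
    using d1 d2 dv lu unfolding c'_def[symmetric] by linarith+
  then show "depth (\<rho> (inv (v \<otimes> p)) c) = Suc (depth (\<rho> (inv v) c))"
    using uc by (simp add: u_def c'_def)
  have pu: "inv v \<otimes> w = p \<otimes> (inv u \<otimes> w)"
    using vc pc w S_cancel[OF p(1), of "inv v \<otimes> w"] by (simp add: iu m_assoc)
  have "len (p \<otimes> (inv u \<otimes> w)) \<le> 1 + len (inv u \<otimes> w)"
    using len_mult[OF pc, of "inv u \<otimes> w"] len_S[OF p(1)] u w by simp
  then have ge: "len u + len w \<le> len (inv u \<otimes> w)" using lv lu unfolding pu by simp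
  have le: "len (inv u \<otimes> w) \<le> len u + len w" using len_mult[of "inv u" w] u w len_inv[of u] by simp
  have P: "\<rho> p c' \<in> rs.P" using depth_pos_iff[OF rho_roots[OF pc c'R]] d(1) by simp
  have "short (\<rho> p c') (inv u \<otimes> w)"
  proof (rule short_pull[OF pc _ _ _ P])
    show "inv u \<otimes> w \<in> carrier W" using u w by simp
    show "len (inv p \<otimes> (inv u \<otimes> w)) = len p + len (inv u \<otimes> w)"
      unfolding S_inv[OF p(1)] pu[symmetric] using lv lu ge le len_S[OF p(1)] by simp
    show "short c' (inv p \<otimes> (inv u \<otimes> w))"
      unfolding S_inv[OF p(1)] pu[symmetric] using sh by (simp add: c'_def)
  qed
  then show "down_prefix c w (v \<otimes> p)"
    unfolding down_prefix_def u_def[symmetric] uc using d(2) ge le u(1) by simp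
qed

lemma down_prefix_ascent:
  assumes c: "c \<in> roots" and v: "down_prefix c w v" and s: "s \<in> S" "depth (\<rho> s (\<rho> (inv v) c)) + 1 = depth (\<rho> (inv v) c)"
  shows "len (v \<otimes> s) = len v + 1"
proof -
  have vc: "v \<in> carrier W" and dv: "depth (\<rho> (inv v) c) + len v = depth c" using v by (auto simp: down_prefix_def)
  have sc: "s \<in> carrier W" using s S_carrier by blast
  have "inv (v \<otimes> s) = s \<otimes> inv v" using vc sc S_inv[OF s(1)] by (simp add: inv_mult_group)
  then have "depth c \<le> len (v \<otimes> s) + depth (\<rho> s (\<rho> (inv v) c))"
    using depth_rho[of "inv (v \<otimes> s)" c] vc sc c len_inv[of "v \<otimes> s"] by (simp add: rho_mult)
  then show ?thesis using len_mult_S[OF vc s(1)] s(2) dv by linarith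
qed

text \<open>Brings a simple root found at the end of a prefix back to \<open>w\<close>. The depth
  falls because that root has depth 1, while the image of \<open>c\<close> at the same place has
  depth at least 2.\<close>

lemma nonsmall_pull:
  assumes w: "w \<in> carrier W" and v: "down_prefix c w v" and c: "c \<in> roots" and r: "r \<in> S"
    and asc: "\<rho> v (\<alpha> r) \<in> rs.P" and neg: "\<rho> (inv (inv v \<otimes> w)) (\<alpha> r) \<notin> rs.P"
    and ns: "rs.nonsmall (- \<rho> (inv (inv v \<otimes> w)) (\<alpha> r))" and d: "depth (\<rho> (inv v) c) \<ge> 2"
  shows "\<exists>a. short a w \<and> depth a < depth c \<and> rs.nonsmall (- \<rho> (inv w) a)"
proof (intro exI conjI)
  have vc: "v \<in> carrier W" and dv: "depth (\<rho> (inv v) c) + len v = depth c"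
    and lv: "len (inv v \<otimes> w) = len v + len w" using v by (auto simp: down_prefix_def)
  have y: "inv v \<otimes> w \<in> carrier W" using vc w by simp
  show "short (\<rho> v (\<alpha> r)) w" using short_pull[OF vc w lv short_simple[OF y r neg] asc] .
  show "depth (\<rho> v (\<alpha> r)) < depth c"
    using depth_inv[OF vc simple_roots[OF r]] depth_simple[OF r] dv d by linarith
  show "rs.nonsmall (- \<rho> (inv w) (\<rho> v (\<alpha> r)))"
    using ns vc w by (simp add: inv_mult_group rho_mult)
qed

text \<open>Let \<open>s\<close> lower the depth of the end root \<open>c'\<close>. If
  \<open>\<alpha> s\<close> were not inverted, \<open>short_push\<close> would extend the maximal
  \<open>v\<close>. Thus \<open>\<alpha> s\<close> is inverted, \<open>short_pairs\<close> controls
  \<open>refl c' (\<alpha> s)\<close>, and \<open>- \<rho> (inv y) (\<alpha> s)\<close> is a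
  positive combination of the non-small root and another positive root.\<close>

lemma nonsmall_chain_away:
  assumes w: "w \<in> carrier W" and c: "c \<in> roots" and v: "down_prefix c w v"
    and max: "\<And>u. down_prefix c w u \<Longrightarrow> len u \<le> len v"
    and ns: "rs.nonsmall (- \<rho> (inv w) c)" and nsimp: "\<rho> (inv v) c \<notin> \<alpha> ` S"
  shows "\<exists>a. short a w \<and> depth a < depth c \<and> rs.nonsmall (- \<rho> (inv w) a)"
proof -
  define c' y where "c' = \<rho> (inv v) c" and "y = inv v \<otimes> w"
  have vc: "v \<in> carrier W" and dv: "depth c' + len v = depth c"
    and lv: "len y = len v + len w" and sh: "short c' y" using v by (auto simp: down_prefix_def c'_def y_def)
  have y: "y \<in> carrier W" and yc: "inv y \<in> carrier W" using vc w by (simp_all add: y_def)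
  have c'P: "c' \<in> rs.P" using short_P[OF sh] .
  then have c'R: "c' \<in> roots" using rs.P_R by blast
  have yw: "\<rho> (inv y) c' = \<rho> (inv w) c" using vc w by (simp add: y_def c'_def inv_mult_group rho_mult rho_inv')
  obtain s where s: "s \<in> S" "depth (\<rho> s c') + 1 = depth c'" "B (\<alpha> s) c' > 0" using depth_down[OF c'P] .
  have sc: "s \<in> carrier W" using s S_carrier by blast
  have ne: "c' \<noteq> \<alpha> s" using nsimp s(1) by (auto simp: c'_def)
  have asc: "len (v \<otimes> s) = len v + 1" using down_prefix_ascent[OF c v s(1)] s(2) by (simp add: c'_def)
  have neg: "\<rho> (inv y) (\<alpha> s) \<notin> rs.P"
  proof
    assume p: "\<rho> (inv y) (\<alpha> s) \<in> rs.P"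
    have i: "inv (v \<otimes> s) = s \<otimes> inv v" using vc sc S_inv[OF s(1)] by (simp add: inv_mult_group)
    have c2: "\<rho> (inv (v \<otimes> s)) c = \<rho> s c'" using vc sc by (simp add: i c'_def rho_mult)
    have y2: "inv (v \<otimes> s) \<otimes> w = s \<otimes> y" using vc sc w by (simp add: i y_def m_assoc)
    have "len (s \<otimes> y) = len y + 1" using len_increases_left_iff[OF y s(1)] len_S_mult[OF y s(1)] p by linarith
    then have "down_prefix c w (v \<otimes> s)"
      unfolding down_prefix_def c2 y2 using short_push[OF y sh s(1) p s(3)] asc lv dv s(2) vc sc by simp
    then show False using max[of "v \<otimes> s"] asc by simp
  qed
  have vP: "\<rho> v (\<alpha> s) \<in> rs.P" using len_increases_iff[OF vc s(1)] asc by simp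
  have notP: "rs.refl c' (\<alpha> s) \<notin> rs.P"
  proof
    assume p: "rs.refl c' (\<alpha> s) \<in> rs.P"
    have pos: "2 * B c' (\<alpha> s) > 0" using s(3) symmetric_B[of "\<alpha> s" c'] by simp
    have "(2 * B c' (\<alpha> s)) *\<^sub>R c' \<in> Cone" using pos rs.P_K[OF c'P] by (intro Cone_scale) auto
    moreover have "(2 * B c' (\<alpha> s)) *\<^sub>R c' + rs.refl c' (\<alpha> s) = 1 *\<^sub>R \<alpha> s" by (simp add: rs.refl_def)
    ultimately obtain k where "(2 * B c' (\<alpha> s)) *\<^sub>R c' = k *\<^sub>R \<alpha> s" using simple_extreme[OF _ rs.P_K[OF p] s(1)] by blast
    then have "(2 * B c' (\<alpha> s)) *\<^sub>R c' + (- k) *\<^sub>R \<alpha> s = 0" by simp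
    then have "2 * B c' (\<alpha> s) = 0" using rs.P_independent[OF c'P simple_P[OF s(1)] ne] by blast
    then show False using pos by simp
  qed
  have "\<rho> (inv y) (rs.refl c' (\<alpha> s)) \<notin> rs.P"
    using short_pairs[OF y sh simple_P[OF s(1)] neg _ notP] ne by blast
  then have eP: "- \<rho> (inv y) (rs.refl c' (\<alpha> s)) \<in> rs.P"
    using rho_minus_P[OF yc rs.refl_R[OF c'R simple_roots[OF s(1)]]] by blast
  have "rs.nonsmall (- \<rho> (inv y) (\<alpha> s))"
  proof (rule nonsmall_transfer_short[OF y sh s(1) neg ne _ _ _ _ eP])
    show "rs.nonsmall (- \<rho> (inv y) c')" using ns yw by simp
    show "2 * B c' (\<alpha> s) > 0" using s(3) symmetric_B[of "\<alpha> s" c'] by simp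
    show "(1::real) > 0" by simp
    show "- \<rho> (inv y) (\<alpha> s) = (2 * B c' (\<alpha> s)) *\<^sub>R (- \<rho> (inv y) c') + 1 *\<^sub>R (- \<rho> (inv y) (rs.refl c' (\<alpha> s)))"
      by (simp add: rs.refl_def rho_diff[OF yc] rho_scale[OF yc])
  qed
  then show ?thesis
    using nonsmall_pull[OF w v c s(1) vP] neg depth_not_simple[OF c'P] nsimp by (simp add: y_def c'_def)
qed

text \<open>The prefix has run into a simple root, so part of it is undone: take the shortest
  \<open>u\<close> at which the image of \<open>c\<close> lies in the span of two simple roots and
  has depth at least 2. Neither of the two generators shortens \<open>u\<close>. Exactly one of the
  two simple roots is inverted: both contradict \<open>short_extreme\<close>, and neither would
  leave the image itself not inverted.\<close>

lemma nonsmall_chain_simple: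
  assumes w: "w \<in> carrier W" and c: "c \<in> roots" and v: "down_prefix c w v"
    and ns: "rs.nonsmall (- \<rho> (inv w) c)" and simp_v: "\<rho> (inv v) c \<in> \<alpha> ` S" and nsimp: "c \<notin> \<alpha> ` S"
  shows "\<exists>a. short a w \<and> depth a < depth c \<and> rs.nonsmall (- \<rho> (inv w) a)"
proof -
  define V where "V u \<longleftrightarrow> down_prefix c w u \<and> depth (\<rho> (inv u) c) \<ge> 2 \<and>
    (\<exists>p q a b. p \<in> S \<and> q \<in> S \<and> p \<noteq> q \<and> \<rho> (inv u) c = a *\<^sub>R \<alpha> p + b *\<^sub>R \<alpha> q)" for u
  obtain q where q: "q \<in> S" "\<rho> (inv v) c = \<alpha> q" using simp_v by blast
  have vc: "v \<in> carrier W" using v by (simp add: down_prefix_def)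
  have "v \<noteq> \<one>" using nsimp simp_v by (auto simp: rho_one)
  then obtain p where p: "p \<in> S" "len (v \<otimes> p) < len v" using right_descent_exists[OF vc] by blast
  have pc: "p \<in> carrier W" using p S_carrier by blast
  note sh = down_prefix_shorten[OF w c v p]
  have i: "inv (v \<otimes> p) = p \<otimes> inv v" using vc pc S_inv[OF p(1)] by (simp add: inv_mult_group)
  have e: "\<rho> (inv (v \<otimes> p)) c = 1 *\<^sub>R \<alpha> q + (- 2 * B (\<alpha> p) (\<alpha> q)) *\<^sub>R \<alpha> p"
    using vc pc q simple_reflection[OF p(1)] by (simp add: i rho_mult)
  have d2: "depth (\<rho> (inv (v \<otimes> p)) c) = 2" using sh(2) depth_simple[OF q(1)] unfolding q(2) by simp
  have "p \<noteq> q"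
  proof
    assume "p = q"
    then have "\<rho> (inv (v \<otimes> p)) c = - \<alpha> q" unfolding i using vc pc q simple_reflection_self[OF q(1)] by (simp add: rho_mult)
    then have "depth (- \<alpha> q) > 0" using d2 by simp
    then show False
      using depth_pos_iff[of "- \<alpha> q"] rs.neg_R[OF simple_roots[OF q(1)]] rs.P_neg[OF simple_P[OF q(1)]] by blast
  qed
  then have "V (v \<otimes> p)" unfolding V_def using sh(1) d2 e p(1) q(1) by (metis order_refl)
  then obtain u where u: "V u" and umin: "\<And>u'. V u' \<Longrightarrow> len u \<le> len u'"
    using ex_has_least_nat[of V "v \<otimes> p" len] by blast
  have dpu: "down_prefix c w u" and du: "depth (\<rho> (inv u) c) \<ge> 2" using u by (simp_all add: V_def)
  have uc: "u \<in> carrier W" using dpu by (simp add: down_prefix_def)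
  define y e where "y = inv u \<otimes> w" and "e = \<rho> (inv u) c"
  have y: "y \<in> carrier W" and yc: "inv y \<in> carrier W" using uc w by (simp_all add: y_def)
  have se: "short e y" using dpu by (simp add: down_prefix_def e_def y_def)
  have eP: "e \<in> rs.P" using short_P[OF se] .
  have eR: "e \<in> roots" using eP rs.P_R by blast
  have yw: "\<rho> (inv y) e = \<rho> (inv w) c" using uc w by (simp add: y_def e_def inv_mult_group rho_mult rho_inv')
  have not_simple: "e \<noteq> \<alpha> r" if "r \<in> S" for r using du depth_simple[OF that] by (auto simp: e_def)
  have asc: "\<rho> u (\<alpha> p) \<in> rs.P" if "p \<in> S" "q \<in> S" "p \<noteq> q" "e = a *\<^sub>R \<alpha> p + b *\<^sub>R \<alpha> q" for p q a b
  proof (rule ccontr)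
    assume "\<rho> u (\<alpha> p) \<notin> rs.P"
    then have len: "len (u \<otimes> p) < len u" using len_increases_iff[OF uc that(1)] len_mult_S[OF uc that(1)] by linarith
    have pc: "p \<in> carrier W" using that S_carrier by blast
    note sh = down_prefix_shorten[OF w c dpu that(1) len]
    have i: "inv (u \<otimes> p) = p \<otimes> inv u" using uc pc S_inv[OF that(1)] by (simp add: inv_mult_group)
    have "\<rho> (inv (u \<otimes> p)) c = \<rho> p e" using uc pc by (simp add: i e_def rho_mult)
    also have "\<dots> = (- a - 2 * b * B (\<alpha> p) (\<alpha> q)) *\<^sub>R \<alpha> p + b *\<^sub>R \<alpha> q"
      unfolding that(4) rho_simple_refl[OF that(1)] by (rule rs.refl_comb[OF simple_roots[OF that(1)]])
    finally have "V (u \<otimes> p)" unfolding V_def using sh du that by (metis Suc_leD Suc_le_mono le_SucI)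
    then show False using umin len by (meson not_le)
  qed
  have main: ?thesis if pq: "p \<in> S" "q \<in> S" "p \<noteq> q" and e_eq: "e = a *\<^sub>R \<alpha> p + b *\<^sub>R \<alpha> q" and ab: "a > 0" "b > 0"
    and neg: "\<rho> (inv y) (\<alpha> p) \<notin> rs.P" and pos: "\<rho> (inv y) (\<alpha> q) \<in> rs.P" for p q a b
  proof -
    have "rs.nonsmall (- \<rho> (inv y) (\<alpha> p))"
    proof (rule nonsmall_transfer_short[OF y se pq(1) neg not_simple[OF pq(1)] _ _ _ _ pos])
      show "rs.nonsmall (- \<rho> (inv y) e)" using ns yw by simp
      show "1 / a > 0" "b / a > 0" using ab by simp_all
      have "- \<rho> (inv y) e = - (a *\<^sub>R \<rho> (inv y) (\<alpha> p) + b *\<^sub>R \<rho> (inv y) (\<alpha> q))"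
        unfolding e_eq by (simp only: rho_add[OF yc] rho_scale[OF yc])
      then show "- \<rho> (inv y) (\<alpha> p) = (1 / a) *\<^sub>R (- \<rho> (inv y) e) + (b / a) *\<^sub>R \<rho> (inv y) (\<alpha> q)"
        using ab by (simp add: scaleR_right_diff_distrib)
    qed
    then show ?thesis using nonsmall_pull[OF w dpu c pq(1) asc[OF pq e_eq]] neg du by (simp add: y_def)
  qed
  obtain p q a b where pq: "p \<in> S" "q \<in> S" "p \<noteq> q" and e_eq: "e = a *\<^sub>R \<alpha> p + b *\<^sub>R \<alpha> q"
    using u by (auto simp: V_def e_def)
  have e_eq': "e = b *\<^sub>R \<alpha> q + a *\<^sub>R \<alpha> p" using e_eq by (simp add: add.commute)
  have ne: "\<alpha> p \<noteq> \<alpha> q" using simple_inj pq by blast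
  have eK: "a *\<^sub>R \<alpha> p + b *\<^sub>R \<alpha> q \<in> Cone" using rs.P_K[OF eP] unfolding e_eq .
  have eK': "b *\<^sub>R \<alpha> q + a *\<^sub>R \<alpha> p \<in> Cone" using rs.P_K[OF eP] unfolding e_eq' .
  have a0: "a \<ge> 0" using simple_pair_coefficients[OF pq(1,2) ne eK] .
  have b0: "b \<ge> 0" using simple_pair_coefficients[OF pq(2,1) ne[symmetric] eK'] .
  have "a \<noteq> 0"
  proof
    assume "a = 0"
    then have "e = b *\<^sub>R \<alpha> q" using e_eq by simp
    then show False using root_multiple_simple[OF eR pq(2) _ b0] not_simple[OF pq(2)] by blast
  qed
  then have a: "a > 0" using a0 by simp
  have "b \<noteq> 0"
  proof
    assume "b = 0"
    then have "e = a *\<^sub>R \<alpha> p" using e_eq by simp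
    then show False using root_multiple_simple[OF eR pq(1) _ a0] not_simple[OF pq(1)] by blast
  qed
  then have b: "b > 0" using b0 by simp
  consider "\<rho> (inv y) (\<alpha> p) \<notin> rs.P" "\<rho> (inv y) (\<alpha> q) \<in> rs.P" | "\<rho> (inv y) (\<alpha> q) \<notin> rs.P" "\<rho> (inv y) (\<alpha> p) \<in> rs.P"
    | "\<rho> (inv y) (\<alpha> p) \<notin> rs.P" "\<rho> (inv y) (\<alpha> q) \<notin> rs.P" | "\<rho> (inv y) (\<alpha> p) \<in> rs.P" "\<rho> (inv y) (\<alpha> q) \<in> rs.P" by blast
  then show ?thesis
  proof cases
    case 1
    then show ?thesis by (rule main[OF pq e_eq a b])
  next
    case 2
    then show ?thesis by (rule main[OF pq(2,1) pq(3)[symmetric] e_eq' b a])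
  next
    case 3
    then show ?thesis
      using short_extreme[OF y se a b simple_P[OF pq(1)] _ simple_P[OF pq(2)] _ e_eq] not_simple[OF pq(1)] by metis
  next
    case 4
    have "\<rho> (inv y) e = a *\<^sub>R \<rho> (inv y) (\<alpha> p) + b *\<^sub>R \<rho> (inv y) (\<alpha> q)"
      unfolding e_eq by (simp only: rho_add[OF yc] rho_scale[OF yc])
    also have "\<dots> \<in> Cone" using 4 a b rs.P_K by (intro Cone_add Cone_scale) auto
    finally show ?thesis using short_neg[OF y se] rho_roots[OF yc eR] by (simp add: rs.P_def)
  qed
qed

lemma nonsmall_chain:
  assumes w: "w \<in> carrier W" and c: "short c w" "c \<notin> \<alpha> ` S" and ns: "rs.nonsmall (- \<rho> (inv w) c)"
  shows "\<exists>a. short a w \<and> depth a < depth c \<and> rs.nonsmall (- \<rho> (inv w) a)"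
proof -
  have cR: "c \<in> roots" using short_P[OF c(1)] rs.P_R by blast
  have "down_prefix c w \<one>" using c(1) w by (simp add: down_prefix_def rho_one len_one)
  moreover have "len u < Suc (depth c)" if "down_prefix c w u" for u using that by (simp add: down_prefix_def)
  ultimately obtain v where v: "down_prefix c w v" and max: "\<And>u. down_prefix c w u \<Longrightarrow> len u \<le> len v"
    using ex_has_greatest_nat[of "down_prefix c w" \<one> len "Suc (depth c)"] by blast
  show ?thesis
  proof (cases "\<rho> (inv v) c \<in> \<alpha> ` S")
    case True
    show ?thesis by (rule nonsmall_chain_simple[OF w cR v ns True c(2)])
  next
    case False
    show ?thesis by (rule nonsmall_chain_away[OF w cR v max ns False])
  qed
qed

lemma nonsmall_simple_exists:
  assumes w: "w \<in> carrier W" and c: "short c w" and ns: "rs.nonsmall (- \<rho> (inv w) c)"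
  shows "\<exists>r \<in> S. \<rho> (inv w) (\<alpha> r) \<notin> rs.P \<and> rs.nonsmall (- \<rho> (inv w) (\<alpha> r))"
  using c ns
proof (induction "depth c" arbitrary: c rule: less_induct)
  case less
  show ?case
  proof (cases "c \<in> \<alpha> ` S")
    case True
    then show ?thesis using less.prems short_neg[OF w] by blast
  next
    case False
    then show ?thesis using nonsmall_chain[OF w less.prems(1) False less.prems(2)] less.hyps by blast
  qed
qed

text \<open>The depth argument produces left descents, so it is applied to \<open>inv x\<close> and
  the short inversion \<open>- \<rho> (inv x) b\<close> of it.\<close>

lemma nonsmall_descent:
  assumes x: "x \<in> carrier W" and b: "short b x" and ns: "rs.nonsmall b"
  obtains r where "r \<in> S" "\<rho> x (\<alpha> r) \<notin> rs.P" "rs.nonsmall (- \<rho> x (\<alpha> r))"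
proof -
  have "- \<rho> (inv (inv x)) (- \<rho> (inv x) b) = b" using x by (simp add: rho_minus rho_inv')
  then show ?thesis
    using nonsmall_simple_exists[OF inv_closed[OF x] short_inverse[OF x b]] ns that x by auto
qed

section \<open>Low elements and boundary roots\<close>

lemma inversions_iff: "x \<in> carrier W \<Longrightarrow> r \<in> rs.P \<Longrightarrow> r \<in> inversions x \<longleftrightarrow> \<rho> (inv x) r \<notin> rs.P"
proof
  assume x: "x \<in> carrier W" and r: "r \<in> rs.P"
  assume "r \<in> inversions x"
  then obtain q where "q \<in> rs.P" "r = \<rho> x (- q)" unfolding inversions_def neg_roots_def pos_roots_P by blast
  then show "\<rho> (inv x) r \<notin> rs.P" using rho_inv[OF x] rs.P_neg by simp
next
  assume x: "x \<in> carrier W" and r: "r \<in> rs.P" and n: "\<rho> (inv x) r \<notin> rs.P"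
  have "- \<rho> (inv x) r \<in> rs.P" using rho_minus_P[of "inv x" r] x rs.P_R[OF r] n by blast
  then have "- (- \<rho> (inv x) r) \<in> neg_roots" unfolding neg_roots_def pos_roots_P by (rule imageI)
  then have "\<rho> x (\<rho> (inv x) r) \<in> \<rho> x ` neg_roots" by simp
  then show "r \<in> inversions x" using r unfolding inversions_def pos_roots_P rho_inv'[OF x] by blast
qed

lemma dominated_by_iff:
  assumes b: "b \<in> rs.P" and c: "c \<in> rs.P"
  shows "dominated_by c b \<longleftrightarrow> rs.dom b c"
proof
  assume d: "dominated_by c b"
  show "rs.dom b c" unfolding rs.dom_def
  proof (intro ballI impI)
    fix g assume g: "g \<in> \<rho> ` carrier W" and n: "g b \<notin> rs.P"
    obtain w where w: "w \<in> carrier W" "g = \<rho> w" using g by blast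
    have i: "inv w \<in> carrier W" using w by simp
    have "b \<in> inversions (inv w)" using inversions_iff[OF i b] n w by simp
    then have "c \<in> inversions (inv w)" using d i by (simp add: dominated_by_def)
    then show "g c \<notin> rs.P" using inversions_iff[OF i c] w by simp
  qed
next
  assume d: "rs.dom b c"
  show "dominated_by c b" unfolding dominated_by_def
  proof (intro ballI impI)
    fix x assume x: "x \<in> carrier W" and "b \<in> inversions x"
    then have "\<rho> (inv x) b \<notin> rs.P" using inversions_iff[OF x b] by blast
    then have "\<rho> (inv x) c \<notin> rs.P" using rs.domD[OF d, of "\<rho> (inv x)"] x by blast
    then show "c \<in> inversions x" using inversions_iff[OF x c] by blast
  qed
qed

lemma small_roots_0_iff: "b \<in> small_roots 0 \<longleftrightarrow> b \<in> rs.P \<and> \<not> rs.nonsmall b"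
proof (cases "b \<in> rs.P")
  case True
  define D where "D = {c \<in> rs.P - {b}. dominated_by c b}"
  have "inf_depth b \<le> enat 0 \<longleftrightarrow> D = {}"
    unfolding inf_depth_def pos_roots_P D_def[symmetric] Let_def by (auto simp: enat_ord_simps)
  also have "\<dots> \<longleftrightarrow> \<not> rs.nonsmall b"
    using dominated_by_iff[OF True] by (auto simp: D_def rs.nonsmall_def)
  finally show ?thesis using True by (simp add: small_roots_def pos_roots_P)
next
  case False
  then show ?thesis by (simp add: small_roots_def pos_roots_P)
qed

lemma low_elements_0_iff: "x \<in> low_elements 0 \<longleftrightarrow> x \<in> carrier W \<and> (\<forall>b. short b x \<longrightarrow> \<not> rs.nonsmall b)"
  using short_P by (auto simp: low_elements_def subset_iff short_inversions_iff small_roots_0_iff)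

lemma one_low: "\<one> \<in> low_elements 0"
  by (simp add: low_elements_0_iff short_def len_one)

lemma low_carrier: "x \<in> low_elements 0 \<Longrightarrow> x \<in> carrier W"
  by (simp add: low_elements_0_iff)

lemma simple_not_nonsmall:
  assumes "s \<in> S" shows "\<not> rs.nonsmall (\<alpha> s)"
proof
  assume "rs.nonsmall (\<alpha> s)"
  then obtain d where d: "d \<in> rs.P" "d \<noteq> \<alpha> s" "rs.dom (\<alpha> s) d" unfolding rs.nonsmall_def by blast
  have "\<rho> s (\<alpha> s) \<notin> rs.P" using simple_reflection_self[OF assms] rs.P_neg[OF simple_P[OF assms]] by simp
  then have "\<rho> s d \<notin> rs.P" using rs.domD[OF d(3), of "\<rho> s"] S_carrier[OF assms] by blast
  then show False using simple_permutes_P[OF assms] d by blast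
qed

lemma simple_rho_twice: "s \<in> S \<Longrightarrow> \<rho> s (\<rho> s v) = v"
  using rho_simple_refl rs.refl_refl simple_roots by simp

text \<open>Any dominated root other than \<open>\<alpha> s\<close> stays positive under
  \<open>\<rho> s\<close> and would be dominated by \<open>c\<close>.\<close>

lemma nonsmall_simple_dom:
  assumes s: "s \<in> S" and c: "\<not> rs.nonsmall c" and ns: "rs.nonsmall (\<rho> s c)"
  shows "rs.dom (\<rho> s c) (\<alpha> s)"
proof -
  obtain d where d: "d \<in> rs.P" "d \<noteq> \<rho> s c" "rs.dom (\<rho> s c) d" using ns unfolding rs.nonsmall_def by blast
  have "d = \<alpha> s"
  proof (rule ccontr)
    assume "d \<noteq> \<alpha> s"
    then have dP: "\<rho> s d \<in> rs.P" using simple_permutes_P[OF s] d by blast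
    have "\<rho> s \<in> \<rho> ` carrier W" using S_carrier[OF s] by blast
    then have "rs.dom (\<rho> s (\<rho> s c)) (\<rho> s d)" by (rule rs.dom_M[OF d(3)])
    then have "rs.dom c (\<rho> s d)" unfolding simple_rho_twice[OF s] .
    moreover have "\<rho> s d \<noteq> c" using d(2) simple_rho_twice[OF s, of d] by auto
    ultimately show False using c dP unfolding rs.nonsmall_def by blast
  qed
  then show ?thesis using d(3) by simp
qed

lemma short_right_simple:
  assumes x: "x \<in> carrier W" and r: "r \<in> S" "\<rho> x (\<alpha> r) \<notin> rs.P"
  shows "short (- \<rho> x (\<alpha> r)) x"
  using short_inverse[of "inv x" "\<alpha> r"] short_simple[of "inv x" r] assms by simp

lemma nonsmall_right_simple:
  assumes "x \<in> carrier W" "x \<notin> low_elements 0"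
  obtains r where "r \<in> S" "\<rho> x (\<alpha> r) \<notin> rs.P" "rs.nonsmall (- \<rho> x (\<alpha> r))"
  using assms nonsmall_descent by (auto simp: low_elements_0_iff)

text \<open>If \<open>y\<close> is not low, it has a right descent with a non-small root
  \<open>c\<close>. Both \<open>c\<close> and a root \<open>d\<close> dominated by it are inverted
  by \<open>\<rho> (inv y)\<close>, hence differ from \<open>\<alpha> s\<close> and stay positive
  under \<open>\<rho> s\<close>. So \<open>\<rho> s c\<close> is a non-small short inversion of
  \<open>s \<otimes> y\<close>.\<close>

lemma low_suffix:
  assumes y: "y \<in> carrier W" and s: "s \<in> S" "len (s \<otimes> y) > len y" and low: "s \<otimes> y \<in> low_elements 0"
  shows "y \<in> low_elements 0"
proof (rule ccontr)
  assume "y \<notin> low_elements 0"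
  then obtain r where r: "r \<in> S" "\<rho> y (\<alpha> r) \<notin> rs.P" "rs.nonsmall (- \<rho> y (\<alpha> r))"
    using nonsmall_right_simple y by blast
  define c where "c = - \<rho> y (\<alpha> r)"
  have sc: "s \<in> carrier W" using s S_carrier by blast
  have yc: "inv y \<in> carrier W" using y by simp
  have sP: "\<rho> (inv y) (\<alpha> s) \<in> rs.P" using len_increases_left_iff[OF y s(1)] s(2) by blast
  have cP: "c \<in> rs.P" unfolding c_def using rho_minus_P[OF y simple_roots[OF r(1)]] r(2) by blast
  have cn: "\<rho> (inv y) c \<notin> rs.P"
    unfolding c_def rho_minus[OF yc] rho_inv[OF y] by (rule rs.P_neg[OF simple_P[OF r(1)]])
  have "rs.nonsmall c" using r(3) by (simp add: c_def)
  then obtain d where d: "d \<in> rs.P" "d \<noteq> c" "rs.dom c d" unfolding rs.nonsmall_def by blast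
  have "\<rho> (inv y) d \<notin> rs.P" using rs.domD[OF d(3), of "\<rho> (inv y)"] yc cn by blast
  then have dP: "\<rho> s d \<in> rs.P" using simple_permutes_P[OF s(1) d(1)] sP by blast
  have scP: "\<rho> s c \<in> rs.P" using simple_permutes_P[OF s(1) cP] sP cn by blast
  have "\<rho> s \<in> \<rho> ` carrier W" using sc by blast
  then have "rs.dom (\<rho> s c) (\<rho> s d)" by (rule rs.dom_M[OF d(3)])
  moreover have "\<rho> s d \<noteq> \<rho> s c" using d(2) simple_rho_twice[OF s(1)] by metis
  ultimately have nsc: "rs.nonsmall (\<rho> s c)" using dP unfolding rs.nonsmall_def by blast
  have e: "\<rho> s c = - \<rho> (s \<otimes> y) (\<alpha> r)" by (simp add: c_def rho_mult[OF sc y] rho_minus[OF sc])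
  have "\<rho> (s \<otimes> y) (\<alpha> r) \<notin> rs.P"
    using rho_minus_P[of "s \<otimes> y" "\<alpha> r"] scP sc y simple_roots[OF r(1)] unfolding e by blast
  then have "short (\<rho> s c) (s \<otimes> y)" unfolding e using short_right_simple r(1) sc y by simp
  then show False using nsc low by (simp add: low_elements_0_iff)
qed

lemma low_exit_ascent:
  assumes y: "y \<in> low_elements 0" and s: "s \<in> S" "s \<otimes> y \<notin> low_elements 0"
  shows "len (s \<otimes> y) > len y"
proof (rule ccontr)
  have yc: "y \<in> carrier W" using low_carrier[OF y] .
  assume "\<not> ?thesis"
  then have "len (s \<otimes> (s \<otimes> y)) > len (s \<otimes> y)"
    using len_S_mult[OF yc s(1)] S_cancel[OF s(1) yc] by simp
  then show False
    using low_suffix[of "s \<otimes> y" s] s y yc S_cancel[OF s(1) yc] S_carrier[OF s(1)] by simp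
qed

lemma left_descent_exists:
  assumes "w \<in> carrier W" "w \<noteq> \<one>"
  obtains s where "s \<in> S" "len (s \<otimes> w) < len w"
proof -
  have "inv w \<noteq> \<one>" using assms by (metis inv_inv inv_one)
  then obtain s where s: "s \<in> S" "len (inv w \<otimes> s) < len (inv w)" using right_descent_exists[of "inv w"] assms by auto
  have "inv w \<otimes> s = inv (s \<otimes> w)" using assms s S_carrier[OF s(1)] S_inv[OF s(1)] by (simp add: inv_mult_group)
  then show ?thesis using that[OF s(1)] s assms len_inv[of w] len_inv[of "s \<otimes> w"] S_carrier[OF s(1)] by simp
qed

text \<open>Strip letters from the left: the suffixes stay low, and \<open>b\<close> changes sign at
  one of the letters.\<close>

lemma low_inverted_root:
  assumes "x \<in> low_elements 0" "b \<in> rs.P" "\<rho> x b \<notin> rs.P"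
  shows "\<exists>z \<in> carrier W. \<exists>t \<in> S. t \<otimes> z \<in> low_elements 0 \<and> \<rho> z b = \<alpha> t"
  using assms
proof (induction "len x" arbitrary: x rule: less_induct)
  case less
  have x: "x \<in> carrier W" using low_carrier[OF less.prems(1)] .
  have "x \<noteq> \<one>" using less.prems(2,3) rho_one[of b] by metis
  then obtain s where s: "s \<in> S" "len (s \<otimes> x) < len x" using left_descent_exists x by blast
  have sc: "s \<in> carrier W" using s S_carrier by blast
  define z where "z = s \<otimes> x"
  have z: "z \<in> carrier W" "s \<otimes> z = x" using sc x S_cancel[OF s(1) x] by (simp_all add: z_def)
  have lz: "len z < len x" using s(2) by (simp add: z_def)
  have zl: "z \<in> low_elements 0" using low_suffix[OF z(1) s(1)] lz less.prems(1) unfolding z(2) by blast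
  show ?case
  proof (cases "\<rho> z b \<in> rs.P")
    case False
    then show ?thesis using less.hyps[OF lz zl less.prems(2)] by blast
  next
    case True
    have "\<rho> s (\<rho> z b) \<notin> rs.P" using less.prems(3) rho_mult[OF sc z(1), of b] unfolding z(2) by simp
    then have "\<rho> z b = \<alpha> s" using simple_permutes_P[OF s(1) True] by blast
    then show ?thesis using z s(1) less.prems(1) by blast
  qed
qed

text \<open>Leaving the low elements yields a right descent \<open>r\<close> of
  \<open>s \<otimes> y\<close> and a small \<open>c\<close> with \<open>\<rho> s c\<close>
  non-small, so that \<open>\<rho> s c\<close> dominates \<open>\<alpha> s\<close>. Moved by the
  inverse of \<open>s \<otimes> y\<close> and negated, this says that \<open>b\<close> dominates
  \<open>\<alpha> r\<close>. If a low element inverts \<open>b\<close>, there is a low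
  \<open>t \<otimes> z\<close> with \<open>\<rho> z b = \<alpha> t\<close>; moved there, the
  dominance gives a short inversion \<open>h\<close> of \<open>t \<otimes> z\<close> that dominates
  \<open>\<alpha> t\<close>, so \<open>h\<close> is not small.\<close>

lemma boundary_root_positive:
  assumes x: "x \<in> low_elements 0" and y: "y \<in> low_elements 0" and s: "s \<in> S" "s \<otimes> y \<notin> low_elements 0"
  shows "\<rho> x (\<rho> (inv y) (\<alpha> s)) \<in> rs.P"
proof (rule ccontr)
  have yc: "y \<in> carrier W" using low_carrier[OF y] .
  have sc: "s \<in> carrier W" using s S_carrier by blast
  define b where "b = \<rho> (inv y) (\<alpha> s)"
  have bP: "b \<in> rs.P" unfolding b_def using len_increases_left_iff[OF yc s(1)] low_exit_ascent[OF y s] by blast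
  have yb: "\<rho> y b = \<alpha> s" unfolding b_def by (rule rho_inv'[OF yc])
  obtain r where r: "r \<in> S" "\<rho> (s \<otimes> y) (\<alpha> r) \<notin> rs.P" "rs.nonsmall (- \<rho> (s \<otimes> y) (\<alpha> r))"
    using nonsmall_right_simple[of "s \<otimes> y"] s(2) sc yc by auto
  define c where "c = - \<rho> y (\<alpha> r)"
  have e: "\<rho> s c = - \<rho> (s \<otimes> y) (\<alpha> r)" by (simp add: c_def rho_mult[OF sc yc] rho_minus[OF sc])
  have nsc: "rs.nonsmall (\<rho> s c)" using r(3) unfolding e .
  have scn: "\<rho> s (\<rho> y (\<alpha> r)) \<notin> rs.P" using r(2) by (simp add: rho_mult[OF sc yc])
  have neg: "\<rho> y (\<alpha> r) \<notin> rs.P"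
  proof
    assume p: "\<rho> y (\<alpha> r) \<in> rs.P"
    then have "\<rho> y (\<alpha> r) = \<alpha> s" using simple_permutes_P[OF s(1) p] scn by blast
    then have "\<rho> s c = \<alpha> s" unfolding c_def using simple_reflection_self[OF s(1)] by (simp add: rho_minus[OF sc])
    then show False using nsc simple_not_nonsmall[OF s(1)] by simp
  qed
  have cP: "c \<in> rs.P" unfolding c_def using rho_minus_P[OF yc simple_roots[OF r(1)]] neg by blast
  have "short c y" unfolding c_def by (rule short_right_simple[OF yc r(1) neg])
  then have "\<not> rs.nonsmall c" using y by (simp add: low_elements_0_iff)
  then have d: "rs.dom (\<rho> s c) (\<alpha> s)" using nonsmall_simple_dom[OF s(1) _ nsc] by blast
  have "\<rho> (inv (s \<otimes> y)) \<in> \<rho> ` carrier W" using sc yc by simp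
  then have "rs.dom (\<rho> (inv (s \<otimes> y)) (\<rho> s c)) (\<rho> (inv (s \<otimes> y)) (\<alpha> s))" by (rule rs.dom_M[OF d])
  moreover have "\<rho> (inv (s \<otimes> y)) (\<rho> s c) = - \<alpha> r"
    unfolding e using rho_inv[of "s \<otimes> y" "\<alpha> r"] sc yc by (simp add: rho_minus)
  moreover have "\<rho> (inv (s \<otimes> y)) (\<alpha> s) = - b"
    using sc yc simple_reflection_self[OF s(1)] S_inv[OF s(1)] by (simp add: inv_mult_group rho_mult rho_minus b_def)
  ultimately have "rs.dom (- \<alpha> r) (- b)" by (simp only:)
  then have "rs.dom (- (- b)) (- (- \<alpha> r))"
    by (rule rs.dom_minus) (use rs.neg_R simple_roots[OF r(1)] rs.P_R[OF bP] in blast)+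
  then have dom: "rs.dom b (\<alpha> r)" by simp
  have br: "b \<noteq> \<alpha> r"
  proof
    assume "b = \<alpha> r"
    then have "c = - \<alpha> s" using yb by (simp add: c_def)
    then show False using cP rs.P_neg[OF simple_P[OF s(1)]] by simp
  qed
  assume "\<rho> x (\<rho> (inv y) (\<alpha> s)) \<notin> rs.P"
  then obtain z t where z: "z \<in> carrier W" "t \<in> S" "t \<otimes> z \<in> low_elements 0" "\<rho> z b = \<alpha> t"
    using low_inverted_root[OF x bP] unfolding b_def by blast
  have tz: "t \<otimes> z \<in> carrier W" using low_carrier[OF z(3)] .
  define h where "h = - \<rho> (t \<otimes> z) (\<alpha> r)"
  have tb: "\<rho> (t \<otimes> z) b = - \<alpha> t"
    using z S_carrier[OF z(2)] simple_reflection_self[OF z(2)] by (simp add: rho_mult)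
  have M: "\<rho> (t \<otimes> z) \<in> \<rho> ` carrier W" using tz by blast
  have "\<rho> (t \<otimes> z) b \<notin> rs.P" unfolding tb by (rule rs.P_neg[OF simple_P[OF z(2)]])
  then have n: "\<rho> (t \<otimes> z) (\<alpha> r) \<notin> rs.P" by (rule rs.domD[OF dom M])
  have hP: "h \<in> rs.P" unfolding h_def using rho_minus_P[OF tz simple_roots[OF r(1)]] n by blast
  have small: "\<not> rs.nonsmall h"
    using short_right_simple[OF tz r(1) n] z(3) unfolding h_def by (simp add: low_elements_0_iff)
  have "rs.dom (- \<alpha> t) (- h)" using rs.dom_M[OF dom M] unfolding tb by (simp add: h_def)
  then have "rs.dom (- (- h)) (- (- \<alpha> t))"
    by (rule rs.dom_minus) (use rs.neg_R simple_roots[OF z(2)] rs.P_R[OF hP] in blast)+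
  then have "rs.dom h (\<alpha> t)" by simp
  moreover have "h \<noteq> \<alpha> t"
  proof
    assume "h = \<alpha> t"
    then have "\<rho> (t \<otimes> z) (\<alpha> r) = \<rho> (t \<otimes> z) b" unfolding tb by (simp add: h_def minus_equation_iff)
    then have "\<rho> (inv (t \<otimes> z)) (\<rho> (t \<otimes> z) (\<alpha> r)) = \<rho> (inv (t \<otimes> z)) (\<rho> (t \<otimes> z) b)" by (simp only:)
    then show False using br unfolding rho_inv[OF tz] by simp
  qed
  ultimately show False using rs.nonsmall_dom[of h "\<alpha> t"] hP simple_P[OF z(2)] small by blast
qed

text \<open>Strip letters from the left until a low suffix is reached; the letter just removed gives
  the boundary root. Putting letters back cannot undo the inversion, as \<open>s\<close> turns only
  \<open>- \<alpha> s\<close> positive and \<open>\<rho> (inv z) (\<alpha> s)\<close> is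
  positive.\<close>

lemma boundary_root_separates:
  assumes "x \<in> carrier W" "x \<notin> low_elements 0"
  shows "\<exists>b \<in> shi_boundary_roots 0. b \<in> rs.P \<and> \<rho> x b \<notin> rs.P"
  using assms
proof (induction "len x" arbitrary: x rule: less_induct)
  case less
  note x = less.prems(1)
  have "x \<noteq> \<one>" using less.prems(2) one_low by blast
  then obtain s where s: "s \<in> S" "len (s \<otimes> x) < len x" using left_descent_exists x by blast
  have sc: "s \<in> carrier W" using s S_carrier by blast
  define z where "z = s \<otimes> x"
  have z: "z \<in> carrier W" "s \<otimes> z = x" using sc x S_cancel[OF s(1) x] by (simp_all add: z_def)
  have lz: "len z < len x" using s(2) by (simp add: z_def)
  have sP: "\<rho> (inv z) (\<alpha> s) \<in> rs.P" using len_increases_left_iff[OF z(1) s(1)] lz unfolding z(2) by blast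
  have xz: "\<rho> x v = \<rho> s (\<rho> z v)" for v using rho_mult[OF sc z(1)] unfolding z(2) .
  show ?case
  proof (cases "z \<in> low_elements 0")
    case True
    have "\<rho> x (\<rho> (inv z) (\<alpha> s)) = - \<alpha> s"
      unfolding xz rho_inv'[OF z(1)] by (rule simple_reflection_self[OF s(1)])
    then have "\<rho> x (\<rho> (inv z) (\<alpha> s)) \<notin> rs.P" using rs.P_neg[OF simple_P[OF s(1)]] by simp
    moreover have "\<rho> (inv z) (\<alpha> s) \<in> shi_boundary_roots 0"
      unfolding shi_boundary_roots_def using True s(1) z(2) less.prems(2) by blast
    ultimately show ?thesis using sP by blast
  next
    case False
    obtain b where b: "b \<in> shi_boundary_roots 0" "b \<in> rs.P" "\<rho> z b \<notin> rs.P"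
      using less.hyps[OF lz z(1) False] by blast
    have "\<rho> x b \<notin> rs.P"
    proof
      assume p: "\<rho> x b \<in> rs.P"
      have m: "- \<rho> z b \<in> rs.P" using rho_minus_P[OF z(1) rs.P_R[OF b(2)]] b(3) by blast
      have "\<rho> s (- \<rho> z b) \<notin> rs.P" using rs.P_neg[OF p] unfolding xz by (simp add: rho_minus[OF sc])
      then have "- \<rho> z b = \<alpha> s" using simple_permutes_P[OF s(1) m] by blast
      then have "\<rho> (inv z) (\<alpha> s) = - b" using z(1) by (metis inv_closed rho_inv rho_minus)
      then show False using sP rs.P_neg[OF b(2)] by simp
    qed
    then show ?thesis using b by blast
  qed
qed

text \<open>The sign of \<open>e\<close> changes at one of the factors of \<open>v\<close>. At a
  generator the root there is simple, and conjugation brings its reflection back inside the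
  subgroup.\<close>

lemma parabolic_reflection:
  assumes J: "J \<subseteq> S" and v: "v \<in> generate W J"
  shows "e \<in> rs.P \<Longrightarrow> \<rho> (inv v) e \<notin> rs.P \<Longrightarrow> root_reflection e \<in> generate W J"
  using v
proof (induction v arbitrary: e rule: generate.induct)
  case one
  then show ?case by (simp add: rho_one)
next
  case (incl h)
  have h: "h \<in> S" using incl J by blast
  have "e = \<alpha> h" using simple_permutes_P[OF h incl(2)] incl(3) unfolding S_inv[OF h] by blast
  then show ?case using root_reflection_simple[OF h] generate.incl[OF incl(1)] by simp
next
  case (inv h)
  have h: "h \<in> S" using inv J by blast
  have "e = \<alpha> h" using simple_permutes_P[OF h inv(2)] inv(3) unfolding S_inv[OF h] by blast
  then show ?case using root_reflection_simple[OF h] generate.incl[OF inv(1)] by simp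
next
  case (eng g h)
  have JW: "J \<subseteq> carrier W" using J S_subset by blast
  have gc: "g \<in> carrier W" and hc: "h \<in> carrier W" using eng(1,2) generate_in_carrier[OF JW] by blast+
  show ?case
  proof (cases "\<rho> (inv g) e \<in> rs.P")
    case False
    then show ?thesis using eng by blast
  next
    case True
    have "\<rho> (inv h) (\<rho> (inv g) e) \<notin> rs.P" using eng(6) gc hc by (simp add: inv_mult_group rho_mult)
    then have t: "root_reflection (\<rho> (inv g) e) \<in> generate W J" using eng(4) True by blast
    have "root_reflection e = g \<otimes> root_reflection (\<rho> (inv g) e) \<otimes> inv g"
      using root_reflection_rho[OF gc rs.P_R[OF True]] unfolding rho_inv'[OF gc] .
    then show ?thesis
      using generate.eng[OF generate.eng[OF eng(1) t] generate_m_inv_closed[OF JW eng(1)]] by simp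
  qed
qed

end

section \<open>Orbits, stabilizers and chambers\<close>

context geometric_chambered_set
begin

lemma phi_mult: "u \<in> carrier W \<Longrightarrow> w \<in> carrier W \<Longrightarrow> p \<in> U \<Longrightarrow> \<phi> (u \<otimes> w) p = \<phi> u (\<phi> w p)"
  using U_action.composition_rule by blast

lemma phi_one: "p \<in> U \<Longrightarrow> \<phi> \<one> p = p"
  using U_action.id_eq_one by (metis restrict_apply)

lemma phi_closed: "w \<in> carrier W \<Longrightarrow> p \<in> U \<Longrightarrow> \<phi> w p \<in> U"
  using U_action.element_image by blast

lemma phi_inv: "w \<in> carrier W \<Longrightarrow> p \<in> U \<Longrightarrow> \<phi> (inv w) (\<phi> w p) = p"
  using phi_mult[of "inv w" w p] by (simp add: phi_one)

lemma orbit_representative: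
  assumes "p \<in> U"
  shows "\<exists>!a. a \<in> C \<and> (\<exists>w \<in> carrier W. \<phi> w a = p)"
proof -
  have "orbit W \<phi> p \<in> orbits W U \<phi>" using assms by (auto simp: orbits_def)
  then have "\<exists>!a. a \<in> C \<and> a \<in> orbit W \<phi> p" by (rule C_representatives)
  moreover have "a \<in> orbit W \<phi> p \<longleftrightarrow> (\<exists>w \<in> carrier W. \<phi> w a = p)" if "a \<in> C" for a
  proof
    assume "a \<in> orbit W \<phi> p"
    then obtain w where "w \<in> carrier W" "a = \<phi> w p" by (auto simp: orbit_def)
    then show "\<exists>w \<in> carrier W. \<phi> w a = p" using phi_inv[OF _ assms] by (intro bexI[of _ "inv w"]) auto
  next
    assume "\<exists>w \<in> carrier W. \<phi> w a = p"
    then obtain w where w: "w \<in> carrier W" "\<phi> w a = p" by blast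
    then have "a = \<phi> (inv w) p" using phi_inv[of w a] that C_subset by auto
    then show "a \<in> orbit W \<phi> p" using w(1) by (auto simp: orbit_def)
  qed
  ultimately show ?thesis by metis
qed

theorem shi_polyhedron_0: "shi_polyhedron 0 = (\<Union>w \<in> low_elements 0. chamber (inv w))"
proof (intro equalityI subsetI)
  fix p assume "p \<in> (\<Union>w \<in> low_elements 0. chamber (inv w))"
  then obtain x where x: "x \<in> low_elements 0" "p \<in> chamber (inv x)" by blast
  have xc: "x \<in> carrier W" using low_carrier[OF x(1)] .
  have "p \<in> half_space b" if "b \<in> shi_boundary_roots 0" for b
  proof -
    have "\<rho> x b \<in> rs.P" using that boundary_root_positive[OF x(1)] unfolding shi_boundary_roots_def by blast
    then have "\<rho> (inv (inv x)) b \<in> pos_roots" using xc by (simp add: pos_roots_P)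
    then show ?thesis unfolding half_space_def using x(2) xc by blast
  qed
  moreover have "p \<in> U" using x(2) xc C_subset phi_closed unfolding chamber_def by auto
  ultimately show "p \<in> shi_polyhedron 0" by (simp add: shi_polyhedron_def)
next
  fix p assume "p \<in> shi_polyhedron 0"
  then have pU: "p \<in> U" and half: "\<And>b. b \<in> shi_boundary_roots 0 \<Longrightarrow> p \<in> half_space b"
    by (auto simp: shi_polyhedron_def)
  obtain a where a: "a \<in> C" "\<exists>w \<in> carrier W. \<phi> w a = p"
    and uniq: "\<And>a'. a' \<in> C \<Longrightarrow> \<exists>w \<in> carrier W. \<phi> w a' = p \<Longrightarrow> a' = a"
    using orbit_representative[OF pU] by blast
  have aU: "a \<in> U" using a C_subset by blast
  define Q where "Q w \<longleftrightarrow> w \<in> carrier W \<and> \<phi> w a = p" for w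
  obtain w0 where "Q w0" using a(2) unfolding Q_def by blast
  then obtain w where "Q w" and wmin: "\<And>u. Q u \<Longrightarrow> len w \<le> len u" using ex_has_least_nat[of Q w0 len] by blast
  then have w: "w \<in> carrier W" "\<phi> w a = p" by (simp_all add: Q_def)
  have iw: "inv w \<in> carrier W" using w by simp
  have "inv w \<in> low_elements 0"
  proof (rule ccontr)
    assume "inv w \<notin> low_elements 0"
    then obtain b where b: "b \<in> shi_boundary_roots 0" "b \<in> rs.P" "\<rho> (inv w) b \<notin> rs.P"
      using boundary_root_separates[OF iw] by blast
    have bR: "b \<in> roots" using rs.P_R[OF b(2)] .
    obtain u where u: "u \<in> carrier W" "\<rho> (inv u) b \<in> rs.P" "p \<in> chamber u"
      using half[OF b(1)] unfolding half_space_def pos_roots_P by blast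
    then obtain a' where "a' \<in> C" "p = \<phi> u a'" unfolding chamber_def by blast
    \<comment> \<open>Every chamber containing \<open>p\<close> contains it as an image of the same
      representative \<open>a\<close>, so \<open>u\<close> and \<open>w\<close> differ by an element
      of the stabilizer.\<close>
    then have ua: "\<phi> u a = p" using uniq u(1) by blast
    define v where "v = inv w \<otimes> u"
    have v: "v \<in> carrier W" using w u by (simp add: v_def)
    have "\<phi> v a = a" using phi_mult[OF iw u(1) aU] phi_inv[OF w(1) aU] ua w(2) by (simp add: v_def)
    then have vs: "v \<in> stabilizer W \<phi> a" using v by (simp add: stabilizer_def)
    obtain J where J: "J \<subseteq> S" "stabilizer W \<phi> a = generate W J" using C_stabilizers[OF a(1)] by blast
    \<comment> \<open>\<open>w\<close> and \<open>u\<close> give \<open>b\<close> opposite signs;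
      seen from \<open>a\<close>, this makes \<open>e\<close> a positive root that
      \<open>inv v\<close> inverts.\<close>
    define e where "e = - \<rho> (inv w) b"
    have eP: "e \<in> rs.P" unfolding e_def using rho_minus_P[OF iw bR] b(3) by blast
    have "\<rho> (inv v) e = - \<rho> (inv u) b"
      using w u by (simp add: e_def v_def inv_mult_group rho_mult rho_minus rho_inv')
    then have "\<rho> (inv v) e \<notin> rs.P" using rs.P_neg[OF u(2)] by simp
    then have "root_reflection e \<in> stabilizer W \<phi> a"
      unfolding J(2) using parabolic_reflection[OF J(1) _ eP] vs unfolding J(2) by blast
    then have t: "root_reflection e \<in> carrier W" "\<phi> (root_reflection e) a = a" by (simp_all add: stabilizer_def)
    have re: "root_reflection e = inv w \<otimes> root_reflection b \<otimes> w"
      unfolding e_def root_reflection_minus[OF rho_roots[OF iw bR]] using root_reflection_rho[OF iw bR] w(1) by simp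
    have "w \<otimes> root_reflection e = root_reflection b \<otimes> w"
      using w(1) root_reflection(1)[OF bR] by (simp add: re m_assoc[symmetric])
    moreover have "Q (w \<otimes> root_reflection e)" unfolding Q_def using w t phi_mult[OF w(1) t(1) aU] by simp
    ultimately have "len w \<le> len (root_reflection b \<otimes> w)" using wmin by simp
    moreover have "len (root_reflection b \<otimes> w) < len w" using reflection_len_iff[OF w(1) b(2)] b(3) by blast
    ultimately show False by simp
  qed
  moreover have "p \<in> chamber (inv (inv w))" unfolding chamber_def using w a(1) by auto
  ultimately show "p \<in> (\<Union>w \<in> low_elements 0. chamber (inv w))" by blast
qed

end

theorem theorem6p12:
  fixes W :: "('w, 'x) monoid_scheme" (structure) and S :: "'w set"
    and \<rho> :: "'w \<Rightarrow> 'v::real_vector \<Rightarrow> 'v" and B :: "'v \<Rightarrow> 'v \<Rightarrow> real" and \<alpha> :: "'w \<Rightarrow> 'v"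
    and U :: "'u set" and \<phi> :: "'w \<Rightarrow> 'u \<Rightarrow> 'u" and C :: "'u set"
  assumes "geometric_chambered_set W S \<rho> B \<alpha> U \<phi> C"
    and "chambered_set.solid W \<phi> C"
    and "chambered_set.walled W S \<phi> C"
  shows "geometric_chambered_set.shi_polyhedron W S \<rho> B \<alpha> U \<phi> C 0 =
    (\<Union>w \<in> geometric_representation.low_elements W S \<rho> B \<alpha> 0.
      chambered_set.chamber \<phi> C (inv w))"
proof -
  interpret geometric_chambered_set W S \<rho> B \<alpha> U \<phi> C by fact
  show ?thesis by (rule shi_polyhedron_0)
qed

end
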